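(* Let $\mathcal{A}$ be a constructively Abelian category and $\mathcal{C}\subset\mathcal{A}$ a thick subcategory. Assume that we can (algorithmically) decide whether an object of $\mathcal{A}$ lies in $\mathcal{C}$. Then the Serre quotient category $\mathcal{A}/\mathcal{C}$ is constructively Abelian.
   Context: A thick subcategory $\mathcal{C}$ of an Abelian category $\mathcal{A}$ is a non-empty full subcategory closed under passing to subobjects, factor objects, and forming extensions. The Serre quotient $\mathcal{A}/\mathcal{C}$ has the same objects as $\mathcal{A}$ and $$\mathrm{Hom}_{\mathcal{A}/\mathcal{C}}(M,N)=\varinjlim_{M'\hookrightarrow M,\ N'\hookrightarrow N,\ M/M'\in\mathcal{C},\ N'\in\mathcal{C}}\mathrm{Hom}_{\mathcal{A}}(M',N/N').$$ Thus a morphism $M\to N$ of $\mathcal{A}/\mathcal{C}$ is represented by an $\mathcal{A}$-morphism $M'\to N/N'$ together with the mono $M'\hookrightarrow M$ and the epi $N\twoheadrightarrow N/N'$, where $M/M',N'\in\mathcal{C}$. Constructively Abelian: an Abelian category is called constructively Abelian (or computable) if all existential quantifiers and disjunctions appearing in the axioms of an Abelian category are realized by algorithms. Explicitly, there are algorithms for the following (composition is written in postfix notation, $fg:=g\circ f$): constructing identity morphisms $1_M$; composing composable morphisms; deciding membership in $\mathrm{Hom}(M,N)$; deciding equality of two morphisms in $\mathrm{Hom}(M,N)$; adding and subtracting morphisms in $\mathrm{Hom}(M,N)$ and constructing zero morphisms $0_{MN}$ (for which $\mathrm{Hom}(M,N)$ is an Abelian group); constructing a zero object; constructing a product $M_1\oplus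 M_2$ with its projections, and for $\psi_i:N\to M_i$ ($i=1,2$) the pairing $\{\psi_1,\psi_2\}:N\to M_1\oplus M_2$; constructing for $\varphi:M\to N$ a kernel $\kappa:\ker\varphi\hookrightarrow M$, and for $\tau:L\to M$ with $\tau\varphi=0$ the unique lift of $\tau$ along $\kappa$; constructing a cokernel $\epsilon:N\twoheadrightarrow\operatorname{coker}\varphi$, and for $\eta:N\to L$ with $\varphi\eta=0$ the unique colift of $\eta$ along $\epsilon$; for any mono $\kappa:K\to M$ with cokernel epi $\varphi$ and any $\tau:L\to M$ with $\tau\varphi=0$, constructing the unique lift $L\to K$ of $\tau$ along $\kappa$; for any epi $\epsilon:N\to C$ with kernel mono $\varphi$ and any $\eta:N\to L$ with $\varphi\eta=0$, constructing the unique colift $C\to L$ of $\eta$ along $\epsilon$. *)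

theory Defs
  imports "HOL-Library.Nat_Bijection" "HOL-Algebra.Group"
begin

section \<open>Algorithms\<close>

text \<open>
  Partial recursive functions, in the unary presentation based on a pairing of the natural
  numbers. Undefinedness (None) is divergence.
\<close>

inductive partial_recursive :: "(nat \<Rightarrow> nat option) \<Rightarrow> bool" where
  zero: "partial_recursive (\<lambda>_. Some 0)"
| succ: "partial_recursive (\<lambda>n. Some (Suc n))"
| fst: "partial_recursive (\<lambda>n. Some (fst (prod_decode n)))"
| snd: "partial_recursive (\<lambda>n. Some (snd (prod_decode n)))"
| pair: "partial_recursive (\<lambda>n. Option.bind (f n) (\<lambda>a.
           Option.bind (g n) (\<lambda>b. Some (prod_encode (a, b)))))"
    if "partial_recursive f" "partial_recursive g"
| comp: "partial_recursive (\<lambda>n. Option.bind (g n) f)"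
    if "partial_recursive f" "partial_recursive g"
| prim_rec: "partial_recursive (\<lambda>n. case prod_decode n of (a, k) \<Rightarrow>
           rec_nat (f a) (\<lambda>i r. Option.bind r (\<lambda>v. g (prod_encode (a, prod_encode (i, v))))) k)"
    if "partial_recursive f" "partial_recursive g"
| minimize: "partial_recursive (\<lambda>a.
           if \<exists>n. f (prod_encode (a, n)) = Some 0 \<and>
                  (\<forall>m<n. \<exists>v. f (prod_encode (a, m)) = Some (Suc v))
           then Some (LEAST n. f (prod_encode (a, n)) = Some 0) else None)"
    if "partial_recursive f"

definition returns :: "(nat \<Rightarrow> nat option) \<Rightarrow> nat list \<Rightarrow> nat list \<Rightarrow> bool" where
  "returns a xs ys \<longleftrightarrow> a (list_encode xs) = Some (list_encode ys)"


section \<open>Abelian categories\<close>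

text \<open>Composition is written in postfix order: first the left factor, then the right one.\<close>

record ('o, 'm) category_data =
  Ob :: "'o set"
  Hom :: "'o \<Rightarrow> 'o \<Rightarrow> 'm set"
  Ident :: "'o \<Rightarrow> 'm"
  Comp :: "'m \<Rightarrow> 'm \<Rightarrow> 'm" (infixl "\<cdot>\<index>" 70)
  Add :: "'o \<Rightarrow> 'o \<Rightarrow> 'm \<Rightarrow> 'm \<Rightarrow> 'm"
  Zero :: "'o \<Rightarrow> 'o \<Rightarrow> 'm"

definition hom_group :: "('o, 'm) category_data \<Rightarrow> 'o \<Rightarrow> 'o \<Rightarrow> 'm monoid" where
  "hom_group A M N = \<lparr>carrier = Hom A M N, mult = Add A M N, one = Zero A M N\<rparr>"

definition Minus :: "('o, 'm) category_data \<Rightarrow> 'o \<Rightarrow> 'o \<Rightarrow> 'm \<Rightarrow> 'm \<Rightarrow> 'm" where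
  "Minus A M N \<phi> \<psi> = Add A M N \<phi> (inv\<^bsub>hom_group A M N\<^esub> \<psi>)"

definition is_mono :: "('o, 'm) category_data \<Rightarrow> 'o \<Rightarrow> 'o \<Rightarrow> 'm \<Rightarrow> bool" where
  "is_mono A K M \<kappa> \<longleftrightarrow> \<kappa> \<in> Hom A K M \<and>
    (\<forall>L. \<forall>\<sigma>\<in>Hom A L K. \<forall>\<tau>\<in>Hom A L K. \<sigma> \<cdot>\<^bsub>A\<^esub> \<kappa> = \<tau> \<cdot>\<^bsub>A\<^esub> \<kappa> \<longrightarrow> \<sigma> = \<tau>)"

definition is_epi :: "('o, 'm) category_data \<Rightarrow> 'o \<Rightarrow> 'o \<Rightarrow> 'm \<Rightarrow> bool" where
  "is_epi A N C \<epsilon> \<longleftrightarrow> \<epsilon> \<in> Hom A N C \<and>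
    (\<forall>L. \<forall>\<sigma>\<in>Hom A C L. \<forall>\<tau>\<in>Hom A C L. \<epsilon> \<cdot>\<^bsub>A\<^esub> \<sigma> = \<epsilon> \<cdot>\<^bsub>A\<^esub> \<tau> \<longrightarrow> \<sigma> = \<tau>)"

definition is_zero_object :: "('o, 'm) category_data \<Rightarrow> 'o \<Rightarrow> bool" where
  "is_zero_object A Z \<longleftrightarrow> Z \<in> Ob A \<and>
    (\<forall>M\<in>Ob A. (\<exists>!\<phi>. \<phi> \<in> Hom A M Z) \<and> (\<exists>!\<phi>. \<phi> \<in> Hom A Z M))"

definition is_product ::
  "('o, 'm) category_data \<Rightarrow> 'o \<Rightarrow> 'o \<Rightarrow> 'o \<Rightarrow> 'm \<Rightarrow> 'm \<Rightarrow> bool" where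
  "is_product A M1 M2 P \<pi>1 \<pi>2 \<longleftrightarrow> \<pi>1 \<in> Hom A P M1 \<and> \<pi>2 \<in> Hom A P M2 \<and>
    (\<forall>N. \<forall>\<psi>1\<in>Hom A N M1. \<forall>\<psi>2\<in>Hom A N M2.
      \<exists>!\<psi>. \<psi> \<in> Hom A N P \<and> \<psi> \<cdot>\<^bsub>A\<^esub> \<pi>1 = \<psi>1 \<and> \<psi> \<cdot>\<^bsub>A\<^esub> \<pi>2 = \<psi>2)"

definition is_kernel ::
  "('o, 'm) category_data \<Rightarrow> 'o \<Rightarrow> 'o \<Rightarrow> 'm \<Rightarrow> 'o \<Rightarrow> 'm \<Rightarrow> bool" where
  "is_kernel A M N \<phi> K \<kappa> \<longleftrightarrow> \<phi> \<in> Hom A M N \<and> \<kappa> \<in> Hom A K M \<and> \<kappa> \<cdot>\<^bsub>A\<^esub> \<phi> = Zero A K N \<and>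
    (\<forall>L. \<forall>\<tau>\<in>Hom A L M. \<tau> \<cdot>\<^bsub>A\<^esub> \<phi> = Zero A L N \<longrightarrow>
      (\<exists>!\<sigma>. \<sigma> \<in> Hom A L K \<and> \<sigma> \<cdot>\<^bsub>A\<^esub> \<kappa> = \<tau>))"

definition is_cokernel ::
  "('o, 'm) category_data \<Rightarrow> 'o \<Rightarrow> 'o \<Rightarrow> 'm \<Rightarrow> 'o \<Rightarrow> 'm \<Rightarrow> bool" where
  "is_cokernel A M N \<phi> C \<epsilon> \<longleftrightarrow> \<phi> \<in> Hom A M N \<and> \<epsilon> \<in> Hom A N C \<and> \<phi> \<cdot>\<^bsub>A\<^esub> \<epsilon> = Zero A M C \<and>
    (\<forall>L. \<forall>\<eta>\<in>Hom A N L. \<phi> \<cdot>\<^bsub>A\<^esub> \<eta> = Zero A M L \<longrightarrow>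
      (\<exists>!\<sigma>. \<sigma> \<in> Hom A C L \<and> \<epsilon> \<cdot>\<^bsub>A\<^esub> \<sigma> = \<eta>))"

locale abelian_category =
  fixes A :: "('o, 'm) category_data" (structure)
  assumes hom_objects: "\<phi> \<in> Hom A M N \<Longrightarrow> M \<in> Ob A \<and> N \<in> Ob A"
    and hom_disjoint: "\<phi> \<in> Hom A M N \<Longrightarrow> \<phi> \<in> Hom A M' N' \<Longrightarrow> M = M' \<and> N = N'"
    and ident_hom: "M \<in> Ob A \<Longrightarrow> Ident A M \<in> Hom A M M"
    and comp_hom: "\<phi> \<in> Hom A L M \<Longrightarrow> \<psi> \<in> Hom A M N \<Longrightarrow> \<phi> \<cdot> \<psi> \<in> Hom A L N"
    and ident_left: "\<phi> \<in> Hom A M N \<Longrightarrow> Ident A M \<cdot> \<phi> = \<phi>"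
    and ident_right: "\<phi> \<in> Hom A M N \<Longrightarrow> \<phi> \<cdot> Ident A N = \<phi>"
    and comp_assoc: "\<phi> \<in> Hom A K L \<Longrightarrow> \<psi> \<in> Hom A L M \<Longrightarrow> \<chi> \<in> Hom A M N \<Longrightarrow>
      (\<phi> \<cdot> \<psi>) \<cdot> \<chi> = \<phi> \<cdot> (\<psi> \<cdot> \<chi>)"
    and hom_comm_group: "M \<in> Ob A \<Longrightarrow> N \<in> Ob A \<Longrightarrow> comm_group (hom_group A M N)"
    and comp_add: "\<phi> \<in> Hom A L M \<Longrightarrow> \<psi> \<in> Hom A M N \<Longrightarrow> \<chi> \<in> Hom A M N \<Longrightarrow>
      \<phi> \<cdot> Add A M N \<psi> \<chi> = Add A L N (\<phi> \<cdot> \<psi>) (\<phi> \<cdot> \<chi>)"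
    and add_comp: "\<phi> \<in> Hom A L M \<Longrightarrow> \<psi> \<in> Hom A L M \<Longrightarrow> \<chi> \<in> Hom A M N \<Longrightarrow>
      Add A L M \<phi> \<psi> \<cdot> \<chi> = Add A L N (\<phi> \<cdot> \<chi>) (\<psi> \<cdot> \<chi>)"
    and zero_object: "\<exists>Z. is_zero_object A Z"
    and product: "M1 \<in> Ob A \<Longrightarrow> M2 \<in> Ob A \<Longrightarrow> \<exists>P \<pi>1 \<pi>2. is_product A M1 M2 P \<pi>1 \<pi>2"
    and kernel: "\<phi> \<in> Hom A M N \<Longrightarrow> \<exists>K \<kappa>. is_kernel A M N \<phi> K \<kappa>"
    and cokernel: "\<phi> \<in> Hom A M N \<Longrightarrow> \<exists>C \<epsilon>. is_cokernel A M N \<phi> C \<epsilon>"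
    and mono_normal: "is_mono A K M \<kappa> \<Longrightarrow> is_cokernel A K M \<kappa> C \<phi> \<Longrightarrow> is_kernel A M C \<phi> K \<kappa>"
    and epi_normal: "is_epi A N C \<epsilon> \<Longrightarrow> is_kernel A N C \<epsilon> K \<phi> \<Longrightarrow> is_cokernel A K N \<phi> C \<epsilon>"


section \<open>Constructively Abelian categories\<close>

text \<open>
  To speak of algorithms on the objects and morphisms of a category, these have to be given by
  data. Data are coded by natural numbers; one object or morphism may have several codes.
  The elements of \<open>mor_data\<close> are the candidates among which membership in a Hom set has to be
  decided (think of matrices of any kind, among which one has to recognize those that represent
  a morphism from M to N); \<open>mor_of\<close> is undefined on candidates that represent no morphism.
\<close>

record ('o, 'm) presentation =
  obj_of :: "nat \<Rightarrow> 'o option"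
  mor_data :: "nat set"
  mor_of :: "nat \<Rightarrow> 'm option"

definition is_presentation ::
  "('o, 'm) category_data \<Rightarrow> ('o, 'm) presentation \<Rightarrow> bool" where
  "is_presentation A P \<longleftrightarrow> ran (obj_of P) = Ob A \<and> dom (mor_of P) \<subseteq> mor_data P \<and>
    ran (mor_of P) = (\<Union>M\<in>Ob A. \<Union>N\<in>Ob A. Hom A M N)"

definition obj_codes :: "('o, 'm) presentation \<Rightarrow> nat set" where
  "obj_codes P = dom (obj_of P)"

definition obj :: "('o, 'm) presentation \<Rightarrow> nat \<Rightarrow> 'o" where
  "obj P m = the (obj_of P m)"

definition mor :: "('o, 'm) presentation \<Rightarrow> nat \<Rightarrow> 'm" where
  "mor P f = the (mor_of P f)"

definition hom_codes ::
  "('o, 'm) category_data \<Rightarrow> ('o, 'm) presentation \<Rightarrow> nat \<Rightarrow> nat \<Rightarrow> nat set" where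
  "hom_codes A P m n = {f. m \<in> obj_codes P \<and> n \<in> obj_codes P \<and>
    f \<in> dom (mor_of P) \<and> mor P f \<in> Hom A (obj P m) (obj P n)}"

definition decides_objects ::
  "('o, 'm) presentation \<Rightarrow> 'o set \<Rightarrow> (nat \<Rightarrow> nat option) \<Rightarrow> bool" where
  "decides_objects P C a \<longleftrightarrow> partial_recursive a \<and>
    (\<forall>m\<in>obj_codes P. returns a [m] [of_bool (obj P m \<in> C)])"

text \<open>
  The algorithms are only required to terminate on the inputs described, and they operate on
  codes: different codes of the same input may lead to different outputs.
\<close>

locale constructively_abelian = abelian_category A
  for A :: "('o, 'm) category_data" (structure) +
  fixes P :: "('o, 'm) presentation"
  assumes presentation: "is_presentation A P"
    and alg_ident: "\<exists>a. partial_recursive a \<and>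
      (\<forall>m\<in>obj_codes P. \<exists>i\<in>hom_codes A P m m.
        returns a [m] [i] \<and> mor P i = Ident A (obj P m))"
    and alg_comp: "\<exists>a. partial_recursive a \<and>
      (\<forall>l m n. \<forall>f\<in>hom_codes A P l m. \<forall>g\<in>hom_codes A P m n. \<exists>h\<in>hom_codes A P l n.
        returns a [l, m, n, f, g] [h] \<and> mor P h = mor P f \<cdot> mor P g)"
    and alg_hom_membership: "\<exists>a. partial_recursive a \<and>
      (\<forall>m\<in>obj_codes P. \<forall>n\<in>obj_codes P. \<forall>f\<in>mor_data P.
        returns a [m, n, f] [of_bool (f \<in> hom_codes A P m n)])"
    and alg_hom_equality: "\<exists>a. partial_recursive a \<and>
      (\<forall>m n. \<forall>f\<in>hom_codes A P m n. \<forall>g\<in>hom_codes A P m n.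
        returns a [m, n, f, g] [of_bool (mor P f = mor P g)])"
    and alg_add: "\<exists>a. partial_recursive a \<and>
      (\<forall>m n. \<forall>f\<in>hom_codes A P m n. \<forall>g\<in>hom_codes A P m n. \<exists>h\<in>hom_codes A P m n.
        returns a [m, n, f, g] [h] \<and> mor P h = Add A (obj P m) (obj P n) (mor P f) (mor P g))"
    and alg_minus: "\<exists>a. partial_recursive a \<and>
      (\<forall>m n. \<forall>f\<in>hom_codes A P m n. \<forall>g\<in>hom_codes A P m n. \<exists>h\<in>hom_codes A P m n.
        returns a [m, n, f, g] [h] \<and> mor P h = Minus A (obj P m) (obj P n) (mor P f) (mor P g))"
    and alg_zero: "\<exists>a. partial_recursive a \<and>
      (\<forall>m\<in>obj_codes P. \<forall>n\<in>obj_codes P. \<exists>h\<in>hom_codes A P m n.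
        returns a [m, n] [h] \<and> mor P h = Zero A (obj P m) (obj P n))"
    and alg_zero_object: "\<exists>a. partial_recursive a \<and>
      (\<exists>z\<in>obj_codes P. returns a [] [z] \<and> is_zero_object A (obj P z))"
    and alg_product: "\<exists>a b. partial_recursive a \<and> partial_recursive b \<and>
      (\<forall>m1\<in>obj_codes P. \<forall>m2\<in>obj_codes P.
        \<exists>p\<in>obj_codes P. \<exists>p1\<in>hom_codes A P p m1. \<exists>p2\<in>hom_codes A P p m2.
          returns a [m1, m2] [p, p1, p2] \<and>
          is_product A (obj P m1) (obj P m2) (obj P p) (mor P p1) (mor P p2) \<and>
          (\<forall>n. \<forall>f1\<in>hom_codes A P n m1. \<forall>f2\<in>hom_codes A P n m2. \<exists>u\<in>hom_codes A P n p.
            returns b [m1, m2, n, f1, f2] [u] \<and>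
            mor P u \<cdot> mor P p1 = mor P f1 \<and> mor P u \<cdot> mor P p2 = mor P f2))"
    and alg_kernel: "\<exists>a b. partial_recursive a \<and> partial_recursive b \<and>
      (\<forall>m n. \<forall>f\<in>hom_codes A P m n. \<exists>k\<in>obj_codes P. \<exists>i\<in>hom_codes A P k m.
          returns a [m, n, f] [k, i] \<and>
          is_kernel A (obj P m) (obj P n) (mor P f) (obj P k) (mor P i) \<and>
          (\<forall>l. \<forall>t\<in>hom_codes A P l m. mor P t \<cdot> mor P f = Zero A (obj P l) (obj P n) \<longrightarrow>
            (\<exists>u\<in>hom_codes A P l k. returns b [m, n, f, l, t] [u] \<and> mor P u \<cdot> mor P i = mor P t)))"
    and alg_cokernel: "\<exists>a b. partial_recursive a \<and> partial_recursive b \<and>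
      (\<forall>m n. \<forall>f\<in>hom_codes A P m n. \<exists>c\<in>obj_codes P. \<exists>e\<in>hom_codes A P n c.
          returns a [m, n, f] [c, e] \<and>
          is_cokernel A (obj P m) (obj P n) (mor P f) (obj P c) (mor P e) \<and>
          (\<forall>l. \<forall>t\<in>hom_codes A P n l. mor P f \<cdot> mor P t = Zero A (obj P m) (obj P l) \<longrightarrow>
            (\<exists>u\<in>hom_codes A P c l. returns b [m, n, f, l, t] [u] \<and> mor P e \<cdot> mor P u = mor P t)))"
    and alg_mono_lift: "\<exists>a. partial_recursive a \<and>
      (\<forall>k m c l. \<forall>i\<in>hom_codes A P k m. \<forall>f\<in>hom_codes A P m c. \<forall>t\<in>hom_codes A P l m.
        is_mono A (obj P k) (obj P m) (mor P i) \<longrightarrow>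
        is_cokernel A (obj P k) (obj P m) (mor P i) (obj P c) (mor P f) \<longrightarrow>
        mor P t \<cdot> mor P f = Zero A (obj P l) (obj P c) \<longrightarrow>
        (\<exists>u\<in>hom_codes A P l k. returns a [k, m, c, l, i, f, t] [u] \<and> mor P u \<cdot> mor P i = mor P t))"
    and alg_epi_colift: "\<exists>a. partial_recursive a \<and>
      (\<forall>k n c l. \<forall>e\<in>hom_codes A P n c. \<forall>f\<in>hom_codes A P k n. \<forall>t\<in>hom_codes A P n l.
        is_epi A (obj P n) (obj P c) (mor P e) \<longrightarrow>
        is_kernel A (obj P n) (obj P c) (mor P e) (obj P k) (mor P f) \<longrightarrow>
        mor P f \<cdot> mor P t = Zero A (obj P k) (obj P l) \<longrightarrow>
        (\<exists>u\<in>hom_codes A P c l. returns a [k, n, c, l, e, f, t] [u] \<and> mor P e \<cdot> mor P u = mor P t))"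


section \<open>Thick subcategories and Serre quotients\<close>

text \<open>A full subcategory is given by its class of objects.\<close>

definition thick :: "('o, 'm) category_data \<Rightarrow> 'o set \<Rightarrow> bool" where
  "thick A C \<longleftrightarrow> C \<subseteq> Ob A \<and> C \<noteq> {} \<and>
    (\<forall>K M \<iota>. is_mono A K M \<iota> \<and> M \<in> C \<longrightarrow> K \<in> C) \<and>
    (\<forall>M Q \<pi>. is_epi A M Q \<pi> \<and> M \<in> C \<longrightarrow> Q \<in> C) \<and>
    (\<forall>K M Q \<iota> \<pi>. is_kernel A M Q \<pi> K \<iota> \<and> is_cokernel A K M \<iota> Q \<pi> \<and> K \<in> C \<and> Q \<in> C \<longrightarrow> M \<in> C)"

text \<open>
  A triple (\<open>\<iota>\<close>, \<open>\<phi>\<close>, \<open>\<pi>\<close>) stands for the element \<open>\<phi>\<close> of Hom(M', N/N') at the index given by the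
  mono \<open>\<iota>\<close> from M' to M and the epi \<open>\<pi>\<close> from N to N/N' with kernel N', where M/M' and N' lie in C.
  These are the elements of the disjoint union of the directed system.
\<close>

definition serre_reps ::
  "('o, 'm) category_data \<Rightarrow> 'o set \<Rightarrow> 'o \<Rightarrow> 'o \<Rightarrow> ('m \<times> 'm \<times> 'm) set" where
  "serre_reps A C M N = {(\<iota>, \<phi>, \<pi>). \<exists>M' Q.
    is_mono A M' M \<iota> \<and> (\<exists>X\<in>C. \<exists>\<epsilon>. is_cokernel A M' M \<iota> X \<epsilon>) \<and>
    is_epi A N Q \<pi> \<and> (\<exists>N'\<in>C. \<exists>\<kappa>. is_kernel A N Q \<pi> N' \<kappa>) \<and>
    \<phi> \<in> Hom A M' Q}"

text \<open>
  The transition maps of the directed system restrict \<open>\<phi>\<close> along \<open>\<alpha>\<close> to a smaller subobject of M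
  and compose it with \<open>\<beta>\<close> to a smaller factor object of N.
\<close>

definition serre_transition ::
  "('o, 'm) category_data \<Rightarrow> 'o set \<Rightarrow> 'o \<Rightarrow> 'o \<Rightarrow> (('m \<times> 'm \<times> 'm) \<times> ('m \<times> 'm \<times> 'm)) set" where
  "serre_transition A C M N =
    {((\<iota>, \<phi>, \<pi>), (\<alpha> \<cdot>\<^bsub>A\<^esub> \<iota>, \<alpha> \<cdot>\<^bsub>A\<^esub> \<phi> \<cdot>\<^bsub>A\<^esub> \<beta>, \<pi> \<cdot>\<^bsub>A\<^esub> \<beta>)) | \<iota> \<phi> \<pi> \<alpha> \<beta> M' M'' Q' Q''.
      (\<iota>, \<phi>, \<pi>) \<in> serre_reps A C M N \<and> \<phi> \<in> Hom A M' Q' \<and>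
      \<alpha> \<in> Hom A M'' M' \<and> \<beta> \<in> Hom A Q' Q'' \<and>
      (\<alpha> \<cdot>\<^bsub>A\<^esub> \<iota>, \<alpha> \<cdot>\<^bsub>A\<^esub> \<phi> \<cdot>\<^bsub>A\<^esub> \<beta>, \<pi> \<cdot>\<^bsub>A\<^esub> \<beta>) \<in> serre_reps A C M N}"

text \<open>Two elements are identified in the direct limit iff they agree at some later index.\<close>

definition serre_rel ::
  "('o, 'm) category_data \<Rightarrow> 'o set \<Rightarrow> (('m \<times> 'm \<times> 'm) \<times> ('m \<times> 'm \<times> 'm)) set" where
  "serre_rel A C = {(s, t). \<exists>M N r.
    (s, r) \<in> serre_transition A C M N \<and> (t, r) \<in> serre_transition A C M N}"

abbreviation serre_class ::
  "('o, 'm) category_data \<Rightarrow> 'o set \<Rightarrow> 'm \<times> 'm \<times> 'm \<Rightarrow> ('m \<times> 'm \<times> 'm) set" where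
  "serre_class A C t \<equiv> serre_rel A C `` {t}"

text \<open>
  Composition: let X be a morphism from L to M represented by a map \<open>\<phi>\<close> from L' to M/M1, and Y one
  from M to N represented by a map \<open>\<psi>\<close> from M' to N/N'. Let I be the image (M' + M1)/M1 of
  \<open>\<iota>' \<cdot> \<pi> = \<epsilon> \<cdot> \<mu>\<close>. At sufficiently late indices \<open>\<phi> = \<phi>0 \<cdot> \<mu>\<close> takes values in I and
  \<open>\<psi> = \<epsilon> \<cdot> \<psi>0\<close> is defined on I, and the composite is represented by \<open>\<phi>0 \<cdot> \<psi>0\<close>.
  The unions here and in the addition are over representatives of the resulting class.
\<close>

definition serre_comp ::
  "('o, 'm) category_data \<Rightarrow> 'o set \<Rightarrow> ('m \<times> 'm \<times> 'm) set \<Rightarrow> ('m \<times> 'm \<times> 'm) set \<Rightarrow>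
    ('m \<times> 'm \<times> 'm) set" where
  "serre_comp A C X Y = \<Union> {serre_class A C (\<iota>, \<phi>0 \<cdot>\<^bsub>A\<^esub> \<psi>0, \<pi>') |
    L M N L' M' Q R I \<iota> \<phi>0 \<mu> \<pi> \<iota>' \<epsilon> \<psi>0 \<pi>'.
      (\<iota>, \<phi>0 \<cdot>\<^bsub>A\<^esub> \<mu>, \<pi>) \<in> X \<inter> serre_reps A C L M \<and>
      (\<iota>', \<epsilon> \<cdot>\<^bsub>A\<^esub> \<psi>0, \<pi>') \<in> Y \<inter> serre_reps A C M N \<and>
      is_epi A M' I \<epsilon> \<and> is_mono A I Q \<mu> \<and> \<iota>' \<cdot>\<^bsub>A\<^esub> \<pi> = \<epsilon> \<cdot>\<^bsub>A\<^esub> \<mu> \<and>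
      \<phi>0 \<in> Hom A L' I \<and> \<psi>0 \<in> Hom A I R}"

definition serre_add ::
  "('o, 'm) category_data \<Rightarrow> 'o set \<Rightarrow> 'o \<Rightarrow> 'o \<Rightarrow> ('m \<times> 'm \<times> 'm) set \<Rightarrow> ('m \<times> 'm \<times> 'm) set \<Rightarrow>
    ('m \<times> 'm \<times> 'm) set" where
  "serre_add A C M N X Y = \<Union> {serre_class A C (\<iota>, Add A M' Q \<phi> \<psi>, \<pi>) | M' Q \<iota> \<phi> \<psi> \<pi>.
      (\<iota>, \<phi>, \<pi>) \<in> X \<inter> serre_reps A C M N \<and> (\<iota>, \<psi>, \<pi>) \<in> Y \<inter> serre_reps A C M N \<and>
      \<phi> \<in> Hom A M' Q \<and> \<psi> \<in> Hom A M' Q}"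

definition serre_quotient ::
  "('o, 'm) category_data \<Rightarrow> 'o set \<Rightarrow> ('o, ('m \<times> 'm \<times> 'm) set) category_data" where
  "serre_quotient A C = \<lparr>
    Ob = Ob A,
    Hom = (\<lambda>M N. serre_reps A C M N // serre_rel A C),
    Ident = (\<lambda>M. serre_class A C (Ident A M, Ident A M, Ident A M)),
    Comp = serre_comp A C,
    Add = serre_add A C,
    Zero = (\<lambda>M N. serre_class A C (Ident A M, Zero A M N, Ident A N))\<rparr>"

text \<open>
  Data for A/C: objects are coded as in A. A candidate for a morphism from M to N consists of codes
  of the objects M' and N/N' and of candidates for the mono from M' to M, the morphism from
  M' to N/N' and the epi from N to N/N'.
\<close>

definition serre_presentation ::
  "('o, 'm) category_data \<Rightarrow> 'o set \<Rightarrow> ('o, 'm) presentation \<Rightarrow>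
    ('o, ('m \<times> 'm \<times> 'm) set) presentation" where
  "serre_presentation A C P = \<lparr>
    obj_of = obj_of P,
    mor_data = {list_encode [m', q, i, f, e] | m' q i f e.
      m' \<in> obj_codes P \<and> q \<in> obj_codes P \<and>
      i \<in> mor_data P \<and> f \<in> mor_data P \<and> e \<in> mor_data P},
    mor_of = (\<lambda>x. case list_decode x of
        [m', q, i, f, e] \<Rightarrow>
          (if \<exists>m n. i \<in> hom_codes A P m' m \<and> f \<in> hom_codes A P m' q \<and> e \<in> hom_codes A P n q \<and>
                    (mor P i, mor P f, mor P e) \<in> serre_reps A C (obj P m) (obj P n)
           then Some (serre_class A C (mor P i, mor P f, mor P e)) else None)
      | _ \<Rightarrow> None)\<rparr>"

end

theory Submission
  imports Defs
begin

text \<open>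
  The Serre quotient is treated as a localisation of \<open>A\<close>. Call a morphism small if it factors
  through an object of \<open>C\<close>, and let \<open>sig\<close> be the class of morphisms whose kernel and cokernel lie in
  \<open>C\<close>. Pullbacks along arbitrary morphisms preserve \<open>sig\<close>, so every morphism of the quotient is a left
  fraction \<open>s\<inverse> f\<close> with \<open>s\<close> in \<open>sig\<close>, and two fractions with the same denominator agree iff the
  difference of their numerators is small. Kernels, cokernels and (co)lifts of \<open>s\<inverse> f\<close> are obtained
  from those of \<open>f\<close>; passing to the opposite category gives the dual facts, in particular the
  representation by right fractions needed for cokernels.

  All these constructions are terms in the given algorithms of \<open>A\<close>. A triple \<open>(\<iota>, \<phi>, \<pi>)\<close> is turned into
  a fraction by pulling back \<open>\<phi>\<close> along \<open>\<pi>\<close>, and a fraction \<open>s\<inverse> f\<close> into a triple through the image of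
  \<open>s\<close>. Equality of morphisms and membership in a Hom set reduce to deciding whether the image of a
  numerator, or a kernel or a cokernel, lies in \<open>C\<close>. No search is involved, since the candidates among
  which one would have to search need not be enumerable.
\<close>

section \<open>Abelian categories\<close>

text \<open>The obstacle is the literal form of the quotient: a morphism is a class of triples whose
  outer parts must be a mono and an epi, classes are formed by strict equality at a later index, and
  composition and addition are unions over all admissible representatives. Each operation therefore
  needs two facts: every admissible choice yields the class predicted by a fraction, and some choice
  exists. Two-sided formal fractions contain both the triples and the left fractions and connect the
  two descriptions; a small difference becomes strict equality on its own kernel. Left fractions
  make composition a cancellation, but for colifts the denominator of the test morphism stands on
  the wrong side and has to be moved. The kernel or cokernel handed to the last two algorithms is
  arbitrary, whereas the formulas use the one computed from the numerator; the vanishing condition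
  is carried over by the universal property. The main constructions are stated with their choices as
  parameters, so that existence proofs and computed terms share one correctness argument.\<close>

context abelian_category
begin

definition arr :: "'m \<Rightarrow> bool" where
  "arr f \<longleftrightarrow> (\<exists>M N. f \<in> Hom A M N)"

text \<open>Hom sets of distinct pairs of objects are disjoint, so a morphism determines its ends.
  With ends as functions, typing becomes equational and can be left to the simplifier.\<close>

definition src :: "'m \<Rightarrow> 'o" where
  "src f = (THE M. \<exists>N. f \<in> Hom A M N)"

definition tgt :: "'m \<Rightarrow> 'o" where
  "tgt f = (THE N. \<exists>M. f \<in> Hom A M N)"

definition plus :: "'m \<Rightarrow> 'm \<Rightarrow> 'm" (infixl "\<oplus>" 65) where
  "f \<oplus> g = Add A (src f) (tgt f) f g"

definition minus :: "'m \<Rightarrow> 'm \<Rightarrow> 'm" (infixl "\<ominus>" 65) where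
  "f \<ominus> g = Minus A (src f) (tgt f) f g"

lemma hom_iff: "f \<in> Hom A M N \<longleftrightarrow> arr f \<and> src f = M \<and> tgt f = N"
proof
  assume f: "f \<in> Hom A M N"
  have "src f = M" unfolding src_def using f hom_disjoint by blast
  moreover have "tgt f = N" unfolding tgt_def using f hom_disjoint by blast
  ultimately show "arr f \<and> src f = M \<and> tgt f = N" using f unfolding arr_def by blast
next
  assume *: "arr f \<and> src f = M \<and> tgt f = N"
  then obtain M' N' where f: "f \<in> Hom A M' N'" unfolding arr_def by blast
  have "src f = M'" unfolding src_def using f hom_disjoint by blast
  moreover have "tgt f = N'" unfolding tgt_def using f hom_disjoint by blast
  ultimately show "f \<in> Hom A M N" using * f by blast
qed

lemma arr_Hom: "arr f \<Longrightarrow> f \<in> Hom A (src f) (tgt f)"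
  by (simp add: hom_iff)

lemma src_Ob [simp]: "arr f \<Longrightarrow> src f \<in> Ob A" and tgt_Ob [simp]: "arr f \<Longrightarrow> tgt f \<in> Ob A"
  using arr_Hom hom_objects by blast+

lemma comp_simps [simp]:
  assumes "arr f" "arr g" "tgt f = src g"
  shows "arr (f \<cdot> g)" "src (f \<cdot> g) = src f" "tgt (f \<cdot> g) = tgt g"
  using comp_hom[of f "src f" "tgt f" g "tgt g"] assms by (simp_all add: hom_iff)

lemma assoc [simp]:
  "arr f \<Longrightarrow> arr g \<Longrightarrow> arr h \<Longrightarrow> tgt f = src g \<Longrightarrow> tgt g = src h \<Longrightarrow> (f \<cdot> g) \<cdot> h = f \<cdot> (g \<cdot> h)"
  using comp_assoc[of f "src f" "src g" g "src h" h "tgt h"] by (simp add: hom_iff)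

text \<open>Simplification associates composites to the right, where \<open>f \<cdot> g\<close> is
  no longer a subterm of \<open>f \<cdot> (g \<cdot> x)\<close>. This form applies an equation to
  the two leading factors of such a composite.\<close>

lemma comp_reduce:
  "f \<cdot> g = h \<Longrightarrow> arr f \<Longrightarrow> arr g \<Longrightarrow> tgt f = src g \<Longrightarrow> arr x \<Longrightarrow> tgt g = src x \<Longrightarrow> f \<cdot> (g \<cdot> x) = h \<cdot> x"
  using assoc[of f g x] by simp

lemma id_simps [simp]:
  assumes "M \<in> Ob A"
  shows "arr (Ident A M)" "src (Ident A M) = M" "tgt (Ident A M) = M"
  using ident_hom[OF assms] by (simp_all add: hom_iff)

lemma id_comp [simp]: "arr f \<Longrightarrow> src f = M \<Longrightarrow> Ident A M \<cdot> f = f"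
  using ident_left[of f M "tgt f"] by (simp add: hom_iff)

lemma comp_id [simp]: "arr f \<Longrightarrow> tgt f = N \<Longrightarrow> f \<cdot> Ident A N = f"
  using ident_right[of f "src f" N] by (simp add: hom_iff)

lemma hom_group_simps [simp]:
  "carrier (hom_group A M N) = Hom A M N" "mult (hom_group A M N) = Add A M N"
  "one (hom_group A M N) = Zero A M N"
  by (simp_all add: hom_group_def)

lemma zero_simps [simp]:
  assumes "M \<in> Ob A" "N \<in> Ob A"
  shows "arr (Zero A M N)" "src (Zero A M N) = M" "tgt (Zero A M N) = N"
proof -
  interpret G: comm_group "hom_group A M N" using hom_comm_group assms .
  show "arr (Zero A M N)" "src (Zero A M N) = M" "tgt (Zero A M N) = N"
    using G.one_closed by (simp_all add: hom_iff)
qed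

lemma plus_simps [simp]:
  assumes "arr f" "arr g" "src f = src g" "tgt f = tgt g"
  shows "arr (f \<oplus> g)" "src (f \<oplus> g) = src g" "tgt (f \<oplus> g) = tgt g"
proof -
  interpret G: comm_group "hom_group A (src f) (tgt f)" using hom_comm_group assms by simp
  show "arr (f \<oplus> g)" "src (f \<oplus> g) = src g" "tgt (f \<oplus> g) = tgt g"
    using G.m_closed[of f g] assms by (simp_all add: hom_iff plus_def)
qed

lemma plus_assoc:
  assumes "arr f" "arr g" "arr h" "src f = src g" "tgt f = tgt g" "src g = src h" "tgt g = tgt h"
  shows "(f \<oplus> g) \<oplus> h = f \<oplus> (g \<oplus> h)"
proof -
  interpret G: comm_group "hom_group A (src h) (tgt h)" using hom_comm_group assms by simp
  show ?thesis using G.m_assoc[of f g h] assms plus_simps[of f g]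
    by (simp add: hom_iff plus_def)
qed

lemma plus_comm:
  assumes "arr f" "arr g" "src f = src g" "tgt f = tgt g"
  shows "f \<oplus> g = g \<oplus> f"
proof -
  interpret G: comm_group "hom_group A (src g) (tgt g)" using hom_comm_group assms by simp
  show ?thesis using G.m_comm[of f g] assms by (simp add: hom_iff plus_def)
qed

lemma plus_zero [simp]: "arr f \<Longrightarrow> src f = M \<Longrightarrow> tgt f = N \<Longrightarrow> f \<oplus> Zero A M N = f"
  and zero_plus [simp]: "arr f \<Longrightarrow> src f = M \<Longrightarrow> tgt f = N \<Longrightarrow> Zero A M N \<oplus> f = f"
proof -
  assume a: "arr f" "src f = M" "tgt f = N"
  interpret G: comm_group "hom_group A (src f) (tgt f)"
    using hom_comm_group[of "src f" "tgt f"] a(1) by simp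
  show "f \<oplus> Zero A M N = f" "Zero A M N \<oplus> f = f"
    using G.r_one[of f] G.l_one[of f] a src_Ob[OF a(1)] tgt_Ob[OF a(1)]
    by (auto simp add: hom_iff plus_def)
qed

lemma minus_simps [simp]:
  assumes "arr f" "arr g" "src f = src g" "tgt f = tgt g"
  shows "arr (f \<ominus> g)" "src (f \<ominus> g) = src g" "tgt (f \<ominus> g) = tgt g"
proof -
  interpret G: comm_group "hom_group A (src f) (tgt f)" using hom_comm_group assms by simp
  show "arr (f \<ominus> g)" "src (f \<ominus> g) = src g" "tgt (f \<ominus> g) = tgt g"
    using G.m_closed[of f "inv\<^bsub>hom_group A (src f) (tgt f)\<^esub> g"] G.inv_closed[of g] assms
    by (simp_all add: hom_iff minus_def Minus_def)
qed

lemma minus_plus [simp]: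
  assumes "arr f" "arr g" "src f = src g" "tgt f = tgt g"
  shows "(f \<ominus> g) \<oplus> g = f"
proof -
  interpret G: comm_group "hom_group A (src g) (tgt g)" using hom_comm_group assms by simp
  show ?thesis
    using G.inv_closed[of g] G.m_assoc[of f "inv\<^bsub>hom_group A (src g) (tgt g)\<^esub> g" g] assms
      minus_simps[of f g] G.l_inv[of g] G.r_one[of f]
    by (simp add: hom_iff plus_def minus_def Minus_def)
qed

text \<open>Right cancellation in the Hom group. Characterising the difference by this equation
  keeps inverses out of later computations with \<open>\<ominus>\<close>.\<close>

lemma minus_unique:
  assumes "arr x" "arr g" "src x = src g" "tgt x = tgt g" "x \<oplus> g = f"
  shows "x = f \<ominus> g"
proof -
  interpret G: comm_group "hom_group A (src g) (tgt g)" using hom_comm_group assms by simp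
  have f: "arr f" "src f = src g" "tgt f = tgt g"
    using plus_simps[of x g] assms(1-4) unfolding assms(5) by simp_all
  have "(f \<ominus> g) \<oplus> g = x \<oplus> g"
    using minus_plus[OF f(1) assms(2) f(2,3)] assms(5) by (rule trans[OF _ sym])
  moreover have "f \<ominus> g \<in> Hom A (src g) (tgt g)" "x \<in> Hom A (src g) (tgt g)"
      "g \<in> Hom A (src g) (tgt g)" "src (f \<ominus> g) = src g" "tgt (f \<ominus> g) = tgt g"
    using f assms(1-4) by (simp_all add: hom_iff)
  ultimately show ?thesis using G.right_cancel[of g x "f \<ominus> g"] assms(3,4)
    unfolding plus_def hom_group_simps by metis
qed

lemma minus_self [simp]: "arr f \<Longrightarrow> f \<ominus> f = Zero A (src f) (tgt f)"
  using minus_unique[of "Zero A (src f) (tgt f)" f f] by simp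

lemma minus_zero [simp]: "arr f \<Longrightarrow> src f = M \<Longrightarrow> tgt f = N \<Longrightarrow> f \<ominus> Zero A M N = f"
  using minus_unique[of f "Zero A M N" f] src_Ob tgt_Ob by auto

lemma minus_eq_zero:
  assumes "arr f" "arr g" "src f = src g" "tgt f = tgt g" "f \<ominus> g = Zero A (src g) (tgt g)"
  shows "f = g"
  using minus_plus[of f g] assms by simp

lemma comp_plus [simp]:
  "arr f \<Longrightarrow> arr g \<Longrightarrow> arr h \<Longrightarrow> tgt f = src g \<Longrightarrow> src g = src h \<Longrightarrow> tgt g = tgt h \<Longrightarrow>
    f \<cdot> (g \<oplus> h) = f \<cdot> g \<oplus> f \<cdot> h"
  using comp_add[of f "src f" "src g" g "tgt g" h] by (simp add: hom_iff plus_def)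

lemma plus_comp [simp]:
  "arr f \<Longrightarrow> arr g \<Longrightarrow> arr h \<Longrightarrow> src f = src g \<Longrightarrow> tgt f = tgt g \<Longrightarrow> tgt g = src h \<Longrightarrow>
    (f \<oplus> g) \<cdot> h = f \<cdot> h \<oplus> g \<cdot> h"
  using add_comp[of f "src f" "tgt f" g h "tgt h"] by (simp add: hom_iff plus_def)

lemma comp_minus [simp]:
  assumes "arr f" "arr g" "arr h" "tgt f = src g" "src g = src h" "tgt g = tgt h"
  shows "f \<cdot> (g \<ominus> h) = f \<cdot> g \<ominus> f \<cdot> h"
proof (rule minus_unique)
  show "f \<cdot> (g \<ominus> h) \<oplus> f \<cdot> h = f \<cdot> g"
    using comp_plus[of f "g \<ominus> h" h] assms by (simp del: comp_plus)
qed (use assms in simp_all)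

lemma minus_comp [simp]:
  assumes "arr f" "arr g" "arr h" "src f = src g" "tgt f = tgt g" "tgt g = src h"
  shows "(f \<ominus> g) \<cdot> h = f \<cdot> h \<ominus> g \<cdot> h"
proof (rule minus_unique)
  show "(f \<ominus> g) \<cdot> h \<oplus> g \<cdot> h = f \<cdot> h"
    using plus_comp[of "f \<ominus> g" g h] assms by (simp del: plus_comp)
qed (use assms in simp_all)

lemma comp_zero [simp]:
  assumes "arr f" "tgt f = M" "N \<in> Ob A"
  shows "f \<cdot> Zero A M N = Zero A (src f) N"
proof -
  have M: "M \<in> Ob A" using tgt_Ob[OF assms(1)] assms(2) by simp
  have "f \<cdot> (Zero A M N \<ominus> Zero A M N) = f \<cdot> Zero A M N \<ominus> f \<cdot> Zero A M N"
    using assms M by (intro comp_minus) simp_all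
  then show ?thesis using assms M by simp
qed

lemma zero_comp [simp]:
  assumes "arr f" "src f = N" "M \<in> Ob A"
  shows "Zero A M N \<cdot> f = Zero A M (tgt f)"
proof -
  have N: "N \<in> Ob A" using src_Ob[OF assms(1)] assms(2) by simp
  have "(Zero A M N \<ominus> Zero A M N) \<cdot> f = Zero A M N \<cdot> f \<ominus> Zero A M N \<cdot> f"
    using assms N by (intro minus_comp) simp_all
  then show ?thesis using assms N by simp
qed

subsection \<open>Monomorphisms, kernels and images\<close>

text \<open>Two morphisms with the same composite have a difference whose composite is zero, so
  additivity reduces cancellation to a test against zero.\<close>

lemma is_mono_iff:
  "is_mono A K M k \<longleftrightarrow> arr k \<and> src k = K \<and> tgt k = M \<and>
    (\<forall>x. arr x \<longrightarrow> tgt x = K \<longrightarrow> x \<cdot> k = Zero A (src x) M \<longrightarrow> x = Zero A (src x) K)"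
proof (intro iffI)
  assume m: "is_mono A K M k"
  then have k: "arr k \<and> src k = K \<and> tgt k = M" by (simp add: is_mono_def hom_iff)
  moreover have "x = Zero A (src x) K" if "arr x" "tgt x = K" "x \<cdot> k = Zero A (src x) M" for x
  proof -
    have "s = t" if "s \<in> Hom A L K" "t \<in> Hom A L K" "s \<cdot> k = t \<cdot> k" for L s t
      using m that unfolding is_mono_def by blast
    then show ?thesis using that k src_Ob[of k] by (simp add: hom_iff)
  qed
  ultimately show "arr k \<and> src k = K \<and> tgt k = M \<and>
    (\<forall>x. arr x \<longrightarrow> tgt x = K \<longrightarrow> x \<cdot> k = Zero A (src x) M \<longrightarrow> x = Zero A (src x) K)" by blast
next
  assume m: "arr k \<and> src k = K \<and> tgt k = M \<and>
    (\<forall>x. arr x \<longrightarrow> tgt x = K \<longrightarrow> x \<cdot> k = Zero A (src x) M \<longrightarrow> x = Zero A (src x) K)"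
  have "x = y" if "arr x" "arr y" "src x = src y" "tgt x = K" "tgt y = K" "x \<cdot> k = y \<cdot> k" for x y
  proof -
    note [simp] = that(1-5) m[THEN conjunct1] m[THEN conjunct2, THEN conjunct1]
      m[THEN conjunct2, THEN conjunct2, THEN conjunct1]
    have "x \<ominus> y = Zero A (src (x \<ominus> y)) K"
      by (rule m[THEN conjunct2, THEN conjunct2, THEN conjunct2, rule_format]) (simp_all add: that(6))
    then show ?thesis by - (rule minus_eq_zero, simp_all)
  qed
  then show "is_mono A K M k" using m by (auto simp: is_mono_def hom_iff)
qed

lemma is_epi_iff:
  "is_epi A M K k \<longleftrightarrow> arr k \<and> src k = M \<and> tgt k = K \<and>
    (\<forall>x. arr x \<longrightarrow> src x = K \<longrightarrow> k \<cdot> x = Zero A M (tgt x) \<longrightarrow> x = Zero A K (tgt x))"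
proof (intro iffI)
  assume m: "is_epi A M K k"
  then have k: "arr k \<and> src k = M \<and> tgt k = K" by (simp add: is_epi_def hom_iff)
  moreover have "x = Zero A K (tgt x)" if "arr x" "src x = K" "k \<cdot> x = Zero A M (tgt x)" for x
  proof -
    have "s = t" if "s \<in> Hom A K L" "t \<in> Hom A K L" "k \<cdot> s = k \<cdot> t" for L s t
      using m that unfolding is_epi_def by blast
    then show ?thesis using that k tgt_Ob[of k] by (simp add: hom_iff)
  qed
  ultimately show "arr k \<and> src k = M \<and> tgt k = K \<and>
    (\<forall>x. arr x \<longrightarrow> src x = K \<longrightarrow> k \<cdot> x = Zero A M (tgt x) \<longrightarrow> x = Zero A K (tgt x))" by blast
next
  assume m: "arr k \<and> src k = M \<and> tgt k = K \<and>
    (\<forall>x. arr x \<longrightarrow> src x = K \<longrightarrow> k \<cdot> x = Zero A M (tgt x) \<longrightarrow> x = Zero A K (tgt x))"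
  have "x = y" if "arr x" "arr y" "tgt x = tgt y" "src x = K" "src y = K" "k \<cdot> x = k \<cdot> y" for x y
  proof -
    note [simp] = that(1-5) m[THEN conjunct1] m[THEN conjunct2, THEN conjunct1]
      m[THEN conjunct2, THEN conjunct2, THEN conjunct1]
    have "x \<ominus> y = Zero A K (tgt (x \<ominus> y))"
      by (rule m[THEN conjunct2, THEN conjunct2, THEN conjunct2, rule_format]) (simp_all add: that(6))
    then show ?thesis by - (rule minus_eq_zero, simp_all)
  qed
  then show "is_epi A M K k" using m by (auto simp: is_epi_def hom_iff)
qed

lemma is_monoD:
  assumes "is_mono A K M k" shows "arr k" "src k = K" "tgt k = M"
  using assms by (simp_all add: is_mono_iff)

lemma mono_zero:
  "is_mono A K M k \<Longrightarrow> arr x \<Longrightarrow> tgt x = K \<Longrightarrow> x \<cdot> k = Zero A (src x) M \<Longrightarrow> x = Zero A (src x) K"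
  by (simp add: is_mono_iff)

lemma is_epiD:
  assumes "is_epi A M K k" shows "arr k" "src k = M" "tgt k = K"
  using assms by (simp_all add: is_epi_iff)

lemma epi_zero:
  "is_epi A M K k \<Longrightarrow> arr x \<Longrightarrow> src x = K \<Longrightarrow> k \<cdot> x = Zero A M (tgt x) \<Longrightarrow> x = Zero A K (tgt x)"
  by (simp add: is_epi_iff)

lemma mono_cancel:
  "is_mono A K M k \<Longrightarrow> arr x \<Longrightarrow> arr y \<Longrightarrow> src x = src y \<Longrightarrow> tgt x = K \<Longrightarrow> tgt y = K \<Longrightarrow>
    x \<cdot> k = y \<cdot> k \<Longrightarrow> x = y"
  by (auto simp: is_mono_def hom_iff)

text \<open>The mono property comes from the uniqueness of lifts: if
  \<open>x \<cdot> k = y \<cdot> k\<close>, then \<open>x\<close> and \<open>y\<close> lift the same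
  morphism.\<close>

lemma is_kernelD:
  assumes "is_kernel A M N f K k"
  shows "arr f" "src f = M" "tgt f = N" "arr k" "src k = K" "tgt k = M" "k \<cdot> f = Zero A K N"
    "is_mono A K M k"
proof -
  show *: "arr f" "src f = M" "tgt f = N" "arr k" "src k = K" "tgt k = M" "k \<cdot> f = Zero A K N"
    using assms by (simp_all add: is_kernel_def hom_iff)
  have "x = y" if "arr x" "arr y" "src x = src y" "tgt x = K" "tgt y = K" "x \<cdot> k = y \<cdot> k" for x y
  proof -
    have "(x \<cdot> k) \<cdot> f = Zero A (src x) N" using * that by auto
    moreover have "x \<cdot> k \<in> Hom A (src x) M" using * that by (simp add: hom_iff)
    ultimately have "\<exists>!s. s \<in> Hom A (src x) K \<and> s \<cdot> k = x \<cdot> k"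
      using assms * that unfolding is_kernel_def by simp
    moreover have "x \<in> Hom A (src x) K" "y \<in> Hom A (src x) K" using that by (simp_all add: hom_iff)
    ultimately show ?thesis using that(6) by metis
  qed
  then show "is_mono A K M k" using * by (auto simp: is_mono_def hom_iff)
qed

lemma is_cokernelD:
  assumes "is_cokernel A M N f K k"
  shows "arr f" "src f = M" "tgt f = N" "arr k" "src k = N" "tgt k = K" "f \<cdot> k = Zero A M K"
    "is_epi A N K k"
proof -
  show *: "arr f" "src f = M" "tgt f = N" "arr k" "src k = N" "tgt k = K" "f \<cdot> k = Zero A M K"
    using assms by (simp_all add: is_cokernel_def hom_iff)
  have "x = y" if "arr x" "arr y" "tgt x = tgt y" "src x = K" "src y = K" "k \<cdot> x = k \<cdot> y" for x y
  proof -
    have "f \<cdot> (k \<cdot> x) = Zero A M (tgt x)"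
      using * that comp_reduce[OF *(7), of x] by auto
    moreover have "k \<cdot> x \<in> Hom A N (tgt x)" using * that by (simp add: hom_iff)
    ultimately have "\<exists>!s. s \<in> Hom A K (tgt x) \<and> k \<cdot> s = k \<cdot> x"
      using assms * that unfolding is_cokernel_def by simp
    moreover have "x \<in> Hom A K (tgt x)" "y \<in> Hom A K (tgt x)" using that by (simp_all add: hom_iff)
    ultimately show ?thesis using that(6) by metis
  qed
  then show "is_epi A N K k" using * by (auto simp: is_epi_def hom_iff)
qed

lemma kernel_lift:
  assumes "is_kernel A M N f K k" "arr t" "tgt t = M" "t \<cdot> f = Zero A (src t) N"
  obtains u where "arr u" "src u = src t" "tgt u = K" "u \<cdot> k = t"
  using assms unfolding is_kernel_def Ball_def hom_iff by blast

lemma cokernel_colift: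
  assumes "is_cokernel A M N f K k" "arr t" "src t = N" "f \<cdot> t = Zero A M (tgt t)"
  obtains u where "arr u" "tgt u = tgt t" "src u = K" "k \<cdot> u = t"
  using assms unfolding is_cokernel_def Ball_def hom_iff by blast

lemma kernel_ex:
  assumes "arr f" obtains K k where "is_kernel A (src f) (tgt f) f K k"
  using kernel[OF arr_Hom[OF assms]] by blast

lemma cokernel_ex:
  assumes "arr f" obtains K k where "is_cokernel A (src f) (tgt f) f K k"
  using cokernel[OF arr_Hom[OF assms]] by blast

lemma is_kernelI:
  assumes f: "arr f" "src f = M" "tgt f = N" and k: "is_mono A K M k" "k \<cdot> f = Zero A K N"
    and l: "\<And>t. arr t \<Longrightarrow> tgt t = M \<Longrightarrow> t \<cdot> f = Zero A (src t) N \<Longrightarrow>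
      \<exists>u. arr u \<and> src u = src t \<and> tgt u = K \<and> u \<cdot> k = t"
  shows "is_kernel A M N f K k"
  unfolding is_kernel_def Ball_def hom_iff
proof (intro conjI allI impI f k)
  show "arr k" "src k = K" "tgt k = M" using k(1) by (simp_all add: is_mono_iff)
  fix L t assume t: "arr t \<and> src t = L \<and> tgt t = M" "t \<cdot> f = Zero A L N"
  then obtain u where u: "arr u" "src u = L" "tgt u = K" "u \<cdot> k = t" using l[of t] by auto
  show "\<exists>!u. (arr u \<and> src u = L \<and> tgt u = K) \<and> u \<cdot> k = t"
  proof (intro ex1I[of _ u])
    fix v assume v: "(arr v \<and> src v = L \<and> tgt v = K) \<and> v \<cdot> k = t"
    show "v = u" by (rule mono_cancel[OF k(1)]) (simp_all only: u v)
  qed (simp add: u)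
qed

lemma mono_comp:
  assumes f: "is_mono A K L f" and g: "is_mono A L M g" shows "is_mono A K M (f \<cdot> g)"
  unfolding is_mono_iff
proof (intro conjI allI impI)
  note [simp] = is_monoD[OF f] is_monoD[OF g]
  show "arr (f \<cdot> g)" "src (f \<cdot> g) = K" "tgt (f \<cdot> g) = M" by simp_all
  fix x assume [simp]: "arr x" "tgt x = K" and *: "x \<cdot> (f \<cdot> g) = Zero A (src x) M"
  have "x \<cdot> f = Zero A (src x) L" using mono_zero[OF g, of "x \<cdot> f"] * by simp
  then show "x = Zero A (src x) K" by - (rule mono_zero[OF f], simp_all)
qed

lemma mono_comp_left:
  assumes fg: "is_mono A K M (f \<cdot> g)" and [simp]: "arr f" "arr g" "tgt f = src g"
  shows "is_mono A K (src g) f"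
  unfolding is_mono_iff
proof (intro conjI allI impI)
  have [simp]: "src f = K" "tgt g = M" using is_monoD[OF fg] by simp_all
  show "arr f" "src f = K" "tgt f = src g" by simp_all
  fix x assume [simp]: "arr x" "tgt x = K" and *: "x \<cdot> f = Zero A (src x) (src g)"
  have "x \<cdot> (f \<cdot> g) = Zero A (src x) M" using comp_reduce[OF *, of g] by simp
  then show "x = Zero A (src x) K" by - (rule mono_zero[OF fg], simp_all)
qed

lemma epi_comp:
  assumes f: "is_epi A K L f" and g: "is_epi A L M g" shows "is_epi A K M (f \<cdot> g)"
  unfolding is_epi_iff
proof (intro conjI allI impI)
  note [simp] = is_epiD[OF f] is_epiD[OF g]
  show "arr (f \<cdot> g)" "src (f \<cdot> g) = K" "tgt (f \<cdot> g) = M" by simp_all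
  fix x assume [simp]: "arr x" "src x = M" and *: "(f \<cdot> g) \<cdot> x = Zero A K (tgt x)"
  have "g \<cdot> x = Zero A L (tgt x)" using epi_zero[OF f, of "g \<cdot> x"] * by simp
  then show "x = Zero A M (tgt x)" by - (rule epi_zero[OF g], simp_all)
qed

lemma epi_comp_right:
  assumes fg: "is_epi A K M (f \<cdot> g)" and [simp]: "arr f" "arr g" "tgt f = src g"
  shows "is_epi A (src g) M g"
  unfolding is_epi_iff
proof (intro conjI allI impI)
  have [simp]: "src f = K" "tgt g = M" using is_epiD[OF fg] by simp_all
  show "arr g" "src g = src g" "tgt g = M" by simp_all
  fix x assume [simp]: "arr x" "src x = M" and *: "g \<cdot> x = Zero A (src g) (tgt x)"
  have "(f \<cdot> g) \<cdot> x = Zero A K (tgt x)" using * by simp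
  then show "x = Zero A M (tgt x)" by - (rule epi_zero[OF fg], simp_all)
qed

lemma mono_id: "M \<in> Ob A \<Longrightarrow> is_mono A M M (Ident A M)"
  by (simp add: is_mono_iff)

lemma epi_id: "M \<in> Ob A \<Longrightarrow> is_epi A M M (Ident A M)"
  by (simp add: is_epi_iff)

lemma kernel_of_cokernel:
  assumes "is_mono A K M i"
  obtains D c where "is_cokernel A K M i D c" "is_kernel A M D c K i"
proof -
  have "i \<in> Hom A K M" using assms by (simp add: is_mono_def)
  then obtain D c where c: "is_cokernel A K M i D c" using cokernel by blast
  then show ?thesis using mono_normal[OF assms c] that by blast
qed

lemma cokernel_of_kernel:
  assumes "is_epi A M K i"
  obtains D c where "is_kernel A M K i D c" "is_cokernel A D M c K i"
proof -
  have "i \<in> Hom A M K" using assms by (simp add: is_epi_def)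
  then obtain D c where c: "is_kernel A M K i D c" using kernel by blast
  then show ?thesis using epi_normal[OF assms c] that by blast
qed

text \<open>If \<open>e \<cdot> x\<close> is zero, then \<open>e\<close>, and with it
  \<open>f\<close>, factors through the subobject \<open>j \<cdot> m\<close>, where \<open>j\<close>
  is the kernel of \<open>x\<close>. A mono is the kernel of its cokernel, so a subobject through
  which \<open>f\<close> factors also contains \<open>m\<close>, the kernel of the cokernel of
  \<open>f\<close>. Hence \<open>j\<close> has a section \<open>u\<close>, and
  \<open>x = u \<cdot> (j \<cdot> x)\<close> vanishes.\<close>

lemma image_epi:
  assumes f: "arr f" "src f = M" and c: "is_cokernel A M N f D c"
    and m: "is_kernel A N D c I m"
    and e: "arr e" "src e = M" "tgt e = I" "e \<cdot> m = f"
  shows "is_epi A M I e"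
  unfolding is_epi_iff
proof (intro conjI allI impI e)
  note [simp] = f e is_cokernelD[OF c] is_kernelD(4-7)[OF m]
  fix x assume [simp]: "arr x" "src x = I" and x: "e \<cdot> x = Zero A M (tgt x)"
  obtain J j where j: "is_kernel A (src x) (tgt x) x J j" using kernel_ex[OF \<open>arr x\<close>] .
  note [simp] = is_kernelD(4-7)[OF j]
  obtain e' where e' [simp]: "arr e'" "src e' = M" "tgt e' = J" "e' \<cdot> j = e"
    by (rule kernel_lift[OF j, of e]) (use x in simp_all)
  have jm: "is_mono A J N (j \<cdot> m)"
    using mono_comp[of J I j N m] is_kernelD(8)[OF j] is_kernelD(8)[OF m] by simp
  obtain E d where d: "is_cokernel A J N (j \<cdot> m) E d"
    and kd: "is_kernel A N E d J (j \<cdot> m)" using kernel_of_cokernel[OF jm] .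
  note [simp] = is_cokernelD(4-6)[OF d]
  have "f \<cdot> d = e' \<cdot> ((j \<cdot> m) \<cdot> d)" using comp_reduce[OF e'(4), of "m \<cdot> d"] comp_reduce[OF e(4), of d]
    by simp
  also have "\<dots> = Zero A M E" using tgt_Ob[of d] by (subst is_cokernelD(7)[OF d]) simp
  finally have fd: "f \<cdot> d = Zero A M E" .
  obtain w where w [simp]: "arr w" "tgt w = E" "src w = D" "c \<cdot> w = d"
    by (rule cokernel_colift[OF c, of d]) (use fd in simp_all)
  have "m \<cdot> d = Zero A I E"
    using comp_reduce[OF is_kernelD(7)[OF m], of w] tgt_Ob[of x] src_Ob[of x] by simp
  then obtain u where u [simp]: "arr u" "src u = I" "tgt u = J" "u \<cdot> (j \<cdot> m) = m"
    by - (rule kernel_lift[OF kd, of m], simp_all)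
  have I: "I \<in> Ob A" using src_Ob[of x] by simp
  have "u \<cdot> j = Ident A I"
    by (rule mono_cancel[OF is_kernelD(8)[OF m]]) (use I in simp_all)
  from comp_reduce[OF this, of x] have "x = u \<cdot> (j \<cdot> x)" by simp
  also have "\<dots> = Zero A I (tgt x)" by simp
  finally show "x = Zero A I (tgt x)" .
qed

lemma image_ex:
  assumes f: "arr f"
  obtains I e m where "is_epi A (src f) I e" "is_mono A I (tgt f) m" "e \<cdot> m = f"
proof -
  obtain D c where c: "is_cokernel A (src f) (tgt f) f D c" using cokernel_ex[OF f] .
  obtain I m where m: "is_kernel A (tgt f) D c I m"
    using kernel_ex[OF is_cokernelD(4)[OF c]] is_cokernelD(5,6)[OF c] by metis
  obtain e where e: "arr e" "src e = src f" "tgt e = I" "e \<cdot> m = f"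
    using kernel_lift[OF m f refl is_cokernelD(7)[OF c]] .
  have "is_epi A (src f) I e" using image_epi[OF f refl c m e] .
  then show ?thesis using that e(4) is_kernelD(8)[OF m] by blast
qed

text \<open>An epi is the cokernel of its kernel, so it suffices to apply the hypothesis to that
  kernel. Stating it for arbitrary \<open>x\<close> lets callers argue as with elements.\<close>

lemma epi_factor:
  assumes e: "is_epi A M I e" and t: "arr t" "src t = M"
    and z: "\<And>x. arr x \<Longrightarrow> tgt x = M \<Longrightarrow> x \<cdot> e = Zero A (src x) I \<Longrightarrow> x \<cdot> t = Zero A (src x) (tgt t)"
  obtains u where "arr u" "src u = I" "tgt u = tgt t" "e \<cdot> u = t"
proof -
  obtain K k where k: "is_kernel A M I e K k" and c: "is_cokernel A K M k I e"
    using cokernel_of_kernel[OF e] .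
  have "k \<cdot> t = Zero A K (tgt t)" using z[of k] is_kernelD(4-7)[OF k] by simp
  then show ?thesis using cokernel_colift[OF c t] that by metis
qed

subsection \<open>Biproducts and duality\<close>

lemma is_productD:
  assumes "is_product A M N P p q"
  shows "arr p" "src p = P" "tgt p = M" "arr q" "src q = P" "tgt q = N"
  using assms by (simp_all add: is_product_def hom_iff)

lemma product_pair:
  assumes P: "is_product A M N P p q"
    and f: "arr f" "arr g" "tgt f = M" "tgt g = N" "src f = src g"
  obtains u where "arr u" "src u = src f" "tgt u = P" "u \<cdot> p = f" "u \<cdot> q = g"
proof -
  have "f \<in> Hom A (src f) M" "g \<in> Hom A (src f) N" using f by (simp_all add: hom_iff)
  with P obtain u where "u \<in> Hom A (src f) P" "u \<cdot> p = f" "u \<cdot> q = g"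
    unfolding is_product_def by blast
  then show ?thesis using that unfolding hom_iff by blast
qed

lemma product_unique:
  assumes P: "is_product A M N P p q"
    and u: "arr u" "arr v" "src u = src v" "tgt u = P" "tgt v = P"
    and e: "u \<cdot> p = v \<cdot> p" "u \<cdot> q = v \<cdot> q"
  shows "u = v"
proof -
  note [simp] = is_productD[OF P]
  have "v \<cdot> p \<in> Hom A (src v) M" "v \<cdot> q \<in> Hom A (src v) N" using u by (simp_all add: hom_iff)
  then have "\<exists>!w. w \<in> Hom A (src v) P \<and> w \<cdot> p = v \<cdot> p \<and> w \<cdot> q = v \<cdot> q"
    using P unfolding is_product_def by blast
  moreover have "u \<in> Hom A (src v) P" "v \<in> Hom A (src v) P" using u by (simp_all add: hom_iff)
  ultimately show ?thesis using e by blast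
qed

lemma product_Ob:
  assumes "is_product A M N P p q" shows "M \<in> Ob A" "N \<in> Ob A" "P \<in> Ob A"
  using is_productD[OF assms] src_Ob[of p] tgt_Ob[of p] tgt_Ob[of q] by auto

text \<open>The injections pair an identity with a zero morphism; the decomposition of the identity
  holds because both sides have the same two projections.\<close>

lemma biproduct:
  assumes P: "is_product A M N P p q"
  obtains i j where "arr i" "src i = M" "tgt i = P" "arr j" "src j = N" "tgt j = P"
    "i \<cdot> p = Ident A M" "i \<cdot> q = Zero A M N" "j \<cdot> p = Zero A N M" "j \<cdot> q = Ident A N"
    "p \<cdot> i \<oplus> q \<cdot> j = Ident A P"
proof -
  note [simp] = is_productD[OF P] product_Ob[OF P]
  obtain i where i [simp]: "arr i" "src i = M" "tgt i = P" "i \<cdot> p = Ident A M" "i \<cdot> q = Zero A M N"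
    using product_pair[OF P, of "Ident A M" "Zero A M N"] by auto
  obtain j where j [simp]: "arr j" "src j = N" "tgt j = P" "j \<cdot> p = Zero A N M" "j \<cdot> q = Ident A N"
    using product_pair[OF P, of "Zero A N M" "Ident A N"] by auto
  have "p \<cdot> i \<oplus> q \<cdot> j = Ident A P"
    by (rule product_unique[OF P]) simp_all
  then show ?thesis using that i j by blast
qed

end

section \<open>The opposite category\<close>

definition opc :: "('o, 'm) category_data \<Rightarrow> ('o, 'm) category_data" where
  "opc A = \<lparr>Ob = Ob A, Hom = (\<lambda>M N. Hom A N M), Ident = Ident A, Comp = (\<lambda>f g. Comp A g f),
    Add = (\<lambda>M N. Add A N M), Zero = (\<lambda>M N. Zero A N M)\<rparr>"

lemma opc_simps [simp]:
  "Ob (opc A) = Ob A" "Hom (opc A) M N = Hom A N M" "Ident (opc A) = Ident A"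
  "Comp (opc A) f g = Comp A g f" "Add (opc A) M N = Add A N M" "Zero (opc A) M N = Zero A N M"
  "hom_group (opc A) M N = hom_group A N M" "Minus (opc A) M N = Minus A N M"
  by (simp_all add: opc_def hom_group_def Minus_def fun_eq_iff)

text \<open>Reversing arrows carries each definition to its dual up to the shape of the formula.
  Simplification therefore turns a result about \<open>opc A\<close> into the dual result about
  \<open>A\<close>.\<close>

lemma opc_universal [simp]:
  "is_mono (opc A) K M k = is_epi A M K k" "is_epi (opc A) M K k = is_mono A K M k"
  "is_kernel (opc A) M N f K k = is_cokernel A N M f K k"
  "is_cokernel (opc A) N M f K k = is_kernel A M N f K k"
  by (auto simp: is_mono_def is_epi_def is_kernel_def is_cokernel_def)

text \<open>The axioms provide products, so for the opposite category the injections must be shown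
  to form a coproduct. The mediating morphism of \<open>f\<close> and \<open>g\<close> is
  \<open>p \<cdot> f \<oplus> q \<cdot> g\<close>; its uniqueness follows from the decomposition of
  \<open>Ident A P\<close>.\<close>

lemma (in abelian_category) is_product_opc:
  assumes P: "is_product A M N P p q"
    and i: "arr i" "src i = M" "tgt i = P" and j: "arr j" "src j = N" "tgt j = P"
    and ij: "i \<cdot> p = Ident A M" "i \<cdot> q = Zero A M N" "j \<cdot> p = Zero A N M" "j \<cdot> q = Ident A N"
  shows "is_product (opc A) M N P i j"
proof -
  note [simp] = is_productD[OF P] product_Ob[OF P] i j ij
  have e: "p \<cdot> i \<oplus> q \<cdot> j = Ident A P" by (rule product_unique[OF P]) simp_all
  note [simp] = comp_reduce[OF ij(1)] comp_reduce[OF ij(2)] comp_reduce[OF ij(3)] comp_reduce[OF ij(4)]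
  show ?thesis
    unfolding is_product_def opc_simps
  proof (intro conjI ballI allI)
    fix T f g assume "f \<in> Hom A M T" "g \<in> Hom A N T"
    then have fg [simp]: "arr f" "src f = M" "tgt f = T" "arr g" "src g = N" "tgt g = T"
      by (simp_all add: hom_iff)
    have [simp]: "T \<in> Ob A" using tgt_Ob[of f] by simp
    show "\<exists>!u. u \<in> Hom A P T \<and> i \<cdot> u = f \<and> j \<cdot> u = g"
    proof (rule ex1I[of _ "p \<cdot> f \<oplus> q \<cdot> g"])
      show "p \<cdot> f \<oplus> q \<cdot> g \<in> Hom A P T \<and> i \<cdot> (p \<cdot> f \<oplus> q \<cdot> g) = f \<and> j \<cdot> (p \<cdot> f \<oplus> q \<cdot> g) = g"
        by (simp add: hom_iff)
      fix u assume u: "u \<in> Hom A P T \<and> i \<cdot> u = f \<and> j \<cdot> u = g"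
      then have [simp]: "arr u" "src u = P" "tgt u = T" by (simp_all add: hom_iff)
      have "u = (p \<cdot> i \<oplus> q \<cdot> j) \<cdot> u" unfolding e by simp
      also have "\<dots> = p \<cdot> f \<oplus> q \<cdot> g" using u by simp
      finally show "u = p \<cdot> f \<oplus> q \<cdot> g" .
    qed
  qed (simp_all add: hom_iff)
qed

lemma (in abelian_category) abelian_category_opc: "abelian_category (opc A)"
proof (rule abelian_category.intro)
  show "\<exists>Z. is_zero_object (opc A) Z"
    using zero_object by (simp add: is_zero_object_def conj_commute)
next
  fix M N assume "M \<in> Ob (opc A)" "N \<in> Ob (opc A)"
  then have "M \<in> Ob A" "N \<in> Ob A" by simp_all
  then obtain P p q where P: "is_product A M N P p q" using product by blast
  obtain i j where "arr i" "src i = M" "tgt i = P" "arr j" "src j = N" "tgt j = P"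
    "i \<cdot> p = Ident A M" "i \<cdot> q = Zero A M N" "j \<cdot> p = Zero A N M" "j \<cdot> q = Ident A N" using biproduct[OF P] .
  then have "is_product (opc A) M N P i j" by (rule is_product_opc[OF P])
  then show "\<exists>P p q. is_product (opc A) M N P p q" by blast
next
  fix M N assume "M \<in> Ob (opc A)" "N \<in> Ob (opc A)"
  then show "comm_group (hom_group (opc A) M N)" using hom_comm_group by simp
next
  fix M N f assume "f \<in> Hom (opc A) M N"
  then have f: "f \<in> Hom A N M" by simp
  show "\<exists>K k. is_kernel (opc A) M N f K k" "\<exists>K k. is_cokernel (opc A) M N f K k"
    using kernel[OF f] cokernel[OF f] by simp_all
qed (auto intro: ident_left ident_right ident_hom comp_hom comp_assoc[symmetric]
    comp_add add_comp dest: hom_objects hom_disjoint mono_normal epi_normal)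

section \<open>Localisation at a thick subcategory\<close>

context abelian_category
begin

lemma opc_arr [simp]:
  "abelian_category.arr (opc A) f = arr f" "abelian_category.src (opc A) f = tgt f"
  "abelian_category.tgt (opc A) f = src f"
  by (simp_all add: abelian_category.arr_def[OF abelian_category_opc] arr_def
    abelian_category.src_def[OF abelian_category_opc] abelian_category.tgt_def[OF abelian_category_opc]
    src_def tgt_def) blast

lemma opc_plus [simp]: "abelian_category.plus (opc A) f g = f \<oplus> g"
  and opc_minus [simp]: "abelian_category.minus (opc A) f g = f \<ominus> g"
  by (simp_all add: abelian_category.plus_def[OF abelian_category_opc] plus_def
    abelian_category.minus_def[OF abelian_category_opc] minus_def)

lemma plus_left_comm:
  assumes "arr f" "arr g" "arr h" "src f = src g" "tgt f = tgt g" "src g = src h" "tgt g = tgt h"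
  shows "f \<oplus> (g \<oplus> h) = g \<oplus> (f \<oplus> h)"
proof -
  have "f \<oplus> (g \<oplus> h) = (f \<oplus> g) \<oplus> h" using plus_assoc[of f g h] assms by simp
  also have "f \<oplus> g = g \<oplus> f" using plus_comm assms by simp
  also have "(g \<oplus> f) \<oplus> h = g \<oplus> (f \<oplus> h)" using plus_assoc[of g f h] assms by simp
  finally show ?thesis .
qed

lemma minus_trans:
  assumes "arr f" "arr g" "arr h" "src f = src g" "tgt f = tgt g" "src g = src h" "tgt g = tgt h"
  shows "(f \<ominus> g) \<oplus> (g \<ominus> h) = f \<ominus> h"
proof (rule minus_unique)
  show "(f \<ominus> g) \<oplus> (g \<ominus> h) \<oplus> h = f"
    using assms by (simp add: plus_assoc)
qed (use assms in simp_all)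

lemma minus_flip:
  assumes "arr f" "arr g" "src f = src g" "tgt f = tgt g"
  shows "Zero A (src g) (tgt g) \<ominus> (f \<ominus> g) = g \<ominus> f"
proof (rule minus_unique[symmetric])
  show "(g \<ominus> f) \<oplus> (f \<ominus> g) = Zero A (src g) (tgt g)"
    using minus_trans[of g f g] assms by simp
qed (use assms in simp_all)

lemma plus_minus_plus:
  assumes "arr f" "arr g" "arr f'" "arr g'" "src f = src f'" "tgt f = tgt f'"
    "src g = src g'" "tgt g = tgt g'" "src f' = src g'" "tgt f' = tgt g'"
  shows "(f \<ominus> f') \<oplus> (g \<ominus> g') = (f \<oplus> g) \<ominus> (f' \<oplus> g')"
proof (rule minus_unique)
  have "(f \<ominus> f') \<oplus> (g \<ominus> g') \<oplus> (f' \<oplus> g') = ((f \<ominus> f') \<oplus> f') \<oplus> ((g \<ominus> g') \<oplus> g')"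
    using assms
    by (simp only: plus_assoc plus_left_comm plus_comm plus_simps minus_simps)
  also have "\<dots> = f \<oplus> g" using assms by simp
  finally show "(f \<ominus> f') \<oplus> (g \<ominus> g') \<oplus> (f' \<oplus> g') = f \<oplus> g" .
qed (use assms in simp_all)

end

section \<open>Thick subcategories and the ideal of small morphisms\<close>

locale thick_subcategory = abelian_category A for A :: "('o, 'm) category_data" (structure) +
  fixes C :: "'o set"
  assumes thick: "thick A C"
begin

lemma C_Ob: "X \<in> C \<Longrightarrow> X \<in> Ob A"
  using thick unfolding thick_def by blast

lemma C_nonempty: obtains X where "X \<in> C"
  using thick unfolding thick_def by blast

lemma C_sub: "is_mono A K M k \<Longrightarrow> M \<in> C \<Longrightarrow> K \<in> C"
  using thick unfolding thick_def by blast

lemma C_quot: "is_epi A M K k \<Longrightarrow> M \<in> C \<Longrightarrow> K \<in> C"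
  using thick unfolding thick_def by blast

lemma C_ext: "is_kernel A M Q p K i \<Longrightarrow> is_cokernel A K M i Q p \<Longrightarrow> K \<in> C \<Longrightarrow> Q \<in> C \<Longrightarrow> M \<in> C"
  using thick unfolding thick_def by blast

text \<open>Closure under subobjects and under quotients trade places; the extension condition names
  both the kernel and the cokernel and is its own dual.\<close>

lemma thick_subcategory_opc: "thick_subcategory (opc A) C"
proof (intro thick_subcategory.intro abelian_category_opc thick_subcategory_axioms.intro)
  show "thick (opc A) C"
    unfolding thick_def opc_simps opc_universal
  proof (intro conjI allI impI subsetI)
    show "X \<in> C \<Longrightarrow> X \<in> Ob A" for X by (rule C_Ob)
    show "C \<noteq> {}" using C_nonempty by blast
    show "is_epi A M K i \<and> M \<in> C \<Longrightarrow> K \<in> C" for K M i using C_quot by blast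
    show "is_mono A K M i \<and> M \<in> C \<Longrightarrow> K \<in> C" for K M i using C_sub by blast
    show "is_cokernel A Q M p K i \<and> is_kernel A M K i Q p \<and> K \<in> C \<and> Q \<in> C \<Longrightarrow> M \<in> C" for M Q p K i
      using C_ext by blast
  qed
qed

text \<open>These are the morphisms that become zero in the quotient. Having the image in
  \<open>C\<close> would be an equivalent condition, but the factorisation is visibly stable under
  composition on both sides and self-dual.\<close>

definition small :: "'m \<Rightarrow> bool" where
  "small f \<longleftrightarrow> (\<exists>a b. arr a \<and> arr b \<and> tgt a = src b \<and> src b \<in> C \<and> f = a \<cdot> b)"

text \<open>The kernel and the cokernel of \<open>s\<close> lie in \<open>C\<close>; this form of the condition is literally
  self-dual.\<close>

definition sig :: "'m \<Rightarrow> bool" where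
  "sig s \<longleftrightarrow> arr s \<and>
    (\<forall>x. arr x \<longrightarrow> tgt x = src s \<longrightarrow> x \<cdot> s = Zero A (src x) (tgt s) \<longrightarrow> small x) \<and>
    (\<forall>y. arr y \<longrightarrow> src y = tgt s \<longrightarrow> s \<cdot> y = Zero A (src s) (tgt y) \<longrightarrow> small y)"

text \<open>The congruence that the passage to the quotient induces on the morphisms of
  \<open>A\<close>. Typing is part of it, so that chains by transitivity carry no side conditions
  about ends.\<close>

definition cong :: "'m \<Rightarrow> 'm \<Rightarrow> bool" (infix "\<approx>" 50) where
  "f \<approx> g \<longleftrightarrow> arr f \<and> arr g \<and> src f = src g \<and> tgt f = tgt g \<and> small (f \<ominus> g)"

lemma smallI: "arr a \<Longrightarrow> arr b \<Longrightarrow> tgt a = src b \<Longrightarrow> src b \<in> C \<Longrightarrow> small (a \<cdot> b)"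
  unfolding small_def by blast

lemma small_comp_left: assumes "small f" "arr g" "tgt g = src f" shows "small (g \<cdot> f)"
proof -
  obtain a b where f: "f = a \<cdot> b" and [simp]: "arr a" "arr b" "tgt a = src b" "src b \<in> C"
    using assms(1) unfolding small_def by blast
  show ?thesis using smallI[of "g \<cdot> a" b] assms(2,3) by (simp add: f)
qed

lemma small_comp_right: assumes "small f" "arr g" "src g = tgt f" shows "small (f \<cdot> g)"
proof -
  obtain a b where f: "f = a \<cdot> b" and [simp]: "arr a" "arr b" "tgt a = src b" "src b \<in> C"
    using assms(1) unfolding small_def by blast
  show ?thesis using smallI[of a "b \<cdot> g"] assms(2,3) by (simp add: f)
qed

lemma small_zero: assumes "M \<in> Ob A" "N \<in> Ob A" shows "small (Zero A M N)"
proof -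
  obtain X where X: "X \<in> C" by (rule C_nonempty)
  show ?thesis using smallI[of "Zero A M X" "Zero A X N"] assms X C_Ob[OF X] by simp
qed

text \<open>The biproduct is an extension of \<open>Y\<close> by \<open>X\<close>: the first
  injection is a kernel of the second projection, and by normality that projection is its
  cokernel.\<close>

lemma C_product:
  assumes "X \<in> C" "Y \<in> C" obtains P p q where "is_product A X Y P p q" "P \<in> C"
proof -
  obtain P p q where P: "is_product A X Y P p q"
    using product[OF C_Ob[OF assms(1)] C_Ob[OF assms(2)]] by blast
  note [simp] = is_productD[OF P] product_Ob[OF P]
  obtain i j where [simp]: "arr i" "src i = X" "tgt i = P" "arr j" "src j = Y" "tgt j = P"
    "i \<cdot> p = Ident A X" "i \<cdot> q = Zero A X Y" "j \<cdot> p = Zero A Y X" "j \<cdot> q = Ident A Y"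
    and e: "p \<cdot> i \<oplus> q \<cdot> j = Ident A P" using biproduct[OF P] .
  have "is_mono A X P i"
    by (rule mono_comp_left[of X X i p, simplified]) (simp_all add: mono_id)
  then have k: "is_kernel A P Y q X i"
  proof (rule is_kernelI[rotated 3])
    fix t assume t [simp]: "arr t" "tgt t = P" "t \<cdot> q = Zero A (src t) Y"
    have "(t \<cdot> p) \<cdot> i = t"
      by (rule product_unique[OF P]) simp_all
    then show "\<exists>u. arr u \<and> src u = src t \<and> tgt u = X \<and> u \<cdot> i = t"
      by (intro exI[of _ "t \<cdot> p"]) simp
  qed simp_all
  have "is_epi A P Y q"
    by (rule epi_comp_right[of Y Y j q, simplified]) (simp_all add: epi_id)
  then have "is_cokernel A X P i Y q" using k epi_normal by blast
  then show ?thesis using that P C_ext[OF k] assms by blast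
qed

text \<open>The sum factors through the biproduct of the two intermediate objects.\<close>

lemma small_plus:
  assumes "small f" "small g" "src f = src g" "tgt f = tgt g" shows "small (f \<oplus> g)"
proof -
  obtain a b where f: "f = a \<cdot> b" and [simp]: "arr a" "arr b" "tgt a = src b" "src b \<in> C"
    using assms(1) unfolding small_def by blast
  obtain c d where g: "g = c \<cdot> d" and [simp]: "arr c" "arr d" "tgt c = src d" "src d \<in> C"
    using assms(2) unfolding small_def by blast
  have [simp]: "src a = src c" "tgt b = tgt d" using assms(3,4) f g by simp_all
  obtain P p q where P: "is_product A (src b) (src d) P p q" "P \<in> C"
    using C_product[of "src b" "src d"] by auto
  note [simp] = is_productD[OF P(1)]
  obtain u where u [simp]: "arr u" "src u = src c" "tgt u = P" "u \<cdot> p = a" "u \<cdot> q = c"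
    by (rule product_pair[OF P(1), of a c]) simp_all
  have "f \<oplus> g = u \<cdot> (p \<cdot> b \<oplus> q \<cdot> d)"
    using comp_reduce[OF u(4), of b] comp_reduce[OF u(5), of d] by (simp add: f g)
  then show ?thesis using smallI[of u "p \<cdot> b \<oplus> q \<cdot> d"] P(2) by simp
qed

lemma small_neg: assumes "small f" shows "small (Zero A (src f) (tgt f) \<ominus> f)"
proof -
  obtain a b where f: "f = a \<cdot> b" and [simp]: "arr a" "arr b" "tgt a = src b" "src b \<in> C"
    using assms(1) unfolding small_def by blast
  show ?thesis using smallI[of a "Zero A (src b) (tgt b) \<ominus> b"] by (simp add: f)
qed

text \<open>The image \<open>I\<close> of the first factor \<open>a\<close> is a subobject of an
  object of \<open>C\<close>. Because \<open>m\<close> is mono, \<open>e\<close> kills whatever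
  \<open>a1\<close> kills, so \<open>J\<close> is a quotient of \<open>I\<close>.\<close>

lemma small_image:
  assumes e: "is_epi A T J e" and m: "is_mono A J M m" and "small (e \<cdot> m)"
  shows "J \<in> C"
proof -
  note [simp] = is_epiD[OF e] is_monoD[OF m]
  obtain a b where ab: "e \<cdot> m = a \<cdot> b" and [simp]: "arr a" "arr b" "tgt a = src b" "src b \<in> C"
    using assms(3) unfolding small_def by blast
  have "src (e \<cdot> m) = src (a \<cdot> b)" "tgt (e \<cdot> m) = tgt (a \<cdot> b)" by (simp_all only: ab)
  then have [simp]: "src a = T" "tgt b = M" by simp_all
  obtain I a1 a2 where a1: "is_epi A (src a) I a1" and a2: "is_mono A I (tgt a) a2" and a: "a1 \<cdot> a2 = a"
    using image_ex[of a] by auto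
  note [simp] = is_epiD[OF a1] is_monoD[OF a2]
  have IC: "I \<in> C" using C_sub[OF a2] by simp
  have "x \<cdot> e = Zero A (src x) J" if x: "arr x" "tgt x = src a" "x \<cdot> a1 = Zero A (src x) I" for x
  proof -
    have "x \<cdot> (e \<cdot> m) = Zero A (src x) M"
      unfolding ab a[symmetric] using comp_reduce[OF x(3), of "a2 \<cdot> b"] x by simp
    then have "x \<cdot> e = Zero A (src (x \<cdot> e)) J"
      by - (rule mono_zero[OF m], use x in simp_all)
    then show ?thesis using x by simp
  qed
  then obtain v where v: "arr v" "src v = I" "tgt v = J" "a1 \<cdot> v = e"
    by - (rule epi_factor[OF a1, of e], simp_all)
  have "is_epi A I J v" using epi_comp_right[of T J a1 v] e v by simp
  then show ?thesis using C_quot IC by blast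
qed

lemma small_mono: "is_mono A K M k \<Longrightarrow> small k \<Longrightarrow> K \<in> C"
  using small_image[of K K "Ident A K" M k] epi_id[of K] is_monoD[of K M k] src_Ob[of k] by simp

lemma small_epi: "is_epi A M K k \<Longrightarrow> small k \<Longrightarrow> K \<in> C"
  using small_image[of M K k K "Ident A K"] mono_id[of K] is_epiD[of M K k] tgt_Ob[of k] by simp

text \<open>The condition on \<open>k\<close> expresses that its cokernel is small. The image
  \<open>J\<close> of \<open>k \<cdot> e\<close> inside the image \<open>I\<close> of
  \<open>x\<close> is also the image of the small \<open>k \<cdot> x\<close>, so it lies in
  \<open>C\<close>. The quotient of \<open>I\<close> by \<open>J\<close> lies in \<open>C\<close>
  because \<open>k \<cdot> (e \<cdot> c)\<close> is zero, and \<open>I\<close> is an extension of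
  the two.\<close>

lemma small_cancel_left:
  assumes kx: "small (k \<cdot> x)" and [simp]: "arr k" "arr x" "tgt k = src x"
    and k: "\<And>y. arr y \<Longrightarrow> src y = tgt k \<Longrightarrow> k \<cdot> y = Zero A (src k) (tgt y) \<Longrightarrow> small y"
  shows "small x"
proof -
  obtain I e m where e: "is_epi A (src x) I e" and m: "is_mono A I (tgt x) m" and x: "e \<cdot> m = x"
    using image_ex[of x] by auto
  note [simp] = is_epiD[OF e] is_monoD[OF m]
  obtain J h j where h: "is_epi A (src (k \<cdot> e)) J h" and j: "is_mono A J (tgt (k \<cdot> e)) j"
    and ke: "h \<cdot> j = k \<cdot> e" using image_ex[of "k \<cdot> e"] by auto
  have h': "is_epi A (src k) J h" and j': "is_mono A J I j" using h j by simp_all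
  note [simp] = is_epiD[OF h'] is_monoD[OF j']
  have "h \<cdot> (j \<cdot> m) = k \<cdot> x" using comp_reduce[OF ke, of m] x by simp
  then have JC: "J \<in> C" using small_image[OF h' mono_comp[OF j' m]] kx by simp
  obtain D c where c: "is_cokernel A J I j D c" and kc: "is_kernel A I D c J j"
    using kernel_of_cokernel[OF j'] .
  note [simp] = is_cokernelD(4-7)[OF c]
  have [simp]: "D \<in> Ob A" using tgt_Ob[of c] by simp
  have "k \<cdot> (e \<cdot> c) = Zero A (src k) D"
    using comp_reduce[OF ke[symmetric], of c] by simp
  then have "small (e \<cdot> c)" using k[of "e \<cdot> c"] by simp
  moreover have "is_epi A (src x) D (e \<cdot> c)" using epi_comp[OF e is_cokernelD(8)[OF c]] .
  ultimately have "D \<in> C" using small_epi by blast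
  then have "I \<in> C" using C_ext[OF kc c JC] by blast
  then show ?thesis using smallI[of e m] x by simp
qed

text \<open>Whatever vanishes on the kernel of \<open>f\<close> factors through the image of
  \<open>f\<close>, which lies in \<open>C\<close>.\<close>

lemma small_kernel_cancel:
  assumes f: "small f" and k: "is_kernel A M N f K k"
    and y: "arr y" "src y = M" "k \<cdot> y = Zero A K (tgt y)"
  shows "small y"
proof -
  note [simp] = is_kernelD(1-7)[OF k] y
  obtain I e m where e: "is_epi A (src f) I e" and m: "is_mono A I (tgt f) m" and em: "e \<cdot> m = f"
    using image_ex[of f] by auto
  note [simp] = is_epiD[OF e] is_monoD[OF m]
  have IC: "I \<in> C" using small_image[OF e m] em f by simp
  have "x \<cdot> y = Zero A (src x) (tgt y)" if x: "arr x" "tgt x = M" "x \<cdot> e = Zero A (src x) I" for x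
  proof -
    have "x \<cdot> f = Zero A (src x) N" using comp_reduce[OF x(3), of m] x em by simp
    with x obtain u where u: "arr u" "src u = src x" "tgt u = K" "u \<cdot> k = x"
      by - (rule kernel_lift[OF k, of x])
    then show ?thesis using comp_reduce[OF u(4), of y] by simp
  qed
  then obtain v where v: "arr v" "src v = I" "tgt v = tgt y" "e \<cdot> v = y"
    by - (rule epi_factor[OF e, of y], simp_all)
  then show ?thesis using smallI[of e v] IC by simp
qed

text \<open>Left cancellation is applied to the kernel \<open>k\<close> of
  \<open>x \<cdot> s\<close>: the composite \<open>k \<cdot> x\<close> is killed by
  \<open>s\<close>, hence small, and a morphism vanishing on \<open>k\<close> is small by
  \<open>small_kernel_cancel\<close>.\<close>

lemma small_cancel_right:
  assumes xs: "small (x \<cdot> s)" and [simp]: "arr x" "arr s" "tgt x = src s"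
    and s: "\<And>z. arr z \<Longrightarrow> tgt z = src s \<Longrightarrow> z \<cdot> s = Zero A (src z) (tgt s) \<Longrightarrow> small z"
  shows "small x"
proof -
  obtain K k where k: "is_kernel A (src (x \<cdot> s)) (tgt (x \<cdot> s)) (x \<cdot> s) K k"
    using kernel_ex[of "x \<cdot> s"] by auto
  then have k': "is_kernel A (src x) (tgt s) (x \<cdot> s) K k" by simp
  note [simp] = is_kernelD(4-7)[OF k']
  have "small (k \<cdot> x)" by (rule s) simp_all
  then show ?thesis
    by (rule small_cancel_left) (use small_kernel_cancel[OF xs k'] in simp_all)
qed

section \<open>Morphisms that are inverted in the quotient\<close>

lemma sig_arr: "sig s \<Longrightarrow> arr s"
  by (simp add: sig_def)

lemma sig_small_left:
  "sig s \<Longrightarrow> small (s \<cdot> y) \<Longrightarrow> arr y \<Longrightarrow> src y = tgt s \<Longrightarrow> small y"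
  by (rule small_cancel_left[of s y]) (simp_all add: sig_def)

lemma sig_small_right:
  "sig s \<Longrightarrow> small (x \<cdot> s) \<Longrightarrow> arr x \<Longrightarrow> tgt x = src s \<Longrightarrow> small x"
  by (rule small_cancel_right[of x s]) (simp_all add: sig_def)

lemma sigI:
  assumes "arr s"
    "\<And>x. arr x \<Longrightarrow> tgt x = src s \<Longrightarrow> x \<cdot> s = Zero A (src x) (tgt s) \<Longrightarrow> small x"
    "\<And>y. arr y \<Longrightarrow> src y = tgt s \<Longrightarrow> s \<cdot> y = Zero A (src s) (tgt y) \<Longrightarrow> small y"
  shows "sig s"
  using assms by (simp add: sig_def)

lemma sig_comp: assumes "sig s" "sig t" "tgt s = src t" shows "sig (s \<cdot> t)"
proof (rule sigI)
  note [simp] = assms(3) sig_arr[OF assms(1)] sig_arr[OF assms(2)]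
  show "arr (s \<cdot> t)" by simp
  fix x assume x: "arr x" "tgt x = src (s \<cdot> t)" "x \<cdot> (s \<cdot> t) = Zero A (src x) (tgt (s \<cdot> t))"
  then have "small ((x \<cdot> s) \<cdot> t)" using small_zero[of "src x" "tgt t"] by simp
  then have "small (x \<cdot> s)" by (rule sig_small_right[OF assms(2)]) (use x in simp_all)
  then show "small x" by (rule sig_small_right[OF assms(1)]) (use x in simp_all)
next
  note [simp] = assms(3) sig_arr[OF assms(1)] sig_arr[OF assms(2)]
  fix x assume x: "arr x" "src x = tgt (s \<cdot> t)" "(s \<cdot> t) \<cdot> x = Zero A (src (s \<cdot> t)) (tgt x)"
  then have "small (s \<cdot> (t \<cdot> x))" using small_zero[of "src s" "tgt x"] by simp
  then have "small (t \<cdot> x)" by (rule sig_small_left[OF assms(1)]) (use x in simp_all)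
  then show "small x" by (rule sig_small_left[OF assms(2)]) (use x in simp_all)
qed

text \<open>As \<open>i\<close> is mono, only its cokernel matters, and a morphism that vanishes
  after \<open>i\<close> also vanishes after \<open>e \<cdot> i\<close>.\<close>

lemma sig_mono_factor:
  assumes i: "is_mono A I N i" and e: "arr e" "tgt e = I" and s: "sig (e \<cdot> i)"
  shows "sig i"
proof (rule sigI)
  note [simp] = is_monoD[OF i] e
  fix x assume x: "arr x" "tgt x = src i" "x \<cdot> i = Zero A (src x) (tgt i)"
  have "x = Zero A (src x) I" by (rule mono_zero[OF i]) (use x in simp_all)
  then show "small x" using small_zero[of "src x" I] x src_Ob[of i] by simp
next
  note [simp] = is_monoD[OF i] e
  fix y assume y: "arr y" "src y = tgt i" "i \<cdot> y = Zero A (src i) (tgt y)"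
  have "(e \<cdot> i) \<cdot> y = e \<cdot> (i \<cdot> y)" using y(1,2) by simp
  also have "\<dots> = Zero A (src (e \<cdot> i)) (tgt y)" unfolding y(3) using y(1) by simp
  finally show "small y" using s y unfolding sig_def by simp
qed (rule is_monoD[OF i])

lemma sig_id: "M \<in> Ob A \<Longrightarrow> sig (Ident A M)"
proof (rule sigI)
  assume M: "M \<in> Ob A"
  show "arr (Ident A M)" using M by simp
  fix x assume x: "arr x" "tgt x = src (Ident A M)"
    "x \<cdot> Ident A M = Zero A (src x) (tgt (Ident A M))"
  then have "x = Zero A (src x) M" using M by simp
  then show "small x" using small_zero[of "src x" M] x M by simp
next
  assume M: "M \<in> Ob A"
  fix x assume x: "arr x" "src x = tgt (Ident A M)"
    "Ident A M \<cdot> x = Zero A (src (Ident A M)) (tgt x)"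
  then have "x = Zero A M (tgt x)" using M by simp
  then show "small x" using small_zero[of M "tgt x"] x M by simp
qed

text \<open>A kernel has trivial kernel, and its cokernel is the coimage of the small
  \<open>f\<close>. Restriction to the kernel of a small morphism is thus always an admissible
  shrinking of the source.\<close>

lemma sig_kernel: assumes f: "small f" and k: "is_kernel A M N f K k" shows "sig k"
proof (rule sigI)
  note [simp] = is_kernelD(4-7)[OF k]
  show "arr k" by simp
  fix x assume x: "arr x" "tgt x = src k" "x \<cdot> k = Zero A (src x) (tgt k)"
  have "x = Zero A (src x) K" by (rule mono_zero[OF is_kernelD(8)[OF k]]) (use x in simp_all)
  then show "small x" using small_zero[of "src x" K] x src_Ob[of k] by simp
next
  note [simp] = is_kernelD(4-7)[OF k]
  fix y assume y: "arr y" "src y = tgt k" "k \<cdot> y = Zero A (src k) (tgt y)"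
  then show "small y" using small_kernel_cancel[OF f k, of y] by simp
qed

lemma small_opc [simp]: "thick_subcategory.small (opc A) C f = small f"
  unfolding small_def thick_subcategory.small_def[OF thick_subcategory_opc]
  by (simp, rule iffI) metis+

lemma sig_opc [simp]: "thick_subcategory.sig (opc A) C f = sig f"
  unfolding sig_def thick_subcategory.sig_def[OF thick_subcategory_opc] by auto

lemma sig_cokernel: "small f \<Longrightarrow> is_cokernel A M N f K k \<Longrightarrow> sig k"
  using thick_subcategory.sig_kernel[OF thick_subcategory_opc, of f N M K k] by simp

text \<open>Connects \<open>sig\<close>, whose tests range over all morphisms, with the condition on
  subobjects in the definition of the quotient. Backwards, \<open>i\<close> is seen as the kernel of
  its small cokernel.\<close>

lemma sig_mono_iff:
  assumes m: "is_mono A K M i"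
  shows "sig i \<longleftrightarrow> (\<exists>X\<in>C. \<exists>c. is_cokernel A K M i X c)"
proof
  note [simp] = is_monoD[OF m]
  assume s: "sig i"
  obtain X c where c: "is_cokernel A K M i X c" and "is_kernel A M X c K i"
    using kernel_of_cokernel[OF m] .
  have "small c" using s is_cokernelD(4-7)[OF c] unfolding sig_def by simp
  then show "\<exists>X\<in>C. \<exists>c. is_cokernel A K M i X c" using small_epi[OF is_cokernelD(8)[OF c]] c by blast
next
  assume "\<exists>X\<in>C. \<exists>c. is_cokernel A K M i X c"
  then obtain X c where X: "X \<in> C" and c: "is_cokernel A K M i X c" by blast
  note [simp] = is_cokernelD(4-7)[OF c]
  have "small c" using smallI[of c "Ident A X"] X C_Ob[OF X] by simp
  then show "sig i" using sig_kernel mono_normal[OF m c] by blast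
qed

lemma sig_epi_iff:
  assumes m: "is_epi A M K i"
  shows "sig i \<longleftrightarrow> (\<exists>X\<in>C. \<exists>c. is_kernel A M K i X c)"
  using thick_subcategory.sig_mono_iff[OF thick_subcategory_opc, of K M i] m by simp

subsection \<open>The congruence of morphisms with small difference\<close>

lemma congD:
  assumes "f \<approx> g" shows "arr f" "arr g" "src f = src g" "tgt f = tgt g" "small (f \<ominus> g)"
  using assms by (simp_all add: cong_def)

lemma cong_refl: "arr f \<Longrightarrow> f \<approx> f"
  by (simp add: cong_def small_zero)

lemma cong_sym: assumes "f \<approx> g" shows "g \<approx> f"
  using small_neg[OF congD(5)[OF assms]] minus_flip[OF congD(1-4)[OF assms]] congD[OF assms]
  by (simp add: cong_def)

lemma cong_trans [trans]: assumes "f \<approx> g" "g \<approx> h" shows "f \<approx> h"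
  using small_plus[OF congD(5)[OF assms(1)] congD(5)[OF assms(2)]]
    congD[OF assms(1)] congD[OF assms(2)] minus_trans[of f g h]
  by (simp add: cong_def)

lemma cong_comp_left: "g \<approx> h \<Longrightarrow> arr f \<Longrightarrow> tgt f = src h \<Longrightarrow> f \<cdot> g \<approx> f \<cdot> h"
  using small_comp_left[of "g \<ominus> h" f] by (simp add: cong_def)

lemma cong_comp_right: "g \<approx> h \<Longrightarrow> arr f \<Longrightarrow> src f = tgt h \<Longrightarrow> g \<cdot> f \<approx> h \<cdot> f"
  using small_comp_right[of "g \<ominus> h" f] by (simp add: cong_def)

lemma cong_cancel_left:
  assumes "s \<cdot> f \<approx> s \<cdot> g" "sig s" "arr f" "arr g" "src f = tgt s" "src g = tgt s"
  shows "f \<approx> g"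
proof -
  note [simp] = assms(3-6) sig_arr[OF assms(2)]
  have [simp]: "tgt f = tgt g" using congD(4)[OF assms(1)] by simp
  have "small (s \<cdot> (f \<ominus> g))" using congD(5)[OF assms(1)] by simp
  then have "small (f \<ominus> g)" by (rule sig_small_left[OF assms(2)]) simp_all
  then show ?thesis by (simp add: cong_def)
qed

lemma cong_cancel_right:
  assumes "f \<cdot> s \<approx> g \<cdot> s" "sig s" "arr f" "arr g" "tgt f = src s" "tgt g = src s"
  shows "f \<approx> g"
proof -
  note [simp] = assms(3-6) sig_arr[OF assms(2)]
  have [simp]: "src f = src g" using congD(3)[OF assms(1)] by simp
  have "small ((f \<ominus> g) \<cdot> s)" using congD(5)[OF assms(1)] by simp
  then have "small (f \<ominus> g)" by (rule sig_small_right[OF assms(2)]) simp_all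
  then show ?thesis by (simp add: cong_def)
qed

text \<open>Right cancellation uses only the kernel half of \<open>sig\<close>, so a mono with an
  arbitrary cokernel will do.\<close>

lemma cong_mono_cancel:
  assumes "f \<cdot> m \<approx> g \<cdot> m" "is_mono A I M m" "arr f" "arr g" "tgt f = I" "tgt g = I"
  shows "f \<approx> g"
proof -
  note [simp] = assms(3-6) is_monoD[OF assms(2)]
  have [simp]: "src f = src g" using congD(3)[OF assms(1)] by simp
  have "small ((f \<ominus> g) \<cdot> m)" using congD(5)[OF assms(1)] by simp
  then have "small (f \<ominus> g)"
  proof (rule small_cancel_right)
    fix z assume z: "arr z" "tgt z = src m" "z \<cdot> m = Zero A (src z) (tgt m)"
    have "z = Zero A (src z) I" by (rule mono_zero[OF assms(2)]) (use z in simp_all)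
    then show "small z" using small_zero[of "src z" I] z src_Ob[of m] by simp
  qed simp_all
  then show ?thesis by (simp add: cong_def)
qed

lemma cong_plus:
  assumes "f \<approx> f'" "g \<approx> g'" "src f' = src g'" "tgt f' = tgt g'" shows "f \<oplus> g \<approx> f' \<oplus> g'"
  using small_plus[OF congD(5)[OF assms(1)] congD(5)[OF assms(2)]] assms(3,4)
    congD[OF assms(1)] congD[OF assms(2)] plus_minus_plus[of f g f' g']
  by (simp add: cong_def)

lemma cong_zero: "arr f \<Longrightarrow> src f = M \<Longrightarrow> tgt f = N \<Longrightarrow> f \<approx> Zero A M N \<longleftrightarrow> small f"
  using src_Ob[of f] tgt_Ob[of f] by (auto simp: cong_def)

subsection \<open>Pullbacks\<close>

text \<open>\<open>J\<close> is the preimage of the subobject \<open>s\<close> under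
  \<open>f\<close>, obtained as the kernel of \<open>f\<close> followed by the cokernel of
  \<open>s\<close>. That composite is small, which puts its kernel in \<open>sig\<close>.\<close>

lemma ore_mono:
  assumes s: "sig s" "is_mono A L M s" and f: "arr f" "tgt f = M"
  obtains J j v where "is_mono A J (src f) j" "sig j" "arr v" "src v = J" "tgt v = L" "j \<cdot> f = v \<cdot> s"
proof -
  note [simp] = is_monoD[OF s(2)] f
  obtain X c where c: "is_cokernel A L M s X c" and k: "is_kernel A M X c L s"
    using kernel_of_cokernel[OF s(2)] .
  note [simp] = is_cokernelD(4-7)[OF c]
  have "small c" using s(1) unfolding sig_def by simp
  then have fc: "small (f \<cdot> c)" by (rule small_comp_left) simp_all
  obtain J j where "is_kernel A (src (f \<cdot> c)) (tgt (f \<cdot> c)) (f \<cdot> c) J j"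
    using kernel_ex[of "f \<cdot> c"] by auto
  then have j: "is_kernel A (src f) X (f \<cdot> c) J j" by simp
  note [simp] = is_kernelD(4-7)[OF j]
  obtain v where "arr v" "src v = src (j \<cdot> f)" "tgt v = L" "v \<cdot> s = j \<cdot> f"
    by (rule kernel_lift[OF k, of "j \<cdot> f"]) simp_all
  then show ?thesis using that[OF is_kernelD(8)[OF j] sig_kernel[OF fc j], of v] by simp
qed

text \<open>By the decomposition of the identity, \<open>x\<close> is the sum of its two components,
  each followed by an injection.\<close>

lemma small_into_product:
  assumes P: "is_product A M N P p q" and x: "arr x" "tgt x = P" "small (x \<cdot> p)" "small (x \<cdot> q)"
  shows "small x"
proof -
  note [simp] = is_productD[OF P] product_Ob[OF P] x(1,2)
  obtain i j where [simp]: "arr i" "src i = M" "tgt i = P" "arr j" "src j = N" "tgt j = P"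
    and e: "p \<cdot> i \<oplus> q \<cdot> j = Ident A P" using biproduct[OF P] .
  have "x = x \<cdot> (p \<cdot> i \<oplus> q \<cdot> j)" unfolding e by simp
  also have "\<dots> = (x \<cdot> p) \<cdot> i \<oplus> (x \<cdot> q) \<cdot> j" by simp
  finally have "x = (x \<cdot> p) \<cdot> i \<oplus> (x \<cdot> q) \<cdot> j" .
  moreover have "small ((x \<cdot> p) \<cdot> i \<oplus> (x \<cdot> q) \<cdot> j)"
    by (intro small_plus small_comp_right x) simp_all
  ultimately show ?thesis by simp
qed

lemma small_mono_cancel:
  assumes "is_mono A K M m" "arr x" "tgt x = K" "small (x \<cdot> m)" shows "small x"
proof -
  note [simp] = is_monoD[OF assms(1)]
  have "x \<cdot> m \<approx> Zero A (src x) K \<cdot> m" using assms(2-4) cong_zero[of "x \<cdot> m" "src x" M] src_Ob[of m] by simp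
  then have "x \<approx> Zero A (src x) K" by (rule cong_mono_cancel[OF _ assms(1)]) (use assms src_Ob[of m] in simp_all)
  then show ?thesis using cong_zero[of x "src x" K] assms by simp
qed

context
  fixes L M N s f P p q K i
  assumes P: "is_product A N L P p q"
    and s [simp]: "arr s" "src s = L" "tgt s = M" and f [simp]: "arr f" "src f = N" "tgt f = M"
    and i: "is_kernel A P M (p \<cdot> f \<ominus> q \<cdot> s) K i"
begin

lemma pullback_simps [simp]:
  "arr p" "src p = P" "tgt p = N" "arr q" "src q = P" "tgt q = L"
  "arr i" "src i = K" "tgt i = P"
  using is_productD[OF P] is_kernelD(4-7)[OF i] by simp_all

text \<open>The pullback of \<open>f\<close> and \<open>s\<close> is realised as the kernel of a
  difference on the product, which is the form in which the algorithms of \<open>A\<close> can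
  compute it.\<close>

lemma pullback_commutes: "i \<cdot> (p \<cdot> f) = i \<cdot> (q \<cdot> s)"
  by (rule minus_eq_zero) (use is_kernelD(7)[OF i] in simp_all)

lemma pullback_lift:
  assumes a [simp]: "arr a" "tgt a = N" "arr b" "tgt b = L" "src a = src b" and e: "a \<cdot> f = b \<cdot> s"
  obtains u where "arr u" "src u = src b" "tgt u = K" "u \<cdot> (i \<cdot> p) = a" "u \<cdot> (i \<cdot> q) = b"
proof -
  obtain w where w [simp]: "arr w" "src w = src b" "tgt w = P" "w \<cdot> p = a" "w \<cdot> q = b"
    by (rule product_pair[OF P, of a b]) simp_all
  have "w \<cdot> (p \<cdot> f \<ominus> q \<cdot> s) = Zero A (src w) M"
    using comp_reduce[OF w(4), of f] comp_reduce[OF w(5), of s] e by simp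
  then obtain u where u [simp]: "arr u" "src u = src w" "tgt u = K" "u \<cdot> i = w"
    by - (rule kernel_lift[OF i, of w], simp_all)
  show ?thesis
    by (rule that[of u]) (use comp_reduce[OF u(4), of p] comp_reduce[OF u(4), of q] in simp_all)
qed

lemma pullback_small:
  assumes x: "arr x" "tgt x = K" "small (x \<cdot> (i \<cdot> p))" "small (x \<cdot> (i \<cdot> q))"
  shows "small x"
proof -
  have "small (x \<cdot> i)" by (rule small_into_product[OF P]) (use x in simp_all)
  then show ?thesis using small_mono_cancel[OF is_kernelD(8)[OF i], of x] x by simp
qed

text \<open>The second injection \<open>b\<close> followed by the difference \<open>?m\<close> is
  the negative of \<open>s\<close>; so \<open>?m\<close> is epi and hence a cokernel of
  \<open>i\<close>. If \<open>x\<close> vanishes after \<open>i \<cdot> p\<close>, then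
  \<open>p \<cdot> x\<close> factors through \<open>?m\<close>. As \<open>b \<cdot> p\<close> is
  zero, the factor \<open>y\<close> vanishes, and the first injection \<open>a\<close> recovers
  \<open>x\<close> from \<open>p \<cdot> x\<close>.\<close>

lemma pullback_epi:
  assumes e: "is_epi A L M s" shows "is_epi A K N (i \<cdot> p)"
  unfolding is_epi_iff
proof (intro conjI allI impI)
  let ?m = "p \<cdot> f \<ominus> q \<cdot> s"
  note [simp] = product_Ob[OF P]
  have [simp]: "M \<in> Ob A" using tgt_Ob[of f] by simp
  obtain a b where [simp]: "arr a" "src a = N" "tgt a = P" "arr b" "src b = L" "tgt b = P"
    and ab: "a \<cdot> p = Ident A N" "b \<cdot> p = Zero A L N" "b \<cdot> q = Ident A L" using biproduct[OF P] .
  note [simp] = comp_reduce[OF ab(1)] comp_reduce[OF ab(2)] comp_reduce[OF ab(3)] ab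
  have z: "y = Zero A M (tgt y)" if y [simp]: "arr y" "src y = M" and b: "b \<cdot> (?m \<cdot> y) = Zero A L (tgt y)" for y
  proof -
    have "b \<cdot> (?m \<cdot> y) = Zero A L (tgt y) \<ominus> s \<cdot> y" by simp
    with b have "Zero A L (tgt y) \<ominus> s \<cdot> y = Zero A L (tgt y)" by simp
    then have "Zero A L (tgt y) = s \<cdot> y"
      using minus_plus[of "Zero A L (tgt y)" "s \<cdot> y"] by simp
    then show ?thesis using epi_zero[OF e, of y] by simp
  qed
  have m: "is_epi A P M ?m" unfolding is_epi_iff
  proof (intro conjI allI impI)
    fix y assume y: "arr y" "src y = M" "?m \<cdot> y = Zero A P (tgt y)"
    show "y = Zero A M (tgt y)" by (rule z) (unfold y(3), use y in simp_all)
  qed simp_all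
  have c: "is_cokernel A K P i M ?m" using epi_normal[OF m i] .
  show "arr (i \<cdot> p)" "src (i \<cdot> p) = K" "tgt (i \<cdot> p) = N" by simp_all
  fix x assume x [simp]: "arr x" "src x = N" and ix: "(i \<cdot> p) \<cdot> x = Zero A K (tgt x)"
  obtain y where y: "arr y" "src y = M" "tgt y = tgt x" "?m \<cdot> y = p \<cdot> x"
    using cokernel_colift[OF c, of "p \<cdot> x"] ix by auto
  have "y = Zero A M (tgt y)" by (rule z) (unfold y(4), use y in simp_all)
  then have "p \<cdot> x = ?m \<cdot> Zero A M (tgt y)" using y(4) by simp
  then have "p \<cdot> x = Zero A P (tgt x)" using y by simp
  then have "a \<cdot> (p \<cdot> x) = Zero A N (tgt x)" by simp
  then show "x = Zero A N (tgt x)" by simp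
qed

end

lemma pullback_ex:
  assumes "arr s" "src s = L" "tgt s = M" "arr f" "src f = N" "tgt f = M"
  obtains P p q K i where "is_product A N L P p q" "is_kernel A P M (p \<cdot> f \<ominus> q \<cdot> s) K i"
proof -
  obtain P p q where P: "is_product A N L P p q" using product[of N L] assms src_Ob by blast
  note [simp] = is_productD[OF P] assms
  have "p \<cdot> f \<ominus> q \<cdot> s \<in> Hom A P M" by (simp add: hom_iff)
  then obtain K i where "is_kernel A P M (p \<cdot> f \<ominus> q \<cdot> s) K i" using kernel by blast
  then show ?thesis using that P by blast
qed

text \<open>Image factorisation splits \<open>s\<close> into a mono, for which preimages work, and
  an epi, for which the pullback projection is again epi while the other projection maps its kernel
  into that of \<open>s\<close>.\<close>

lemma ore:
  assumes s: "sig s" and f: "arr f" "tgt f = tgt s"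
  obtains p q where "arr p" "arr q" "sig p" "src q = src p" "tgt p = src f" "tgt q = src s" "p \<cdot> f = q \<cdot> s"
proof -
  note [simp] = sig_arr[OF s] f
  obtain I e m where e: "is_epi A (src s) I e" and m: "is_mono A I (tgt s) m" and em: "e \<cdot> m = s"
    using image_ex[of s] by auto
  note [simp] = is_epiD[OF e] is_monoD[OF m]
  have "sig m" by (rule sig_mono_factor[OF m, of e]) (use s em in simp_all)
  then obtain J j v where j: "is_mono A J (src f) j" "sig j" and v [simp]: "arr v" "src v = J" "tgt v = I"
    and jf: "j \<cdot> f = v \<cdot> m" using ore_mono[OF _ m f] by blast
  note [simp] = is_monoD[OF j(1)]
  have ee: "arr e" "src e = src s" "tgt e = I" "arr v" "src v = J" "tgt v = I" by simp_all
  obtain P p q K i where P': "is_product A J (src s) P p q"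
    and i': "is_kernel A P I (p \<cdot> v \<ominus> q \<cdot> e) K i" using pullback_ex[OF ee] .
  note [simp] = pullback_simps[OF P' ee i']
  have epi: "is_epi A K J (i \<cdot> p)" by (rule pullback_epi[OF P' ee i' e])
  have c: "i \<cdot> (p \<cdot> v) = i \<cdot> (q \<cdot> e)" by (rule pullback_commutes[OF P' ee i'])
  have cs: "i \<cdot> (p \<cdot> (v \<cdot> m)) = i \<cdot> (q \<cdot> s)"
  proof -
    have "i \<cdot> (p \<cdot> (v \<cdot> m)) = (i \<cdot> (p \<cdot> v)) \<cdot> m" by simp
    also have "\<dots> = i \<cdot> (q \<cdot> (e \<cdot> m))" unfolding c by simp
    finally show ?thesis unfolding em .
  qed
  have "sig (i \<cdot> p)"
  proof (rule sigI)
    fix x assume x: "arr x" "tgt x = src (i \<cdot> p)" "x \<cdot> (i \<cdot> p) = Zero A (src x) (tgt (i \<cdot> p))"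
    have "x \<cdot> (i \<cdot> (q \<cdot> s)) = (x \<cdot> (i \<cdot> p)) \<cdot> (v \<cdot> m)" unfolding cs[symmetric] using x(1,2) by simp
    also have "\<dots> = Zero A (src x) (tgt s)" unfolding x(3) using x(1,2) by simp
    finally have "(x \<cdot> (i \<cdot> q)) \<cdot> s = Zero A (src (x \<cdot> (i \<cdot> q))) (tgt s)" using x(1,2) by simp
    then have "small (x \<cdot> (i \<cdot> q))" using s x unfolding sig_def by simp
    moreover have "small (x \<cdot> (i \<cdot> p))" unfolding x(3) by (rule small_zero) (use x src_Ob[of v] in simp_all)
    ultimately show "small x" using pullback_small[OF P' ee i', of x] x by simp
  next
    fix y assume y: "arr y" "src y = tgt (i \<cdot> p)" "(i \<cdot> p) \<cdot> y = Zero A (src (i \<cdot> p)) (tgt y)"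
    then have "y = Zero A J (tgt y)" using epi_zero[OF epi, of y] by simp
    then show "small y" using small_zero[of J "tgt y"] y src_Ob[of v] by simp
  qed simp
  then have "sig ((i \<cdot> p) \<cdot> j)" by (rule sig_comp[OF _ j(2)]) simp
  moreover have "((i \<cdot> p) \<cdot> j) \<cdot> f = (i \<cdot> q) \<cdot> s" using jf cs by simp
  ultimately show ?thesis by (intro that[of "(i \<cdot> p) \<cdot> j" "i \<cdot> q"]) simp_all
qed

text \<open>The algorithms compute a particular pullback, whereas \<open>ore\<close> yields some
  square. The kernel half is direct. For the cokernel half, the leg \<open>p0\<close> of the Ore
  square factors through \<open>i \<cdot> p\<close>, so a morphism vanishing after
  \<open>i \<cdot> p\<close> vanishes after \<open>p0\<close>, which lies in
  \<open>sig\<close>.\<close>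

lemma pullback_sig:
  assumes P: "is_product A N L P p q"
    and s: "arr s" "src s = L" "tgt s = M" and f: "arr f" "src f = N" "tgt f = M"
    and i: "is_kernel A P M (p \<cdot> f \<ominus> q \<cdot> s) K i" and sig: "sig s"
  shows "sig (i \<cdot> p)"
proof -
  note [simp] = pullback_simps[OF P s f i] s f
  have c: "i \<cdot> (p \<cdot> f) = i \<cdot> (q \<cdot> s)" by (rule pullback_commutes[OF P s f i])
  obtain p0 q0 where pq0 [simp]: "arr p0" "arr q0" "src q0 = src p0" "tgt p0 = N" "tgt q0 = L"
    and sp: "sig p0" and e: "p0 \<cdot> f = q0 \<cdot> s" by (rule ore[OF sig, of f]) simp_all
  obtain u where u [simp]: "arr u" "src u = src q0" "tgt u = K" "u \<cdot> (i \<cdot> p) = p0"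
    by (rule pullback_lift[OF P s f i, of p0 q0]) (simp_all add: e)
  show ?thesis
  proof (rule sigI)
    fix x assume x: "arr x" "tgt x = src (i \<cdot> p)" "x \<cdot> (i \<cdot> p) = Zero A (src x) (tgt (i \<cdot> p))"
    have "x \<cdot> (i \<cdot> (q \<cdot> s)) = (x \<cdot> (i \<cdot> p)) \<cdot> f" unfolding c[symmetric] using x(1,2) by simp
    also have "\<dots> = Zero A (src x) M" unfolding x(3) using x(1,2) by simp
    finally have "(x \<cdot> (i \<cdot> q)) \<cdot> s = Zero A (src (x \<cdot> (i \<cdot> q))) (tgt s)" using x(1,2) by simp
    then have "small (x \<cdot> (i \<cdot> q))" using sig x unfolding sig_def by simp
    moreover have "small (x \<cdot> (i \<cdot> p))" unfolding x(3) by (rule small_zero) (use x src_Ob[of f] in simp_all)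
    ultimately show "small x" using pullback_small[OF P s f i, of x] x by simp
  next
    fix y assume y: "arr y" "src y = tgt (i \<cdot> p)" "(i \<cdot> p) \<cdot> y = Zero A (src (i \<cdot> p)) (tgt y)"
    have "p0 \<cdot> y = u \<cdot> ((i \<cdot> p) \<cdot> y)" using comp_reduce[OF u(4), of y] y(1,2) by simp
    also have "\<dots> = Zero A (src p0) (tgt y)" unfolding y(3) using y(1) src_Ob[of i] by simp
    finally show "small y" using sp y unfolding sig_def by simp
  qed simp
qed

lemma coore:
  assumes s: "sig s" and f: "arr f" "src f = src s"
  obtains p q where "arr p" "arr q" "sig p" "tgt q = tgt p" "src p = tgt f" "src q = tgt s" "f \<cdot> p = s \<cdot> q"
  using thick_subcategory.ore[OF thick_subcategory_opc, of s f] s f by auto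

lemma coore_epi:
  assumes "sig s" "is_epi A M L s" "arr f" "src f = M"
  obtains J j v where "is_epi A (tgt f) J j" "sig j" "arr v" "tgt v = J" "src v = L" "f \<cdot> j = s \<cdot> v"
  using thick_subcategory.ore_mono[OF thick_subcategory_opc, of s L M f] assms by auto

text \<open>A pushout is a pullback in \<open>opc A\<close>; accordingly \<open>p\<close> and
  \<open>q\<close> are here the injections of a coproduct.\<close>

lemma pushout_sig:
  assumes "is_product (opc A) N L P p q"
    "arr s" "tgt s = L" "src s = M" "arr f" "tgt f = N" "src f = M"
    "is_cokernel A M P (f \<cdot> p \<ominus> s \<cdot> q) K i" "sig s"
  shows "sig (p \<cdot> i)"
  using thick_subcategory.pullback_sig[OF thick_subcategory_opc, of N L P p q s M f K i] assms by simp

lemma pushout_commutes: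
  assumes P: "is_product (opc A) N L P p q"
    and s: "arr s" "tgt s = L" "src s = M" "arr f" "tgt f = N" "src f = M"
    and c: "is_cokernel A M P (f \<cdot> p \<ominus> s \<cdot> q) K i"
  shows "f \<cdot> (p \<cdot> i) = s \<cdot> (q \<cdot> i)"
proof -
  note [simp] = s is_cokernelD(4-6)[OF c]
    abelian_category.is_productD[OF abelian_category_opc P, simplified]
  show ?thesis
    using thick_subcategory.pullback_commutes[OF thick_subcategory_opc, of N L P p q s M f K i] P c by simp
qed

end

section \<open>Roofs and the morphisms of the Serre quotient\<close>

lemma triple_set_eqI: "(\<And>a b c. (a, b, c) \<in> S \<longleftrightarrow> (a, b, c) \<in> T) \<Longrightarrow> S = T"
  by auto

context thick_subcategory
begin

lemma serre_reps_iff: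
  "(i, f, p) \<in> serre_reps A C M N \<longleftrightarrow>
    is_mono A (src i) M i \<and> sig i \<and> is_epi A N (tgt p) p \<and> sig p \<and>
    arr f \<and> src f = src i \<and> tgt f = tgt p"
proof
  assume "(i, f, p) \<in> serre_reps A C M N"
  then obtain M' Q where *: "is_mono A M' M i" "\<exists>X\<in>C. \<exists>e. is_cokernel A M' M i X e"
    "is_epi A N Q p" "\<exists>N'\<in>C. \<exists>k. is_kernel A N Q p N' k" "f \<in> Hom A M' Q"
    unfolding serre_reps_def by blast
  moreover have "src i = M'" "tgt p = Q" using is_monoD[OF *(1)] is_epiD[OF *(3)] by simp_all
  ultimately show "is_mono A (src i) M i \<and> sig i \<and> is_epi A N (tgt p) p \<and> sig p \<and>
    arr f \<and> src f = src i \<and> tgt f = tgt p"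
    using sig_mono_iff[OF *(1)] sig_epi_iff[OF *(3)] by (simp add: hom_iff)
next
  assume *: "is_mono A (src i) M i \<and> sig i \<and> is_epi A N (tgt p) p \<and> sig p \<and>
    arr f \<and> src f = src i \<and> tgt f = tgt p"
  then show "(i, f, p) \<in> serre_reps A C M N"
    using sig_mono_iff[of "src i" M i] sig_epi_iff[of N "tgt p" p]
    unfolding serre_reps_def by (auto simp: hom_iff)
qed

text \<open>Weaker than \<open>serre_reps\<close> in that the outer parts need not be mono and epi.
  This admits left fractions, whose right denominator is an identity, so one relation compares them
  with triples.\<close>

definition fraction :: "'o \<Rightarrow> 'o \<Rightarrow> 'm \<Rightarrow> 'm \<Rightarrow> 'm \<Rightarrow> bool" where
  "fraction M N i f p \<longleftrightarrow> sig i \<and> tgt i = M \<and> arr f \<and> src f = src i \<and> tgt f = tgt p \<and> sig p \<and> src p = N"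

text \<open>Equality of the formal fractions \<open>i\<inverse> f p\<inverse>\<close> and \<open>i'\<inverse> f' p'\<inverse>\<close>, tested on all common refinements
  instead of a chosen one; by the Ore conditions there are enough of them for transitivity.\<close>

definition teq :: "'m \<Rightarrow> 'm \<Rightarrow> 'm \<Rightarrow> 'm \<Rightarrow> 'm \<Rightarrow> 'm \<Rightarrow> bool" where
  "teq i f p i' f' p' \<longleftrightarrow> (\<forall>a b c d. arr a \<and> arr b \<and> arr c \<and> arr d \<and> src a = src b \<and> tgt c = tgt d \<and>
    tgt a = src i \<and> tgt b = src i' \<and> src c = tgt p \<and> src d = tgt p' \<and> a \<cdot> i = b \<cdot> i' \<and> p \<cdot> c = p' \<cdot> d \<longrightarrow>
    a \<cdot> (f \<cdot> c) \<approx> b \<cdot> (f' \<cdot> d))"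

lemma fractionD:
  assumes "fraction M N i f p"
  shows "sig i" "arr i" "tgt i = M" "arr f" "src f = src i" "tgt f = tgt p" "sig p" "arr p" "src p = N"
  using assms sig_arr by (simp_all add: fraction_def)

lemma serre_reps_fraction: "(i, f, p) \<in> serre_reps A C M N \<Longrightarrow> fraction M N i f p"
  by (auto simp: serre_reps_iff fraction_def is_mono_iff is_epi_iff)

lemma teqD:
  assumes "teq i f p i' f' p'" "a \<cdot> i = b \<cdot> i'" "p \<cdot> c = p' \<cdot> d"
    "arr a" "arr b" "arr c" "arr d" "src a = src b" "tgt c = tgt d"
    "tgt a = src i" "tgt b = src i'" "src c = tgt p" "src d = tgt p'"
  shows "a \<cdot> (f \<cdot> c) \<approx> b \<cdot> (f' \<cdot> d)"
  using assms unfolding teq_def by blast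

lemma teqI:
  assumes "\<And>a b c d. arr a \<Longrightarrow> arr b \<Longrightarrow> arr c \<Longrightarrow> arr d \<Longrightarrow> src a = src b \<Longrightarrow> tgt c = tgt d \<Longrightarrow>
    tgt a = src i \<Longrightarrow> tgt b = src i' \<Longrightarrow> src c = tgt p \<Longrightarrow> src d = tgt p' \<Longrightarrow>
    a \<cdot> i = b \<cdot> i' \<Longrightarrow> p \<cdot> c = p' \<cdot> d \<Longrightarrow> a \<cdot> (f \<cdot> c) \<approx> b \<cdot> (f' \<cdot> d)"
  shows "teq i f p i' f' p'"
  using assms unfolding teq_def by blast

lemma teq_sym: "teq i f p i' f' p' \<Longrightarrow> teq i' f' p' i f p"
  unfolding teq_def using cong_sym by metis

text \<open>The Ore conditions refine a comparison of the outer fractions until it reaches the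
  middle one on both sides. The refining morphisms \<open>u\<close> and \<open>x\<close> lie in
  \<open>sig\<close> and cancel from the resulting congruence.\<close>

lemma teq_trans:
  assumes F: "fraction M N i f p" "fraction M N i' f' p'" "fraction M N i'' f'' p''"
    and t: "teq i f p i' f' p'" "teq i' f' p' i'' f'' p''"
  shows "teq i f p i'' f'' p''"
proof (rule teqI)
  note [simp] = fractionD[OF F(1)] fractionD[OF F(2)] fractionD[OF F(3)]
  fix a b c d assume [simp]: "arr a" "arr b" "arr c" "arr d" "src a = src b" "tgt c = tgt d"
    "tgt a = src i" "tgt b = src i''" "src c = tgt p" "src d = tgt p''"
    and ab: "a \<cdot> i = b \<cdot> i''" and cd: "p \<cdot> c = p'' \<cdot> d"
  obtain u v where [simp]: "arr u" "arr v" "src v = src u" "tgt u = src b" "tgt v = src i'"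
    and u: "sig u" "u \<cdot> (a \<cdot> i) = v \<cdot> i'" by (rule ore[of i' "a \<cdot> i"]) simp_all
  obtain x y where [simp]: "arr x" "arr y" "tgt y = tgt x" "src x = tgt d" "src y = tgt p'"
    and x: "sig x" "(p \<cdot> c) \<cdot> x = p' \<cdot> y" by (rule coore[of p' "p \<cdot> c"]) simp_all
  have "(u \<cdot> a) \<cdot> (f \<cdot> (c \<cdot> x)) \<approx> v \<cdot> (f' \<cdot> y)"
    by (rule teqD[OF t(1)]) (use u x in simp_all)
  also have "v \<cdot> (f' \<cdot> y) \<approx> (u \<cdot> b) \<cdot> (f'' \<cdot> (d \<cdot> x))"
    by (rule teqD[OF t(2)]) (use u x ab cd comp_reduce[OF cd, of x] in simp_all)
  finally have "u \<cdot> ((a \<cdot> (f \<cdot> c)) \<cdot> x) \<approx> u \<cdot> ((b \<cdot> (f'' \<cdot> d)) \<cdot> x)" by simp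
  then have "(a \<cdot> (f \<cdot> c)) \<cdot> x \<approx> (b \<cdot> (f'' \<cdot> d)) \<cdot> x"
    by (rule cong_cancel_left[OF _ u(1)]) simp_all
  then show "a \<cdot> (f \<cdot> c) \<approx> b \<cdot> (f'' \<cdot> d)"
    by (rule cong_cancel_right[OF _ x(1)]) simp_all
qed

text \<open>Any other refinement is joined to the given one by Ore squares. Their legs then agree up
  to small morphisms, since \<open>i\<close>, \<open>i'\<close>, \<open>p\<close> and
  \<open>p'\<close> cancel modulo \<open>\<approx>\<close>, and \<open>teq\<close> asks for no more
  than that.\<close>

lemma teq_witness:
  assumes F: "fraction M N i f p" "fraction M N i' f' p'"
    and [simp]: "arr a" "arr a'" "arr b" "arr b'" "tgt a = src i" "tgt a' = src i'"
      "src b = tgt p" "src b' = tgt p'" "src a = src a'" "tgt b = tgt b'"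
    and ai: "a \<cdot> i = a' \<cdot> i'" "sig (a \<cdot> i)" and pb: "p \<cdot> b = p' \<cdot> b'" "sig (p \<cdot> b)"
    and e: "a \<cdot> (f \<cdot> b) \<approx> a' \<cdot> (f' \<cdot> b')"
  shows "teq i f p i' f' p'"
proof (rule teqI)
  note [simp] = fractionD[OF F(1)] fractionD[OF F(2)]
  fix x y z w assume [simp]: "arr x" "arr y" "arr z" "arr w" "src x = src y" "tgt z = tgt w"
    "tgt x = src i" "tgt y = src i'" "src z = tgt p" "src w = tgt p'"
    and xy: "x \<cdot> i = y \<cdot> i'" and zw: "p \<cdot> z = p' \<cdot> w"
  obtain u v where [simp]: "arr u" "arr v" "src v = src u" "tgt u = src y" "tgt v = src a'"
    and u: "sig u" "u \<cdot> (x \<cdot> i) = v \<cdot> (a \<cdot> i)" by (rule ore[OF ai(2), of "x \<cdot> i"]) simp_all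
  obtain r q where [simp]: "arr r" "arr q" "tgt q = tgt r" "src r = tgt w" "src q = tgt b'"
    and r: "sig r" "(p \<cdot> z) \<cdot> r = (p \<cdot> b) \<cdot> q" by (rule coore[OF pb(2), of "p \<cdot> z"]) simp_all
  have 1: "u \<cdot> x \<approx> v \<cdot> a"
    by (rule cong_cancel_right[of _ i]) (use u cong_refl[of "v \<cdot> (a \<cdot> i)"] in simp_all)
  have "u \<cdot> (y \<cdot> i') = v \<cdot> (a' \<cdot> i')" using u(2) unfolding xy ai(1) .
  then have 2: "u \<cdot> y \<approx> v \<cdot> a'"
    by - (rule cong_cancel_right[of _ i'], use cong_refl[of "v \<cdot> (a' \<cdot> i')"] in simp_all)
  have 3: "z \<cdot> r \<approx> b \<cdot> q"
    by (rule cong_cancel_left[of p]) (use r cong_refl[of "p \<cdot> (b \<cdot> q)"] in simp_all)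
  have "p' \<cdot> (w \<cdot> r) = p' \<cdot> (b' \<cdot> q)"
    using comp_reduce[OF zw[symmetric], of r] comp_reduce[OF pb(1)[symmetric], of q] r by simp
  then have 4: "w \<cdot> r \<approx> b' \<cdot> q"
    by - (rule cong_cancel_left[of p'], use cong_refl[of "p' \<cdot> (b' \<cdot> q)"] in simp_all)
  have "(u \<cdot> x) \<cdot> (f \<cdot> (z \<cdot> r)) \<approx> (v \<cdot> a) \<cdot> (f \<cdot> (z \<cdot> r))" by (rule cong_comp_right[OF 1]) simp_all
  also have "\<dots> \<approx> (v \<cdot> a) \<cdot> (f \<cdot> (b \<cdot> q))" by (intro cong_comp_left 3) simp_all
  also have "(v \<cdot> a) \<cdot> (f \<cdot> (b \<cdot> q)) = v \<cdot> ((a \<cdot> (f \<cdot> b)) \<cdot> q)" by simp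
  also have "\<dots> \<approx> v \<cdot> ((a' \<cdot> (f' \<cdot> b')) \<cdot> q)" by (intro cong_comp_left cong_comp_right e) simp_all
  also have "\<dots> = (v \<cdot> a') \<cdot> (f' \<cdot> (b' \<cdot> q))" by simp
  also have "\<dots> \<approx> (v \<cdot> a') \<cdot> (f' \<cdot> (w \<cdot> r))" by (intro cong_comp_left cong_sym[OF 4]) simp_all
  also have "\<dots> \<approx> (u \<cdot> y) \<cdot> (f' \<cdot> (w \<cdot> r))" by (rule cong_comp_right[OF cong_sym[OF 2]]) simp_all
  finally have "u \<cdot> ((x \<cdot> (f \<cdot> z)) \<cdot> r) \<approx> u \<cdot> ((y \<cdot> (f' \<cdot> w)) \<cdot> r)" by simp
  then have "(x \<cdot> (f \<cdot> z)) \<cdot> r \<approx> (y \<cdot> (f' \<cdot> w)) \<cdot> r"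
    by (rule cong_cancel_left[OF _ u(1)]) simp_all
  then show "x \<cdot> (f \<cdot> z) \<approx> y \<cdot> (f' \<cdot> w)"
    by (rule cong_cancel_right[OF _ r(1)]) simp_all
qed

lemma serre_transition_teq:
  assumes "((i, f, p), (i', f', p')) \<in> serre_transition A C M N"
  shows "(i, f, p) \<in> serre_reps A C M N" "(i', f', p') \<in> serre_reps A C M N" "teq i f p i' f' p'"
proof -
  obtain a b M' M'' Q' Q'' where r: "(i, f, p) \<in> serre_reps A C M N" and
    h: "f \<in> Hom A M' Q'" "a \<in> Hom A M'' M'" "b \<in> Hom A Q' Q''" and
    e: "i' = a \<cdot> i" "f' = a \<cdot> f \<cdot> b" "p' = p \<cdot> b" and
    r': "(i', f', p') \<in> serre_reps A C M N"
    using assms unfolding serre_transition_def by blast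
  show "(i, f, p) \<in> serre_reps A C M N" "(i', f', p') \<in> serre_reps A C M N" using r r' .
  note F = serre_reps_fraction[OF r] serre_reps_fraction[OF r']
  note [simp] = h[unfolded hom_iff] fractionD[OF F(1)]
  have [simp]: "src i = M'" "tgt p = Q'"
    using fractionD(5,6)[OF F(1)] h(1) by (simp_all add: hom_iff)
  show "teq i f p i' f' p'"
    by (rule teq_witness[OF F, of a "Ident A M''" b "Ident A Q''"])
      (use fractionD[OF F(2)] e src_Ob[of a] tgt_Ob[of b] in \<open>simp_all add: cong_refl\<close>)
qed

lemma serre_transitionI:
  assumes r: "(i, f, p) \<in> serre_reps A C M N"
    and s: "(a \<cdot> i, a \<cdot> f \<cdot> b, p \<cdot> b) \<in> serre_reps A C M N"
    and ab: "arr a" "tgt a = src i" "arr b" "src b = tgt p"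
  shows "((i, f, p), (a \<cdot> i, a \<cdot> f \<cdot> b, p \<cdot> b)) \<in> serre_transition A C M N"
proof -
  note [simp] = fractionD[OF serre_reps_fraction[OF r]]
  have "f \<in> Hom A (src i) (tgt p)" "a \<in> Hom A (src a) (src i)" "b \<in> Hom A (tgt p) (tgt b)"
    using ab by (simp_all add: hom_iff)
  then show ?thesis unfolding serre_transition_def using r s by blast
qed

text \<open>The direct limit demands strict equality. Common refinements by a mono and an epi give
  numerators with small difference, and restriction to the kernel of this difference, which lies in
  \<open>sig\<close>, makes them equal.\<close>

lemma teq_transition:
  assumes r: "(i, f, p) \<in> serre_reps A C M N" and r': "(i', f', p') \<in> serre_reps A C M N"
    and t: "teq i f p i' f' p'"
  obtains x where "((i, f, p), x) \<in> serre_transition A C M N" "((i', f', p'), x) \<in> serre_transition A C M N"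
proof -
  note F = serre_reps_fraction[OF r] serre_reps_fraction[OF r']
  note [simp] = fractionD[OF F(1)] fractionD[OF F(2)]
  have m: "is_mono A (src i) M i" "is_mono A (src i') M i'" "is_epi A N (tgt p) p" "is_epi A N (tgt p') p'"
    using r r' by (simp_all add: serre_reps_iff)
  obtain J a a' where a: "is_mono A J (src i) a" "sig a" and [simp]: "arr a'" "src a' = J" "tgt a' = src i'"
    and ai: "a \<cdot> i = a' \<cdot> i'" by (rule ore_mono[OF _ m(2), of i]) simp_all
  note [simp] = is_monoD[OF a(1)]
  obtain K b b' where b: "is_epi A (tgt p) K b" "sig b" and [simp]: "arr b'" "tgt b' = K" "src b' = tgt p'"
    and pb: "p \<cdot> b = p' \<cdot> b'" by (rule coore_epi[OF _ m(4), of p]) simp_all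
  note [simp] = is_epiD[OF b(1)]
  have c: "a \<cdot> (f \<cdot> b) \<approx> a' \<cdot> (f' \<cdot> b')" by (rule teqD[OF t ai pb]) simp_all
  let ?d = "a \<cdot> (f \<cdot> b) \<ominus> a' \<cdot> (f' \<cdot> b')"
  have "?d \<in> Hom A J K" by (simp add: hom_iff)
  then obtain L k where k: "is_kernel A J K ?d L k" using kernel by blast
  note [simp] = is_kernelD(4-6)[OF k]
  have kk: "is_mono A L J k" "sig k" using is_kernelD(8)[OF k] sig_kernel[OF congD(5)[OF c] k] .
  have e: "(k \<cdot> a) \<cdot> f \<cdot> b = (k \<cdot> a') \<cdot> f' \<cdot> b'"
    by (rule minus_eq_zero) (use is_kernelD(7)[OF k] in simp_all)
  have e2: "(k \<cdot> a) \<cdot> i = (k \<cdot> a') \<cdot> i'" using ai by simp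
  have "is_mono A L M ((k \<cdot> a) \<cdot> i)" using mono_comp[OF mono_comp[OF kk(1) a(1)] m(1)] .
  moreover have "is_epi A N K (p \<cdot> b)" using epi_comp[OF m(3) b(1)] .
  moreover have "sig ((k \<cdot> a) \<cdot> i)" "sig (p \<cdot> b)" using a b kk by (auto intro!: sig_comp)
  ultimately have s: "((k \<cdot> a) \<cdot> i, (k \<cdot> a) \<cdot> f \<cdot> b, p \<cdot> b) \<in> serre_reps A C M N"
    by (simp add: serre_reps_iff)
  then have "((i, f, p), ((k \<cdot> a) \<cdot> i, (k \<cdot> a) \<cdot> f \<cdot> b, p \<cdot> b)) \<in> serre_transition A C M N"
    by (intro serre_transitionI r) simp_all
  moreover have "((i', f', p'), ((k \<cdot> a') \<cdot> i', (k \<cdot> a') \<cdot> f' \<cdot> b', p' \<cdot> b')) \<in> serre_transition A C M N"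
    by (intro serre_transitionI r') (use s in \<open>simp_all only: e e2 pb\<close>, simp_all)
  ultimately show ?thesis using that unfolding e e2 pb by blast
qed

lemma serre_reps_unique:
  assumes "(i, f, p) \<in> serre_reps A C M N" "(i, f, p) \<in> serre_reps A C M' N'" shows "M = M'" "N = N'"
  using serre_reps_fraction[OF assms(1)] serre_reps_fraction[OF assms(2)] by (auto simp: fraction_def)

text \<open>Transitions preserve \<open>teq\<close>, and conversely \<open>teq\<close> is realised
  by two transitions to one triple.\<close>

lemma serre_class_iff:
  assumes r: "(i, f, p) \<in> serre_reps A C M N"
  shows "(i', f', p') \<in> serre_class A C (i, f, p) \<longleftrightarrow> (i', f', p') \<in> serre_reps A C M N \<and> teq i f p i' f' p'"
proof
  assume "(i', f', p') \<in> serre_class A C (i, f, p)"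
  then obtain M' N' i'' f'' p'' where
    t: "((i, f, p), (i'', f'', p'')) \<in> serre_transition A C M' N'"
      "((i', f', p'), (i'', f'', p'')) \<in> serre_transition A C M' N'"
    unfolding serre_rel_def by auto
  \<comment> \<open>\<open>serre_rel\<close> quantifies over the ends, but a triple determines
    them.\<close>
  have [simp]: "M' = M" "N' = N" using serre_reps_unique[OF r serre_transition_teq(1)[OF t(1)]] by simp_all
  note t' = serre_transition_teq[OF t(1), simplified] serre_transition_teq[OF t(2), simplified]
  show "(i', f', p') \<in> serre_reps A C M N \<and> teq i f p i' f' p'"
    using t'(4) teq_trans[OF t'(1,2,4)[THEN serre_reps_fraction] t'(3) teq_sym[OF t'(6)]] by blast
next
  assume *: "(i', f', p') \<in> serre_reps A C M N \<and> teq i f p i' f' p'"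
  then obtain x where "((i, f, p), x) \<in> serre_transition A C M N" "((i', f', p'), x) \<in> serre_transition A C M N"
    using teq_transition[OF r] by blast
  then show "(i', f', p') \<in> serre_class A C (i, f, p)"
    unfolding serre_rel_def by blast
qed

section \<open>Left fractions and their classes\<close>

definition roof :: "'o \<Rightarrow> 'o \<Rightarrow> 'm \<Rightarrow> 'm \<Rightarrow> bool" where
  "roof M N s f \<longleftrightarrow> sig s \<and> tgt s = M \<and> arr f \<and> src f = src s \<and> tgt f = N"

text \<open>The class of the formal fraction \<open>s\<inverse> f\<close>.\<close>

definition rc :: "'m \<Rightarrow> 'm \<Rightarrow> ('m \<times> 'm \<times> 'm) set" where
  "rc s f = {(i, g, p). (i, g, p) \<in> serre_reps A C (tgt s) (tgt f) \<and> teq s f (Ident A (tgt f)) i g p}"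

lemma roofD:
  assumes "roof M N s f"
  shows "sig s" "arr s" "tgt s = M" "arr f" "src f = src s" "tgt f = N" "M \<in> Ob A" "N \<in> Ob A"
  using assms sig_arr tgt_Ob by (auto simp: roof_def)

lemma roof_fraction: "roof M N s f \<Longrightarrow> fraction M N s f (Ident A N)"
  using roofD[of M N s f] by (simp add: fraction_def sig_id)

lemma roof_cong:
  assumes R: "roof M N s f" and R': "roof M N s' f'" and t: "teq s f (Ident A N) s' f' (Ident A N)"
    and a: "arr a" "arr b" "src a = src b" "tgt a = src s" "tgt b = src s'" "a \<cdot> s = b \<cdot> s'"
  shows "a \<cdot> f \<approx> b \<cdot> f'"
proof -
  note [simp] = roofD[OF R] roofD[OF R'] a(1-5)
  show ?thesis using teqD[OF t a(6), of "Ident A N" "Ident A N"] by simp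
qed

lemma roof_triple:
  assumes R: "roof M N s f" and r: "(i, g, p) \<in> serre_reps A C M N"
    and u: "arr u" "src u = src s" "tgt u = src i" "u \<cdot> i = s" "u \<cdot> g = f \<cdot> p"
  shows "teq s f (Ident A N) i g p"
proof -
  note F = roof_fraction[OF R] serre_reps_fraction[OF r]
  note [simp] = fractionD[OF F(1)] fractionD[OF F(2)] u(1-3) roofD[OF R]
  show ?thesis
    by (rule teq_witness[OF F, of "Ident A (src s)" u p "Ident A (tgt p)"])
      (use u(4,5) in \<open>simp_all add: cong_refl\<close>)
qed

lemma rc_iff:
  "roof M N s f \<Longrightarrow> (i, g, p) \<in> rc s f \<longleftrightarrow> (i, g, p) \<in> serre_reps A C M N \<and> teq s f (Ident A N) i g p"
  by (simp add: rc_def roofD)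

lemma serre_class_rc:
  assumes R: "roof M N s f" and r: "(i, g, p) \<in> serre_reps A C M N" and t: "teq s f (Ident A N) i g p"
  shows "serre_class A C (i, g, p) = rc s f"
proof -
  note F = roof_fraction[OF R] serre_reps_fraction[OF r]
  have "(i', f', p') \<in> serre_class A C (i, g, p) \<longleftrightarrow> (i', f', p') \<in> rc s f" for i' f' p'
    unfolding serre_class_iff[OF r] rc_iff[OF R]
    using teq_trans[OF F serre_reps_fraction t] teq_trans[OF F(2) F(1) serre_reps_fraction teq_sym[OF t]]
    by blast
  then show ?thesis by (rule triple_set_eqI)
qed

lemma roof_of_triple:
  assumes r: "(i, g, p) \<in> serre_reps A C M N"
  obtains s f where "roof M N s f" "teq s f (Ident A N) i g p"
proof -
  note [simp] = fractionD[OF serre_reps_fraction[OF r]]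
  obtain u v where u: "sig u" "u \<cdot> g = v \<cdot> p" and [simp]: "arr u" "arr v" "src v = src u" "tgt u = src i" "tgt v = N"
    by (rule ore[of p g]) simp_all
  have R: "roof M N (u \<cdot> i) v" using u(1) by (simp add: roof_def sig_comp)
  then show ?thesis using that[OF R roof_triple[OF R r, of u]] u by simp
qed

text \<open>The kernel \<open>k\<close> of the epi part is killed by \<open>s\<close>, which makes
  it small; the mono part inherits \<open>sig\<close> from \<open>s\<close>.\<close>

lemma image_factor:
  assumes [simp]: "sig s"
  obtains I e i K k where "is_epi A (src s) I e" "is_mono A I (tgt s) i" "sig i" "e \<cdot> i = s"
    "is_kernel A (src s) I e K k" "is_cokernel A K (src s) k I e" "small k"
proof -
  have [simp]: "arr s" by (rule sig_arr) simp
  obtain I e i where e: "is_epi A (src s) I e" and i: "is_mono A I (tgt s) i" and ei: "e \<cdot> i = s"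
    using image_ex[of s] by auto
  note [simp] = is_epiD[OF e] is_monoD[OF i]
  obtain K k where k: "is_kernel A (src s) I e K k" "is_cokernel A K (src s) k I e"
    using cokernel_of_kernel[OF e] .
  note [simp] = is_kernelD(4-6)[OF k(1)]
  have "k \<cdot> s = Zero A K (tgt s)"
    using comp_reduce[OF is_kernelD(7)[OF k(1)], of i] ei src_Ob[of k] by simp
  then have "small k" using assms unfolding sig_def by simp
  moreover have "sig i" by (rule sig_mono_factor[OF i, of e]) (use assms ei in simp_all)
  ultimately show ?thesis using that e i ei k by blast
qed

text \<open>All choices are parameters. The same statement then serves the existence proof, the
  addition of two fractions over the same \<open>i\<close> and \<open>p\<close>, and the computed
  triple.\<close>

lemma triple_of_roof:
  assumes R: "roof M N s f"
    and e: "is_epi A (src s) I e" and i: "is_mono A I M i" "sig i" and ei: "e \<cdot> i = s"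
    and p: "is_epi A N Q p" "sig p" and g: "arr g" "src g = I" "tgt g = Q" "e \<cdot> g = f \<cdot> p"
  shows "(i, g, p) \<in> serre_reps A C M N" "teq s f (Ident A N) i g p"
proof -
  note [simp] = is_epiD[OF e] is_monoD[OF i(1)] is_epiD[OF p(1)] roofD[OF R] g(1-3)
  show r: "(i, g, p) \<in> serre_reps A C M N" using i p by (simp add: serre_reps_iff)
  show "teq s f (Ident A N) i g p" by (rule roof_triple[OF R r, of e]) (use g ei in simp_all)
qed

text \<open>The numerator \<open>f\<close> need not vanish on the kernel \<open>k\<close> of the epi
  part, but \<open>k \<cdot> f\<close> is small. Dividing \<open>N\<close> by its image lets
  \<open>f \<cdot> p\<close> descend along \<open>e\<close>.\<close>

lemma triple_of_roof_ex:
  assumes R: "roof M N s f"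
  obtains i g p where "(i, g, p) \<in> serre_reps A C M N" "teq s f (Ident A N) i g p"
proof -
  note [simp] = roofD[OF R]
  obtain I e i K k where *: "is_epi A (src s) I e" "is_mono A I (tgt s) i" "sig i" "e \<cdot> i = s"
    "is_kernel A (src s) I e K k" "is_cokernel A K (src s) k I e" "small k"
    by (rule image_factor[of s]) simp_all
  note [simp] = is_kernelD(4-6)[OF *(5)]
  have kf: "small (k \<cdot> f)" using small_comp_right[OF *(7), of f] by simp
  have "k \<cdot> f \<in> Hom A K N" by (simp add: hom_iff)
  then obtain Q p where p: "is_cokernel A K N (k \<cdot> f) Q p" using cokernel by blast
  note [simp] = is_cokernelD(4-6)[OF p]
  obtain g where g: "arr g" "tgt g = Q" "src g = I" "e \<cdot> g = f \<cdot> p"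
    by (rule cokernel_colift[OF *(6), of "f \<cdot> p"]) (use is_cokernelD(7)[OF p] in simp_all)
  show ?thesis
    by (rule that[OF triple_of_roof[OF R *(1) _ *(3,4) is_cokernelD(8)[OF p] sig_cokernel[OF kf p] g(1,3,2,4)]])
      (use * in simp_all)
qed

text \<open>The common class is non-empty; both fractions are \<open>teq\<close> to any triple in
  it, hence to each other.\<close>

lemma rc_eqD:
  assumes R: "roof M N s f" and R': "roof M N s' f'" and e: "rc s f = rc s' f'"
    and a: "arr a" "arr b" "src a = src b" "tgt a = src s" "tgt b = src s'" "a \<cdot> s = b \<cdot> s'"
  shows "a \<cdot> f \<approx> b \<cdot> f'"
proof -
  obtain i g p where r: "(i, g, p) \<in> serre_reps A C M N" "teq s f (Ident A N) i g p"
    using triple_of_roof_ex[OF R] .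
  then have "(i, g, p) \<in> rc s' f'" unfolding e[symmetric] by (simp add: rc_def roofD[OF R])
  then have t: "teq s' f' (Ident A N) i g p" by (simp add: rc_def roofD[OF R'])
  show ?thesis
    using roof_cong[OF R R' teq_trans[OF roof_fraction[OF R] serre_reps_fraction[OF r(1)] roof_fraction[OF R'] r(2) teq_sym[OF t]] a] .
qed

lemma rc_eqI:
  assumes R: "roof M N s f" and R': "roof M N s' f'"
    and a: "arr a" "arr b" "src a = src b" "tgt a = src s" "tgt b = src s'" "a \<cdot> s = b \<cdot> s'"
    and s: "sig (a \<cdot> s)" and e: "a \<cdot> f \<approx> b \<cdot> f'"
  shows "rc s f = rc s' f'"
proof -
  note F = roof_fraction[OF R] roof_fraction[OF R']
  note [simp] = roofD[OF R] roofD[OF R'] a(1-5)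
  have t: "teq s f (Ident A N) s' f' (Ident A N)"
    by (rule teq_witness[OF F, of a b "Ident A N" "Ident A N"]) (use a s e in \<open>simp_all add: sig_id\<close>)
  have "(i, g, p) \<in> rc s f \<longleftrightarrow> (i, g, p) \<in> rc s' f'" for i g p
    unfolding rc_iff[OF R] rc_iff[OF R']
    using teq_trans[OF F serre_reps_fraction t] teq_trans[OF F(2) F(1) serre_reps_fraction teq_sym[OF t]]
    by blast
  then show ?thesis by (rule triple_set_eqI)
qed

lemma Hom_serre_quotient:
  "X \<in> Hom (serre_quotient A C) M N \<longleftrightarrow> (\<exists>s f. roof M N s f \<and> X = rc s f)"
proof
  assume "X \<in> Hom (serre_quotient A C) M N"
  then obtain i g p where r: "(i, g, p) \<in> serre_reps A C M N" and X: "X = serre_class A C (i, g, p)"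
    unfolding serre_quotient_def by (auto elim!: quotientE)
  then show "\<exists>s f. roof M N s f \<and> X = rc s f"
    using roof_of_triple[OF r] serre_class_rc[OF _ r] by metis
next
  assume "\<exists>s f. roof M N s f \<and> X = rc s f"
  then obtain s f where R: "roof M N s f" and X: "X = rc s f" by blast
  obtain i g p where r: "(i, g, p) \<in> serre_reps A C M N" "teq s f (Ident A N) i g p"
    using triple_of_roof_ex[OF R] .
  then show "X \<in> Hom (serre_quotient A C) M N"
    using quotientI[OF r(1), of "serre_rel A C"] serre_class_rc[OF R r] by (simp add: serre_quotient_def X)
qed

end

section \<open>The Serre quotient is Abelian\<close>

context thick_subcategory
begin

abbreviation Q :: "('o, ('m \<times> 'm \<times> 'm) set) category_data" where
  "Q \<equiv> serre_quotient A C"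

section \<open>Composition and addition of left fractions\<close>

abbreviation comp_class (infixl "\<odot>" 70) where
  "X \<odot> Y \<equiv> serre_comp A C X Y"

lemma roofI: "sig s \<Longrightarrow> tgt s = M \<Longrightarrow> arr f \<Longrightarrow> src f = src s \<Longrightarrow> tgt f = N \<Longrightarrow> roof M N s f"
  by (simp add: roof_def)

text \<open>Ore squares for \<open>i\<close> and \<open>i'\<close> bring representatives and
  fractions over one source. Cancelling the mono \<open>m\<close> there shows that the two ways into
  the image \<open>I\<close> agree up to small morphisms, so \<open>e \<cdot> g0\<close> may be
  replaced by \<open>f0 \<cdot> g0\<close>.\<close>

lemma comp_sound:
  assumes R: "roof L M s (q \<cdot> t)" and R': "roof M N t g"
    and q [simp]: "arr q" "src q = src s" "tgt q = src t"
    and t1: "(i, f0 \<cdot> m, p) \<in> rc s (q \<cdot> t)" and t2: "(i', e \<cdot> g0, p') \<in> rc t g"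
    and e: "is_epi A M' I e" and m: "is_mono A I P m" and em: "i' \<cdot> p = e \<cdot> m"
    and fg: "f0 \<in> Hom A L' I" "g0 \<in> Hom A I P'"
  shows "(i, f0 \<cdot> g0, p') \<in> serre_reps A C L N" "teq s (q \<cdot> g) (Ident A N) i (f0 \<cdot> g0) p'"
proof -
  note r1 = t1[unfolded rc_iff[OF R], THEN conjunct1] and r2 = t2[unfolded rc_iff[OF R'], THEN conjunct1]
  note e1 = t1[unfolded rc_iff[OF R], THEN conjunct2] and e2 = t2[unfolded rc_iff[OF R'], THEN conjunct2]
  note [simp] = roofD[OF R] roofD[OF R'] is_epiD[OF e] is_monoD[OF m] fg[unfolded hom_iff]
  note F1 = fractionD[OF serre_reps_fraction[OF r1]] and F2 = fractionD[OF serre_reps_fraction[OF r2]]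
  have [simp]: "sig i" "arr i" "tgt i = L" "src i = L'" "sig p" "arr p" "src p = M" "tgt p = P"
    using F1 by simp_all
  have [simp]: "sig i'" "arr i'" "tgt i' = M" "src i' = M'" "sig p'" "arr p'" "src p' = N" "tgt p' = P'"
    using F2 by simp_all
  have [simp]: "P' \<in> Ob A" "P \<in> Ob A" using tgt_Ob[of p'] tgt_Ob[of p] by simp_all
  show r: "(i, f0 \<cdot> g0, p') \<in> serre_reps A C L N"
    using r1 r2 by (simp add: serre_reps_iff)
  have R2: "roof L N s (q \<cdot> g)" by (rule roofI) simp_all
  obtain a a' where [simp]: "sig a" "arr a" "arr a'" "src a' = src a" "tgt a = src s" "tgt a' = L'"
    and aa: "a \<cdot> s = a' \<cdot> i" by (rule ore[of i s]) simp_all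
  obtain b b' where [simp]: "sig b" "arr b" "arr b'" "src b' = src b" "tgt b = src a" "tgt b' = M'"
    and bb: "b \<cdot> ((a \<cdot> q) \<cdot> t) = b' \<cdot> i'" by (rule ore[of i' "(a \<cdot> q) \<cdot> t"]) simp_all
  have "sig (b \<cdot> (a \<cdot> s))" by (simp add: sig_comp)
  then have [simp]: "sig (b \<cdot> (a' \<cdot> i))" unfolding aa .
  have x1: "(b \<cdot> (a \<cdot> q)) \<cdot> (g \<cdot> p') \<approx> b' \<cdot> ((e \<cdot> g0) \<cdot> Ident A P')"
    by (rule teqD[OF e2]) (use bb in simp_all)
  have x2: "(b \<cdot> a) \<cdot> ((q \<cdot> t) \<cdot> p) \<approx> (b \<cdot> a') \<cdot> ((f0 \<cdot> m) \<cdot> Ident A P)"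
    by (rule teqD[OF e1]) (use aa in simp_all)
  have "(b \<cdot> a) \<cdot> ((q \<cdot> t) \<cdot> p) = (b \<cdot> ((a \<cdot> q) \<cdot> t)) \<cdot> p" by simp
  also have "\<dots> = b' \<cdot> (i' \<cdot> p)" unfolding bb by simp
  also have "\<dots> = (b' \<cdot> e) \<cdot> m" unfolding em by simp
  finally have "(b' \<cdot> e) \<cdot> m \<approx> ((b \<cdot> a') \<cdot> f0) \<cdot> m" using x2 by simp
  then have x3: "b' \<cdot> e \<approx> (b \<cdot> a') \<cdot> f0" by (rule cong_mono_cancel[OF _ m]) simp_all
  have "(b \<cdot> a) \<cdot> ((q \<cdot> g) \<cdot> p') \<approx> (b' \<cdot> e) \<cdot> g0" using x1 by simp
  also have "(b' \<cdot> e) \<cdot> g0 \<approx> ((b \<cdot> a') \<cdot> f0) \<cdot> g0" by (rule cong_comp_right[OF x3]) simp_all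
  finally have x4: "(b \<cdot> a) \<cdot> ((q \<cdot> g) \<cdot> p') \<approx> (b \<cdot> a') \<cdot> ((f0 \<cdot> g0) \<cdot> Ident A P')" by simp
  show "teq s (q \<cdot> g) (Ident A N) i (f0 \<cdot> g0) p'"
    by (rule teq_witness[OF roof_fraction[OF R2] serre_reps_fraction[OF r], of "b \<cdot> a" "b \<cdot> a'" p' "Ident A P'"])
      (use x4 aa in \<open>simp_all add: sig_comp\<close>)
qed

text \<open>The source of the first representative is cut down to the part that \<open>f\<close>
  maps into the image \<open>I\<close>, as the kernel of \<open>f \<cdot> c\<close>. The target of
  the second is divided by the image of \<open>k \<cdot> h\<close>, so that \<open>h\<close>
  descends to \<open>I\<close>. Both changes lie in \<open>sig\<close> because \<open>c\<close> and
  \<open>k\<close> are small.\<close>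

lemma comp_exists:
  assumes r1: "(i, f, p) \<in> serre_reps A C L M" and r2: "(i', h, p') \<in> serre_reps A C M N"
  obtains L' M' P' P I j f0 m e g0 r where "(j, f0 \<cdot> m, p) \<in> serre_reps A C L M" "teq i f p j (f0 \<cdot> m) p"
    "(i', e \<cdot> g0, r) \<in> serre_reps A C M N" "teq i' h p' i' (e \<cdot> g0) r"
    "is_epi A M' I e" "is_mono A I P m" "i' \<cdot> p = e \<cdot> m" "f0 \<in> Hom A L' I" "g0 \<in> Hom A I P'"
proof -
  note [simp] = fractionD[OF serre_reps_fraction[OF r1]] fractionD[OF serre_reps_fraction[OF r2]]
  obtain I e m where "is_epi A (src (i' \<cdot> p)) I e" "is_mono A I (tgt (i' \<cdot> p)) m" and em: "e \<cdot> m = i' \<cdot> p"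
    by (rule image_ex[of "i' \<cdot> p"]) simp_all
  then have e: "is_epi A (src i') I e" and m: "is_mono A I (tgt p) m" by simp_all
  note [simp] = is_epiD[OF e] is_monoD[OF m]
  have [simp]: "I \<in> Ob A" using src_Ob[of m] by simp
  obtain X c where c: "is_cokernel A I (tgt p) m X c" "is_kernel A (tgt p) X c I m"
    using kernel_of_cokernel[OF m] .
  note [simp] = is_cokernelD(4-7)[OF c(1)]
  have "i' \<cdot> (p \<cdot> c) = Zero A (src i') X" using comp_reduce[OF em[symmetric], of c] tgt_Ob[of c] by simp
  then have "small (p \<cdot> c)"
    using sig_small_left[of i' "p \<cdot> c"] small_zero[of "src i'" X] tgt_Ob[of c] src_Ob[of i'] by simp
  then have "small c" using sig_small_left[of p c] by simp
  then have fc: "small (f \<cdot> c)" using small_comp_left[of c f] by simp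
  have "f \<cdot> c \<in> Hom A (src i) X" by (simp add: hom_iff)
  then obtain K a where a: "is_kernel A (src i) X (f \<cdot> c) K a" using kernel by blast
  note [simp] = is_kernelD(4-6)[OF a]
  have siga [simp]: "sig a" using sig_kernel[OF fc a] .
  obtain f0 where f0 [simp]: "arr f0" "src f0 = src (a \<cdot> f)" "tgt f0 = I" and f0': "f0 \<cdot> m = a \<cdot> f"
    by (rule kernel_lift[OF c(2), of "a \<cdot> f"]) (use is_kernelD(7)[OF a] in simp_all)
  have im: "is_mono A (src i) L i" "is_epi A M (tgt p) p" "is_mono A (src i') M i'" "is_epi A N (tgt p') p'"
    using r1 r2 by (simp_all add: serre_reps_iff)
  have j: "(a \<cdot> i, f0 \<cdot> m, p) \<in> serre_reps A C L M"
    using mono_comp[OF is_kernelD(8)[OF a] im(1)] im by (simp add: serre_reps_iff sig_comp)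
  have tj: "teq i f p (a \<cdot> i) (f0 \<cdot> m) p"
    by (rule teq_witness[OF serre_reps_fraction[OF r1] serre_reps_fraction[OF j], of a "Ident A K" "Ident A (tgt p)" "Ident A (tgt p)"])
      (use src_Ob[of a] f0' in \<open>simp_all add: cong_refl sig_comp\<close>)
  obtain E k where k: "is_kernel A (src i') I e E k" "is_cokernel A E (src i') k I e"
    using cokernel_of_kernel[OF e] .
  note [simp] = is_kernelD(4-7)[OF k(1)]
  have "k \<cdot> (i' \<cdot> p) = Zero A E (tgt p)"
    unfolding em[symmetric] using comp_reduce[OF is_kernelD(7)[OF k(1)], of m] src_Ob[of k] by simp
  then have "small ((k \<cdot> i') \<cdot> p)" using small_zero[of E "tgt p"] src_Ob[of k] tgt_Ob[of p] by simp
  then have "small (k \<cdot> i')" by (rule sig_small_right[rotated]) simp_all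
  then have "small k" by (rule sig_small_right[rotated]) simp_all
  then have kh: "small (k \<cdot> h)" using small_comp_right[of k h] by simp
  have "k \<cdot> h \<in> Hom A E (tgt p')" by (simp add: hom_iff)
  then obtain P' b where b: "is_cokernel A E (tgt p') (k \<cdot> h) P' b" using cokernel by blast
  note [simp] = is_cokernelD(4-6)[OF b]
  have sigb [simp]: "sig b" using sig_cokernel[OF kh b] .
  obtain g0 where g0 [simp]: "arr g0" "tgt g0 = tgt (h \<cdot> b)" "src g0 = I" and g0': "e \<cdot> g0 = h \<cdot> b"
    by (rule cokernel_colift[OF k(2), of "h \<cdot> b"]) (use is_cokernelD(7)[OF b] in simp_all)
  have r: "(i', e \<cdot> g0, p' \<cdot> b) \<in> serre_reps A C M N"
    using epi_comp[OF im(4) is_cokernelD(8)[OF b]] im by (simp add: serre_reps_iff sig_comp)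
  have tr: "teq i' h p' i' (e \<cdot> g0) (p' \<cdot> b)"
    by (rule teq_witness[OF serre_reps_fraction[OF r2] serre_reps_fraction[OF r], of "Ident A (src i')" "Ident A (src i')" b "Ident A P'"])
      (use tgt_Ob[of b] g0' in \<open>simp_all add: cong_refl sig_comp\<close>)
  have "f0 \<in> Hom A K I" "g0 \<in> Hom A I P'" by (simp_all add: hom_iff)
  then show ?thesis using that[OF j tj r tr e m em[symmetric]] by blast
qed

text \<open>The union that defines the composite runs over a singleton: \<open>comp_sound\<close>
  leaves only one possible member, and \<open>comp_exists\<close> provides it.\<close>

lemma comp_rc_aligned:
  assumes R: "roof L M s (q \<cdot> t)" and R': "roof M N t g"
    and q: "arr q" "src q = src s" "tgt q = src t"
  shows "rc s (q \<cdot> t) \<odot> rc t g = rc s (q \<cdot> g)"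
proof -
  have R2: "roof L N s (q \<cdot> g)"
    using roofD[OF R] roofD[OF R'] q by (intro roofI) simp_all
  let ?S = "{serre_class A C (i, f0 \<cdot> g0, p') | L M N L' M' P P' I i f0 m p i' e g0 p'.
      (i, f0 \<cdot> m, p) \<in> rc s (q \<cdot> t) \<inter> serre_reps A C L M \<and>
      (i', e \<cdot> g0, p') \<in> rc t g \<inter> serre_reps A C M N \<and>
      is_epi A M' I e \<and> is_mono A I P m \<and> i' \<cdot> p = e \<cdot> m \<and> f0 \<in> Hom A L' I \<and> g0 \<in> Hom A I P'}"
  have "?S \<subseteq> {rc s (q \<cdot> g)}"
  proof
    fix X assume "X \<in> ?S"
    then obtain i f0 m p i' e g0 p' M' I P L' P' where X: "X = serre_class A C (i, f0 \<cdot> g0, p')"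
      and *: "(i, f0 \<cdot> m, p) \<in> rc s (q \<cdot> t)" "(i', e \<cdot> g0, p') \<in> rc t g" "is_epi A M' I e"
        "is_mono A I P m" "i' \<cdot> p = e \<cdot> m" "f0 \<in> Hom A L' I" "g0 \<in> Hom A I P'" by blast
    show "X \<in> {rc s (q \<cdot> g)}" unfolding X using serre_class_rc[OF R2 comp_sound[OF R R' q *]] by simp
  qed
  moreover have "?S \<noteq> {}"
  proof -
    obtain i f p where 1: "(i, f, p) \<in> serre_reps A C L M" "teq s (q \<cdot> t) (Ident A M) i f p"
      using triple_of_roof_ex[OF R] .
    obtain i' h p' where 2: "(i', h, p') \<in> serre_reps A C M N" "teq t g (Ident A N) i' h p'"
      using triple_of_roof_ex[OF R'] .
    obtain L' M' P' P I j f0 m e g0 r where *: "(j, f0 \<cdot> m, p) \<in> serre_reps A C L M" "teq i f p j (f0 \<cdot> m) p"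
      "(i', e \<cdot> g0, r) \<in> serre_reps A C M N" "teq i' h p' i' (e \<cdot> g0) r"
      "is_epi A M' I e" "is_mono A I P m" "i' \<cdot> p = e \<cdot> m" "f0 \<in> Hom A L' I" "g0 \<in> Hom A I P'"
      using comp_exists[OF 1(1) 2(1)] .
    have "(j, f0 \<cdot> m, p) \<in> rc s (q \<cdot> t) \<inter> serre_reps A C L M"
      using * teq_trans[OF roof_fraction[OF R] 1(1)[THEN serre_reps_fraction] *(1)[THEN serre_reps_fraction] 1(2) *(2)]
      by (simp add: rc_iff[OF R])
    moreover have "(i', e \<cdot> g0, r) \<in> rc t g \<inter> serre_reps A C M N"
      using * teq_trans[OF roof_fraction[OF R'] 2(1)[THEN serre_reps_fraction] *(3)[THEN serre_reps_fraction] 2(2) *(4)]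
      by (simp add: rc_iff[OF R'])
    ultimately have "serre_class A C (j, f0 \<cdot> g0, r) \<in> ?S" using *(5-9) by blast
    then show ?thesis by blast
  qed
  ultimately have "?S = {rc s (q \<cdot> g)}" by (metis (no_types, lifting) subset_singletonD)
  then show ?thesis unfolding serre_comp_def by simp
qed

lemma rc_expand:
  assumes R: "roof M N s f" and p: "arr p" "tgt p = src s" "sig (p \<cdot> s)"
  shows "roof M N (p \<cdot> s) (p \<cdot> f)" "rc s f = rc (p \<cdot> s) (p \<cdot> f)"
proof -
  note [simp] = roofD[OF R] p
  show R': "roof M N (p \<cdot> s) (p \<cdot> f)" by (rule roofI) simp_all
  show "rc s f = rc (p \<cdot> s) (p \<cdot> f)"
    by (rule rc_eqI[OF R R', of p "Ident A (src p)"]) (simp_all add: cong_refl)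
qed

text \<open>Expanding the first fraction by \<open>p\<close> reduces to the aligned case. Since
  \<open>p\<close> and \<open>q\<close> are arbitrary, a computed pullback can be put in their
  place.\<close>

lemma comp_rc:
  assumes R: "roof L M s f" and R': "roof M N t g"
    and p: "arr p" "tgt p = src s" "sig (p \<cdot> s)" "arr q" "src q = src p" "tgt q = src t" "p \<cdot> f = q \<cdot> t"
  shows "roof L N (p \<cdot> s) (q \<cdot> g)" "rc s f \<odot> rc t g = rc (p \<cdot> s) (q \<cdot> g)"
proof -
  note [simp] = roofD[OF R] roofD[OF R'] p(1-6)
  show "roof L N (p \<cdot> s) (q \<cdot> g)" by (rule roofI) simp_all
  note R1 = rc_expand[OF R p(1-3), unfolded p(7)]
  show "rc s f \<odot> rc t g = rc (p \<cdot> s) (q \<cdot> g)"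
    unfolding R1(2) by (rule comp_rc_aligned[OF R1(1) R']) simp_all
qed

lemma comp_ex:
  assumes R: "roof L M s f" and R': "roof M N t g"
  obtains p q where "arr p" "tgt p = src s" "sig p" "sig (p \<cdot> s)" "arr q" "src q = src p" "tgt q = src t" "p \<cdot> f = q \<cdot> t"
    "roof L N (p \<cdot> s) (q \<cdot> g)" "rc s f \<odot> rc t g = rc (p \<cdot> s) (q \<cdot> g)"
proof -
  note [simp] = roofD[OF R] roofD[OF R']
  obtain p q where pq: "arr p" "arr q" "sig p" "src q = src p" "tgt p = src s" "tgt q = src t" "p \<cdot> f = q \<cdot> t"
    by (rule ore[of t f]) simp_all
  have s: "sig (p \<cdot> s)" using pq by (simp add: sig_comp)
  show ?thesis using that[OF pq(1,5,3) s pq(2,4,6,7) comp_rc[OF R R' pq(1,5) s pq(2,4,6,7)]] .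
qed

lemma common_denominator:
  assumes R: "roof M N s f" and R': "roof M N' t g"
  obtains r f' g' where "roof M N r f'" "rc s f = rc r f'" "roof M N' r g'" "rc t g = rc r g'"
proof -
  note [simp] = roofD[OF R] roofD[OF R']
  obtain p q where pq [simp]: "arr p" "arr q" "sig p" "src q = src p" "tgt p = src s" "tgt q = src t"
    and e: "p \<cdot> s = q \<cdot> t" by (rule ore[of t s]) simp_all
  have s: "sig (p \<cdot> s)" "sig (q \<cdot> t)" by (simp_all add: sig_comp flip: e)
  note 1 = rc_expand[OF R _ _ s(1), simplified] and 2 = rc_expand[OF R' _ _ s(2), simplified]
  show ?thesis using that[OF 1 2[folded e]] .
qed

lemma add_sound:
  assumes R: "roof M N s f" and R': "roof M N s g"
    and t: "(i, h, p) \<in> rc s f" "(i, k, p) \<in> rc s g"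
  shows "(i, h \<oplus> k, p) \<in> serre_reps A C M N" "teq s (f \<oplus> g) (Ident A N) i (h \<oplus> k) p"
proof -
  note [simp] = roofD[OF R] roofD[OF R']
  note t1 = t(1)[unfolded rc_iff[OF R]] and t2 = t(2)[unfolded rc_iff[OF R']]
  note [simp] = fractionD[OF t1[THEN conjunct1, THEN serre_reps_fraction]]
    fractionD[OF t2[THEN conjunct1, THEN serre_reps_fraction]]
  show "(i, h \<oplus> k, p) \<in> serre_reps A C M N" using t1 by (simp add: serre_reps_iff)
  show "teq s (f \<oplus> g) (Ident A N) i (h \<oplus> k) p"
  proof (rule teqI)
    fix a b c d assume [simp]: "arr a" "arr b" "arr c" "arr d" "src a = src b" "tgt c = tgt d"
      "tgt a = src s" "tgt b = src i" "src c = tgt (Ident A N)" "src d = tgt p"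
      and e: "a \<cdot> s = b \<cdot> i" "Ident A N \<cdot> c = p \<cdot> d"
    have "a \<cdot> (f \<cdot> c) \<approx> b \<cdot> (h \<cdot> d)" by (rule teqD[OF t1[THEN conjunct2] e]) simp_all
    moreover have "a \<cdot> (g \<cdot> c) \<approx> b \<cdot> (k \<cdot> d)" by (rule teqD[OF t2[THEN conjunct2] e]) simp_all
    ultimately have "a \<cdot> (f \<cdot> c) \<oplus> a \<cdot> (g \<cdot> c) \<approx> b \<cdot> (h \<cdot> d) \<oplus> b \<cdot> (k \<cdot> d)" by (rule cong_plus) simp_all
    then show "a \<cdot> ((f \<oplus> g) \<cdot> c) \<approx> b \<cdot> ((h \<oplus> k) \<cdot> d)" by simp
  qed
qed

text \<open>One \<open>i\<close> and one epi must serve both numerators. The target is divided once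
  so that \<open>f\<close> descends along \<open>e\<close> and once more for \<open>g\<close>; the
  composite quotient \<open>p \<cdot> q\<close> works for both.\<close>

lemma add_exists:
  assumes R: "roof M N s f" and R': "roof M N s g"
  obtains i h k p where "(i, h, p) \<in> rc s f" "(i, k, p) \<in> rc s g"
proof -
  note [simp] = roofD[OF R] roofD[OF R']
  obtain I e i K k where *: "is_epi A (src s) I e" "is_mono A I (tgt s) i" "sig i" "e \<cdot> i = s"
    "is_kernel A (src s) I e K k" "is_cokernel A K (src s) k I e" "small k"
    by (rule image_factor[of s]) simp_all
  note [simp] = is_kernelD(4-6)[OF *(5)]
  have kf: "small (k \<cdot> f)" using small_comp_right[OF *(7), of f] by simp
  have "k \<cdot> f \<in> Hom A K N" by (simp add: hom_iff)
  then obtain P p where p: "is_cokernel A K N (k \<cdot> f) P p" using cokernel by blast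
  note [simp] = is_cokernelD(4-6)[OF p]
  have kg: "small (k \<cdot> (g \<cdot> p))" using small_comp_right[OF *(7), of "g \<cdot> p"] by simp
  have "k \<cdot> (g \<cdot> p) \<in> Hom A K P" by (simp add: hom_iff)
  then obtain P' q where q: "is_cokernel A K P (k \<cdot> (g \<cdot> p)) P' q" using cokernel by blast
  note [simp] = is_cokernelD(4-6)[OF q]
  have z: "k \<cdot> (f \<cdot> p) = Zero A K P" "k \<cdot> (g \<cdot> (p \<cdot> q)) = Zero A K P'"
    using is_cokernelD(7)[OF p] is_cokernelD(7)[OF q] by simp_all
  have "k \<cdot> (f \<cdot> (p \<cdot> q)) = Zero A K P'" using comp_reduce[OF is_cokernelD(7)[OF p], of q] src_Ob[of k] by simp
  then obtain h1 where h1: "arr h1" "tgt h1 = P'" "src h1 = I" "e \<cdot> h1 = f \<cdot> (p \<cdot> q)"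
    by - (rule cokernel_colift[OF *(6), of "f \<cdot> (p \<cdot> q)"], simp_all)
  obtain h2 where h2: "arr h2" "tgt h2 = P'" "src h2 = I" "e \<cdot> h2 = g \<cdot> (p \<cdot> q)"
    by (rule cokernel_colift[OF *(6), of "g \<cdot> (p \<cdot> q)"]) (use z in simp_all)
  have pq: "is_epi A N P' (p \<cdot> q)" "sig (p \<cdot> q)"
    using epi_comp[OF is_cokernelD(8)[OF p] is_cokernelD(8)[OF q]] sig_cokernel[OF kf p] sig_cokernel[OF kg q]
    by (simp_all add: sig_comp)
  have i: "is_mono A I M i" using *(2) by simp
  show ?thesis
    using that[of i h1 "p \<cdot> q" h2] triple_of_roof[OF R *(1) i *(3,4) pq h1(1,3,2,4)]
      triple_of_roof[OF R' *(1) i *(3,4) pq h2(1,3,2,4)]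
    by (simp add: rc_iff[OF R] rc_iff[OF R'])
qed

lemma add_rc:
  assumes R: "roof M N s f" and R': "roof M N s g"
  shows "roof M N s (f \<oplus> g)" "serre_add A C M N (rc s f) (rc s g) = rc s (f \<oplus> g)"
proof -
  note [simp] = roofD[OF R] roofD[OF R']
  show R2: "roof M N s (f \<oplus> g)" by (rule roofI) simp_all
  let ?S = "{serre_class A C (i, Add A M' P h k, p) | M' P i h k p.
      (i, h, p) \<in> rc s f \<inter> serre_reps A C M N \<and> (i, k, p) \<in> rc s g \<inter> serre_reps A C M N \<and>
      h \<in> Hom A M' P \<and> k \<in> Hom A M' P}"
  have "?S \<subseteq> {rc s (f \<oplus> g)}"
  proof
    fix X assume "X \<in> ?S"
    then obtain i h k p M' P where X: "X = serre_class A C (i, Add A M' P h k, p)"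
      and *: "(i, h, p) \<in> rc s f" "(i, k, p) \<in> rc s g" "h \<in> Hom A M' P" by blast
    have "Add A M' P h k = h \<oplus> k" using *(3) by (simp add: plus_def hom_iff)
    then show "X \<in> {rc s (f \<oplus> g)}" unfolding X using serre_class_rc[OF R2 add_sound[OF R R' *(1,2)]] by simp
  qed
  moreover have "?S \<noteq> {}"
  proof -
    obtain i h k p where *: "(i, h, p) \<in> rc s f" "(i, k, p) \<in> rc s g" using add_exists[OF R R'] .
    then have r: "(i, h, p) \<in> serre_reps A C M N" "(i, k, p) \<in> serre_reps A C M N"
      using rc_iff[OF R] rc_iff[OF R'] by blast+
    then have "h \<in> Hom A (src i) (tgt p)" "k \<in> Hom A (src i) (tgt p)" by (simp_all add: serre_reps_iff hom_iff)
    then have "serre_class A C (i, Add A (src i) (tgt p) h k, p) \<in> ?S" using * r by blast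
    then show ?thesis by blast
  qed
  ultimately have "?S = {rc s (f \<oplus> g)}" by (metis (no_types, lifting) subset_singletonD)
  then show "serre_add A C M N (rc s f) (rc s g) = rc s (f \<oplus> g)" unfolding serre_add_def by simp
qed

lemma Q_simps [simp]:
  "Ob Q = Ob A" "Comp Q = serre_comp A C" "Add Q = serre_add A C"
  by (simp_all add: serre_quotient_def)

section \<open>Identities, zeros and equality of left fractions\<close>

lemma ident_roof: "M \<in> Ob A \<Longrightarrow> roof M M (Ident A M) (Ident A M)"
  by (rule roofI) (simp_all add: sig_id)

lemma zero_roof: "sig s \<Longrightarrow> tgt s = M \<Longrightarrow> N \<in> Ob A \<Longrightarrow> roof M N s (Zero A (src s) N)"
  using sig_arr[of s] by (intro roofI) simp_all

lemma loc_roof: "arr h \<Longrightarrow> src h = M \<Longrightarrow> tgt h = N \<Longrightarrow> roof M N (Ident A M) h"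
  using src_Ob[of h] by (intro roofI) (simp_all add: sig_id)

text \<open>Triples with identities as outer parts occur in the definitions of identities and zeros;
  they are the images of morphisms of \<open>A\<close> in the quotient.\<close>

lemma Q_triple:
  assumes h: "arr h" "src h = M" "tgt h = N"
  shows "serre_class A C (Ident A M, h, Ident A N) = rc (Ident A M) h"
proof -
  have o [simp]: "M \<in> Ob A" "N \<in> Ob A" using src_Ob[of h] tgt_Ob[of h] h by simp_all
  have r: "(Ident A M, h, Ident A N) \<in> serre_reps A C M N"
    using h by (simp add: serre_reps_iff mono_id epi_id sig_id)
  show ?thesis
    by (rule serre_class_rc[OF loc_roof[OF h] r roof_triple[OF loc_roof[OF h] r, of "Ident A M"]])
      (use h in simp_all)
qed

lemma Q_Ident: "M \<in> Ob A \<Longrightarrow> Ident Q M = rc (Ident A M) (Ident A M)"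
  using Q_triple[of "Ident A M" M M] by (simp add: serre_quotient_def)

lemma rc_cong_iff:
  assumes R: "roof M N s f" and R': "roof M N s g"
  shows "rc s f = rc s g \<longleftrightarrow> f \<approx> g"
proof -
  note [simp] = roofD[OF R] roofD[OF R']
  show ?thesis
  proof
    assume e: "rc s f = rc s g"
    have "Ident A (src s) \<cdot> f \<approx> Ident A (src s) \<cdot> g" by (rule rc_eqD[OF R R' e]) simp_all
    then show "f \<approx> g" by simp
  next
    assume "f \<approx> g"
    then show "rc s f = rc s g"
      by - (rule rc_eqI[OF R R', of "Ident A (src s)" "Ident A (src s)"], simp_all)
  qed
qed

text \<open>The freedom in \<open>s\<close> lets a fraction be compared with zero over its own
  denominator.\<close>

lemma Q_Zero:
  assumes "sig s" "tgt s = M" "N \<in> Ob A"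
  shows "Zero Q M N = rc s (Zero A (src s) N)"
proof -
  note [simp] = assms sig_arr[OF assms(1)]
  have M [simp]: "M \<in> Ob A" using tgt_Ob[of s] by simp
  have "Zero Q M N = rc (Ident A M) (Zero A M N)"
    using Q_triple[of "Zero A M N" M N] by (simp add: serre_quotient_def)
  also have "\<dots> = rc s (Zero A (src s) N)"
  proof (rule rc_eqI[of M N])
    show "roof M N (Ident A M) (Zero A M N)" by (rule loc_roof) simp_all
    show "roof M N s (Zero A (src s) N)" by (rule zero_roof) simp_all
    show "s \<cdot> Zero A M N \<approx> Ident A (src s) \<cdot> Zero A (src s) N" by (simp add: cong_refl)
  qed simp_all
  finally show ?thesis .
qed

lemma rc_zero_iff:
  assumes R: "roof M N s f" shows "rc s f = Zero Q M N \<longleftrightarrow> small f"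
proof -
  note [simp] = roofD[OF R]
  have "rc s f = Zero Q M N \<longleftrightarrow> f \<approx> Zero A (src s) N"
    using rc_cong_iff[OF R zero_roof[of s M N]] Q_Zero[of s M N] by simp
  then show ?thesis using cong_zero[of f "src s" N] by simp
qed

lemma Q_HomE:
  assumes "X \<in> Hom Q M N" obtains s f where "roof M N s f" "X = rc s f"
  using assms Hom_serre_quotient by blast

lemma Q_HomI: "roof M N s f \<Longrightarrow> rc s f \<in> Hom Q M N"
  using Hom_serre_quotient by blast

end

text \<open>The dual of \<open>image_epi\<close>: image factorisations may equally be computed as
  cokernels of kernels.\<close>

lemma (in abelian_category) image_mono:
  assumes "is_kernel A M N f K k" "is_cokernel A K M k I d" "arr i" "src i = I" "tgt i = N" "d \<cdot> i = f"
  shows "is_mono A I N i"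
  using abelian_category.image_epi[OF abelian_category_opc, of f N M K k I d i] assms
    is_kernelD(1-3)[OF assms(1)] by simp

context thick_subcategory
begin

lemma cong_opc [simp]: "thick_subcategory.cong (opc A) C f g \<longleftrightarrow> f \<approx> g"
  unfolding cong_def thick_subcategory.cong_def[OF thick_subcategory_opc] by auto

lemma cong_epi_cancel:
  "e \<cdot> f \<approx> e \<cdot> g \<Longrightarrow> is_epi A M I e \<Longrightarrow> arr f \<Longrightarrow> arr g \<Longrightarrow> src f = I \<Longrightarrow> src g = I \<Longrightarrow> f \<approx> g"
  using thick_subcategory.cong_mono_cancel[OF thick_subcategory_opc, of f e g I M] by simp

section \<open>Category and group axioms of the quotient\<close>

lemma comp_loc:
  assumes R: "roof L M s f" and h: "arr h" "src h = M"
  shows "rc s f \<odot> rc (Ident A M) h = rc s (f \<cdot> h)"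
proof -
  note [simp] = roofD[OF R] h
  have "roof L M s (f \<cdot> Ident A M)" using R by simp
  from comp_rc_aligned[OF this loc_roof[OF h refl]] show ?thesis by simp
qed

lemma comp_cancel:
  assumes R: "roof L M r s" and R': "roof M N s f"
  shows "rc r s \<odot> rc s f = rc r f"
proof -
  note [simp] = roofD[OF R] roofD[OF R']
  have "roof L M r (Ident A (src s) \<cdot> s)" using R by simp
  from comp_rc_aligned[OF this R'] show ?thesis by simp
qed

text \<open>Once the numerator of the first fraction is a multiple of the denominator
  \<open>t\<close> of the second, composition is the cancellation of \<open>t\<close>. One Ore
  square achieves this.\<close>

lemma aligned_ex:
  assumes R: "roof L M s f" and R': "roof M N t g"
  obtains r q where "roof L M r (q \<cdot> t)" "rc s f = rc r (q \<cdot> t)" "arr q" "src q = src r" "tgt q = src t"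
proof -
  note [simp] = roofD[OF R] roofD[OF R']
  obtain p q where [simp]: "arr p" "arr q" "sig p" "src q = src p" "tgt p = src s" "tgt q = src t"
    and e: "p \<cdot> f = q \<cdot> t" by (rule ore[of t f]) simp_all
  have "sig (p \<cdot> s)" by (simp add: sig_comp)
  from rc_expand[OF R _ _ this] show ?thesis using that[of "p \<cdot> s" q] unfolding e by simp
qed

lemma Q_comp_hom: assumes "X \<in> Hom Q L M" "Y \<in> Hom Q M N" shows "X \<odot> Y \<in> Hom Q L N"
proof -
  obtain s f where 1: "roof L M s f" "X = rc s f" using assms(1) by (rule Q_HomE)
  obtain t g where 2: "roof M N t g" "Y = rc t g" using assms(2) by (rule Q_HomE)
  show ?thesis using comp_ex[OF 1(1) 2(1)] Q_HomI 1(2) 2(2) by metis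
qed

text \<open>Aligning the three fractions from right to left turns both bracketings into
  \<open>s\<inverse>\<close> followed by a composite in \<open>A\<close>.\<close>

lemma Q_assoc:
  assumes "X \<in> Hom Q K L" "Y \<in> Hom Q L M" "Z \<in> Hom Q M N"
  shows "(X \<odot> Y) \<odot> Z = X \<odot> (Y \<odot> Z)"
proof -
  obtain u h where Z: "roof M N u h" "Z = rc u h" using assms(3) by (rule Q_HomE)
  obtain t0 g where Y0: "roof L M t0 g" "Y = rc t0 g" using assms(2) by (rule Q_HomE)
  obtain t q where Y: "roof L M t (q \<cdot> u)" "Y = rc t (q \<cdot> u)" and q: "arr q" "src q = src t" "tgt q = src u"
    using aligned_ex[OF Y0(1) Z(1)] Y0(2) by metis
  obtain s0 f where X0: "roof K L s0 f" "X = rc s0 f" using assms(1) by (rule Q_HomE)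
  obtain s p where X: "roof K L s (p \<cdot> t)" "X = rc s (p \<cdot> t)" and p: "arr p" "src p = src s" "tgt p = src t"
    using aligned_ex[OF X0(1) Y(1)] X0(2) by metis
  note [simp] = roofD[OF Z(1)] roofD[OF X(1)] roofD[OF Y(1)] p q
  have XY: "X \<odot> Y = rc s ((p \<cdot> q) \<cdot> u)" unfolding X Y by (subst comp_rc_aligned[OF X(1) Y(1)]) simp_all
  have YZ: "Y \<odot> Z = rc t (q \<cdot> h)" unfolding Z Y by (subst comp_rc_aligned[OF Y(1) Z(1)]) simp_all
  have R1: "roof K M s ((p \<cdot> q) \<cdot> u)" by (rule roofI) simp_all
  have R2: "roof L N t (q \<cdot> h)" by (rule roofI) simp_all
  have "(X \<odot> Y) \<odot> Z = rc s ((p \<cdot> q) \<cdot> h)" unfolding XY Z by (rule comp_rc_aligned[OF R1 Z(1)]) simp_all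
  moreover have "X \<odot> (Y \<odot> Z) = rc s (p \<cdot> (q \<cdot> h))" unfolding YZ X by (rule comp_rc_aligned[OF X(1) R2]) simp_all
  ultimately show ?thesis by simp
qed

lemma Q_pairE:
  assumes "X \<in> Hom Q M N" "Y \<in> Hom Q M N'"
  obtains s f g where "roof M N s f" "X = rc s f" "roof M N' s g" "Y = rc s g"
  using assms common_denominator unfolding Hom_serre_quotient by metis

lemma Q_comp_add:
  assumes "X \<in> Hom Q L M" "Y \<in> Hom Q M N" "Z \<in> Hom Q M N"
  shows "X \<odot> serre_add A C M N Y Z = serre_add A C L N (X \<odot> Y) (X \<odot> Z)"
proof -
  obtain t g h where YZ: "roof M N t g" "Y = rc t g" "roof M N t h" "Z = rc t h"
    using assms(2,3) by (rule Q_pairE)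
  obtain s0 f where X0: "roof L M s0 f" "X = rc s0 f" using assms(1) by (rule Q_HomE)
  obtain s q where X: "roof L M s (q \<cdot> t)" "X = rc s (q \<cdot> t)" and q: "arr q" "src q = src s" "tgt q = src t"
    using aligned_ex[OF X0(1) YZ(1)] X0(2) by metis
  note [simp] = roofD[OF X(1)] roofD[OF YZ(1)] roofD[OF YZ(3)] q
  have R: "roof L N s (q \<cdot> g)" "roof L N s (q \<cdot> h)" by (rule roofI; simp)+
  show ?thesis
    unfolding X(2) YZ(2,4) add_rc(2)[OF YZ(1,3)] comp_rc_aligned[OF X(1) YZ(1) q]
      comp_rc_aligned[OF X(1) YZ(3) q] comp_rc_aligned[OF X(1) add_rc(1)[OF YZ(1,3)] q] add_rc(2)[OF R]
    by simp
qed

text \<open>Both summands have to be aligned with \<open>t\<close> over one denominator. A first Ore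
  square handles \<open>f\<close>; a second one handles \<open>p \<cdot> g\<close> and keeps the
  alignment of \<open>f\<close>.\<close>

lemma Q_add_comp:
  assumes "X \<in> Hom Q L M" "Y \<in> Hom Q L M" "Z \<in> Hom Q M N"
  shows "serre_add A C L M X Y \<odot> Z = serre_add A C L N (X \<odot> Z) (Y \<odot> Z)"
proof -
  obtain t h where Z: "roof M N t h" "Z = rc t h" using assms(3) by (rule Q_HomE)
  obtain s f g where XY: "roof L M s f" "X = rc s f" "roof L M s g" "Y = rc s g"
    using assms(1,2) by (rule Q_pairE)
  note [simp] = roofD[OF XY(1)] roofD[OF XY(3)] roofD[OF Z(1)]
  obtain p q where [simp]: "arr p" "arr q" "sig p" "src q = src p" "tgt p = src s" "tgt q = src t"
    and e: "p \<cdot> f = q \<cdot> t" by (rule ore[of t f]) simp_all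
  obtain p' q' where [simp]: "arr p'" "arr q'" "sig p'" "src q' = src p'" "tgt p' = src p" "tgt q' = src t"
    and e': "p' \<cdot> (p \<cdot> g) = q' \<cdot> t" by (rule ore[of t "p \<cdot> g"]) simp_all
  let ?s = "(p' \<cdot> p) \<cdot> s"
  have s: "sig ?s" by (simp add: sig_comp)
  have f: "(p' \<cdot> p) \<cdot> f = (p' \<cdot> q) \<cdot> t" and g: "(p' \<cdot> p) \<cdot> g = q' \<cdot> t" using e e' by simp_all
  have X: "roof L M ?s ((p' \<cdot> q) \<cdot> t)" "X = rc ?s ((p' \<cdot> q) \<cdot> t)"
    using rc_expand[OF XY(1) _ _ s] XY(2) unfolding f by simp_all
  have Y: "roof L M ?s (q' \<cdot> t)" "Y = rc ?s (q' \<cdot> t)"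
    using rc_expand[OF XY(3) _ _ s] XY(4) unfolding g by simp_all
  have S: "serre_add A C L M X Y = rc ?s ((p' \<cdot> q \<oplus> q') \<cdot> t)" "roof L M ?s ((p' \<cdot> q \<oplus> q') \<cdot> t)"
    using add_rc[OF X(1) Y(1)] X(2) Y(2) by simp_all
  have "X \<odot> Z = rc ?s ((p' \<cdot> q) \<cdot> h)" unfolding X(2) Z(2) by (rule comp_rc_aligned[OF X(1) Z(1)]) simp_all
  moreover have "Y \<odot> Z = rc ?s (q' \<cdot> h)" unfolding Y(2) Z(2) by (rule comp_rc_aligned[OF Y(1) Z(1)]) simp_all
  moreover have "roof L N ?s ((p' \<cdot> q) \<cdot> h)" "roof L N ?s (q' \<cdot> h)" using s by (rule_tac [!] roofI) simp_all
  moreover have "rc ?s ((p' \<cdot> q \<oplus> q') \<cdot> t) \<odot> Z = rc ?s ((p' \<cdot> q \<oplus> q') \<cdot> h)"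
    unfolding Z(2) by (rule comp_rc_aligned[OF S(2) Z(1)]) simp_all
  ultimately show ?thesis unfolding S(1) using add_rc(2) by simp
qed

lemma Q_comm_group:
  assumes M: "M \<in> Ob A" and N: "N \<in> Ob A" shows "comm_group (hom_group Q M N)"
proof (rule comm_groupI; unfold hom_group_def Q_simps partial_object.simps monoid.simps)
  fix X Y assume X: "X \<in> Hom Q M N"
  obtain s f where Xs: "roof M N s f" "X = rc s f" using X by (rule Q_HomE)
  note [simp] = roofD[OF Xs(1)]
  have Z: "Zero Q M N = rc s (Zero A (src s) N)" "roof M N s (Zero A (src s) N)"
    using Q_Zero[of s M N] zero_roof[of s M N] by simp_all
  show "serre_add A C M N (Zero Q M N) X = X"
    unfolding Z Xs(2) add_rc(2)[OF Z(2) Xs(1)] by simp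
  have R: "roof M N s (Zero A (src s) N \<ominus> f)" by (rule roofI) simp_all
  show "\<exists>Y\<in>Hom Q M N. serre_add A C M N Y X = Zero Q M N"
  proof (rule bexI[OF _ Q_HomI[OF R]])
    show "serre_add A C M N (rc s (Zero A (src s) N \<ominus> f)) X = Zero Q M N"
      unfolding Z Xs(2) add_rc(2)[OF R Xs(1)] by simp
  qed
  assume Y: "Y \<in> Hom Q M N"
  obtain s f g where XY: "roof M N s f" "X = rc s f" "roof M N s g" "Y = rc s g"
    using X Y by (rule Q_pairE)
  note [simp] = roofD[OF XY(1)] roofD[OF XY(3)]
  show "serre_add A C M N X Y \<in> Hom Q M N"
    using Q_HomI add_rc[OF XY(1,3)] XY(2,4) by simp
  show "serre_add A C M N X Y = serre_add A C M N Y X"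
    unfolding XY(2,4) add_rc(2)[OF XY(1,3)] add_rc(2)[OF XY(3,1)] by (simp add: plus_comm[of f g])
  fix Z assume Z: "Z \<in> Hom Q M N"
  then obtain t h where Zt: "roof M N t h" "Z = rc t h" by (rule Q_HomE)
  note [simp] = roofD[OF Zt(1)]
  obtain p q where [simp]: "arr p" "arr q" "sig p" "src q = src p" "tgt p = src s" "tgt q = src t"
    and e: "p \<cdot> s = q \<cdot> t" by (rule ore[of t s]) simp_all
  have s: "sig (p \<cdot> s)" "sig (q \<cdot> t)" by (simp_all add: sig_comp flip: e)
  have 1: "roof M N (p \<cdot> s) (p \<cdot> f)" "X = rc (p \<cdot> s) (p \<cdot> f)"
    using rc_expand[OF XY(1) _ _ s(1)] XY(2) by simp_all
  have 2: "roof M N (p \<cdot> s) (p \<cdot> g)" "Y = rc (p \<cdot> s) (p \<cdot> g)"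
    using rc_expand[OF XY(3) _ _ s(1)] XY(4) by simp_all
  have 3: "roof M N (p \<cdot> s) (q \<cdot> h)" "Z = rc (p \<cdot> s) (q \<cdot> h)"
    using rc_expand[OF Zt(1) _ _ s(2)] Zt(2) unfolding e by simp_all
  show "serre_add A C M N (serre_add A C M N X Y) Z = serre_add A C M N X (serre_add A C M N Y Z)"
    unfolding 1(2) 2(2) 3(2) add_rc(2)[OF 1(1) 2(1)] add_rc(2)[OF 2(1) 3(1)]
      add_rc(2)[OF add_rc(1)[OF 1(1) 2(1)] 3(1)] add_rc(2)[OF 1(1) add_rc(1)[OF 2(1) 3(1)]]
    by (simp add: plus_assoc)
next
  show "Zero Q M N \<in> Hom Q M N"
    using Q_Zero[of "Ident A M" M N] zero_roof[of "Ident A M" M N] sig_id M N Q_HomI by simp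
qed

section \<open>Universal constructions in the quotient\<close>

lemma Q_zero_comp:
  assumes "X \<in> Hom Q M N" "L \<in> Ob A" shows "Zero Q L M \<odot> X = Zero Q L N"
proof -
  obtain t g where X: "roof M N t g" "X = rc t g" using assms(1) by (rule Q_HomE)
  note [simp] = roofD[OF X(1)] assms(2)
  have Z: "Zero Q L M = rc (Ident A L) (Zero A L (src t) \<cdot> t)" "roof L M (Ident A L) (Zero A L (src t) \<cdot> t)"
    using Q_Zero[of "Ident A L" L M] zero_roof[of "Ident A L" L M] by (simp_all add: sig_id)
  show ?thesis unfolding Z(1) X(2)
    by (subst comp_rc_aligned[OF Z(2) X(1)]) (simp_all add: Q_Zero[of "Ident A L" L N] sig_id)
qed

lemma Q_comp_zero:
  assumes "X \<in> Hom Q L M" "N \<in> Ob A" shows "X \<odot> Zero Q M N = Zero Q L N"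
proof -
  obtain t g where X: "roof L M t g" "X = rc t g" using assms(1) by (rule Q_HomE)
  note [simp] = roofD[OF X(1)] assms(2)
  have Z: "Zero Q M N = rc (Ident A M) (Zero A M N)"
    using Q_Zero[of "Ident A M" M N] by (simp add: sig_id)
  show ?thesis unfolding Z X(2)
    by (subst comp_loc[OF X(1)]) (simp_all add: Q_Zero[of t L N])
qed

lemma Q_Zero_hom: "M \<in> Ob A \<Longrightarrow> N \<in> Ob A \<Longrightarrow> Zero Q M N \<in> Hom Q M N"
  using Q_Zero[of "Ident A M" M N] zero_roof[of "Ident A M" M N] sig_id Q_HomI by simp

text \<open>Fractions over a common denominator are paired through their numerators. Two pairings
  have a difference with small components, which is small by
  \<open>small_into_product\<close>.\<close>

lemma Q_is_product:
  assumes P: "is_product A M N P p q"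
  shows "is_product Q M N P (rc (Ident A P) p) (rc (Ident A P) q)"
  unfolding is_product_def Q_simps
proof (intro conjI allI ballI)
  note [simp] = is_productD[OF P] product_Ob[OF P]
  show "rc (Ident A P) p \<in> Hom Q P M" "rc (Ident A P) q \<in> Hom Q P N"
    by (intro Q_HomI loc_roof; simp)+
  fix T X Y assume "X \<in> Hom Q T M" "Y \<in> Hom Q T N"
  then obtain s f g where XY: "roof T M s f" "X = rc s f" "roof T N s g" "Y = rc s g"
    by (rule Q_pairE)
  note [simp] = roofD[OF XY(1)] roofD[OF XY(3)]
  obtain u where u [simp]: "arr u" "src u = src f" "tgt u = P" "u \<cdot> p = f" "u \<cdot> q = g"
    by (rule product_pair[OF P, of f g]) simp_all
  have U: "roof T P s u" by (rule roofI) simp_all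
  show "\<exists>!Z. Z \<in> Hom Q T P \<and> Z \<odot> rc (Ident A P) p = X \<and> Z \<odot> rc (Ident A P) q = Y"
  proof (rule ex1I[of _ "rc s u"])
    show "rc s u \<in> Hom Q T P \<and> rc s u \<odot> rc (Ident A P) p = X \<and> rc s u \<odot> rc (Ident A P) q = Y"
      using Q_HomI[OF U] comp_loc[OF U, of p] comp_loc[OF U, of q] XY by simp
    fix Z assume Z: "Z \<in> Hom Q T P \<and> Z \<odot> rc (Ident A P) p = X \<and> Z \<odot> rc (Ident A P) q = Y"
    then obtain r h v where hv: "roof T P r h" "Z = rc r h" "roof T P r v" "rc s u = rc r v"
      using Q_pairE[of Z T P "rc s u" P] Q_HomI[OF U] by metis
    note [simp] = roofD[OF hv(1)] roofD[OF hv(3)]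
    have R: "roof T M r (h \<cdot> p)" "roof T M r (v \<cdot> p)" "roof T N r (h \<cdot> q)" "roof T N r (v \<cdot> q)"
      by (rule roofI; simp)+
    have "rc r (h \<cdot> p) = rc r (v \<cdot> p)" "rc r (h \<cdot> q) = rc r (v \<cdot> q)"
      using Z comp_loc[OF hv(1)] comp_loc[OF hv(3)] comp_loc[OF U, of p] comp_loc[OF U, of q]
      unfolding hv(2) hv(4)[symmetric] XY by simp_all
    then have "h \<cdot> p \<approx> v \<cdot> p" "h \<cdot> q \<approx> v \<cdot> q"
      using rc_cong_iff[OF R(1,2)] rc_cong_iff[OF R(3,4)] by simp_all
    then have "small (h \<ominus> v)"
      by (intro small_into_product[OF P, of "h \<ominus> v"]) (use congD(5) in \<open>force+\<close>)
    then have "h \<approx> v" by (simp add: cong_def)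
    then show "Z = rc s u" unfolding hv(2,4) using rc_cong_iff[OF hv(1,3)] by simp
  qed
qed

lemma Q_zero_object: assumes Z: "is_zero_object A Z" shows "is_zero_object Q Z"
  unfolding is_zero_object_def Q_simps
proof (intro conjI ballI)
  have o [simp]: "Z \<in> Ob A" using Z by (simp add: is_zero_object_def)
  then show "Z \<in> Ob A" .
  fix M assume M [simp]: "M \<in> Ob A"
  have to: "f = Zero A (src f) Z" if "arr f" "tgt f = Z" for f
  proof -
    have "f \<in> Hom A (src f) Z" "Zero A (src f) Z \<in> Hom A (src f) Z" "src f \<in> Ob A"
      using that by (simp_all add: hom_iff)
    then show ?thesis using Z unfolding is_zero_object_def by blast
  qed
  show "\<exists>!X. X \<in> Hom Q M Z"
  proof (rule ex1I[of _ "Zero Q M Z"])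
    show "Zero Q M Z \<in> Hom Q M Z" by (rule Q_Zero_hom) simp_all
    fix X assume "X \<in> Hom Q M Z"
    then obtain s f where X: "roof M Z s f" "X = rc s f" by (rule Q_HomE)
    note [simp] = roofD[OF X(1)]
    have "small f" using to[of f] small_zero[of "src f" Z] by simp
    then show "X = Zero Q M Z" using rc_zero_iff[OF X(1)] X(2) by simp
  qed
  show "\<exists>!X. X \<in> Hom Q Z M"
  proof (rule ex1I[of _ "Zero Q Z M"])
    show "Zero Q Z M \<in> Hom Q Z M" by (rule Q_Zero_hom) simp_all
    fix X assume "X \<in> Hom Q Z M"
    then obtain s f where X: "roof Z M s f" "X = rc s f" by (rule Q_HomE)
    note [simp] = roofD[OF X(1)]
    \<comment> \<open>The denominator itself goes into the zero object and is zero. Cancelling it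
      makes the identity of its source small, and with it every numerator.\<close>
    have "small s" using to[of s] small_zero[of "src s" Z] by simp
    then have "small (Ident A (src s))"
      by - (rule sig_small_right[of s "Ident A (src s)"], simp_all)
    then have "small f" using small_comp_right[of "Ident A (src s)" f] by simp
    then show "X = Zero Q Z M" using rc_zero_iff[OF X(1)] X(2) by simp
  qed
qed

text \<open>Vanishing of the composite makes \<open>q \<cdot> f\<close> small, so its kernel
  \<open>j\<close> may join the denominator, and on \<open>j\<close> the leg \<open>q\<close>
  factors through \<open>k\<close>. All data are parameters, so that the universal property and the
  algorithm rest on the same formula.\<close>

lemma Q_kernel_lift:
  assumes R: "roof M N s f" and k: "is_kernel A (src s) N f K k" and T: "roof T M t g"
    and z: "rc t g \<odot> rc s f = Zero Q T N"
    and p: "arr p" "tgt p = src t" "sig p" "arr q" "src q = src p" "tgt q = src s" "p \<cdot> g = q \<cdot> s"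
    and j: "is_kernel A (src p) N (q \<cdot> f) J j"
    and u: "arr u" "src u = J" "tgt u = K" "u \<cdot> k = j \<cdot> q"
  shows "roof T K (j \<cdot> (p \<cdot> t)) u" "rc (j \<cdot> (p \<cdot> t)) u \<odot> rc (Ident A K) (k \<cdot> s) = rc t g"
proof -
  note [simp] = roofD[OF R] roofD[OF T] p(1-6) is_kernelD(4-6)[OF k] is_kernelD(4-6)[OF j] u(1-3)
  have s: "sig (p \<cdot> t)" by (simp add: sig_comp)
  have "small (q \<cdot> f)"
    using z comp_rc[OF T R p(1,2) s p(4-7)] rc_zero_iff by metis
  then have [simp]: "sig j" using sig_kernel[OF _ j] by blast
  show U: "roof T K (j \<cdot> (p \<cdot> t)) u" by (rule roofI) (simp_all add: sig_comp)
  have "u \<cdot> (k \<cdot> s) = (j \<cdot> p) \<cdot> g"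
    using comp_reduce[OF u(4), of s] p(7) by simp
  then have "rc (j \<cdot> (p \<cdot> t)) u \<odot> rc (Ident A K) (k \<cdot> s) = rc ((j \<cdot> p) \<cdot> t) ((j \<cdot> p) \<cdot> g)"
    by (subst comp_loc[OF U]) simp_all
  also have "\<dots> = rc t g"
    by (rule rc_expand(2)[OF T, symmetric]) (simp_all add: sig_comp)
  finally show "rc (j \<cdot> (p \<cdot> t)) u \<odot> rc (Ident A K) (k \<cdot> s) = rc t g" .
qed

text \<open>The denominator is invertible in the quotient, so the kernel of \<open>f\<close> is all
  that counts, carried into \<open>M\<close> by \<open>s\<close>. For uniqueness, \<open>s\<close>
  and the mono \<open>k\<close> are cancelled modulo small morphisms.\<close>

lemma Q_is_kernel:
  assumes R: "roof M N s f" and k: "is_kernel A (src s) N f K k"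
  shows "is_kernel Q M N (rc s f) K (rc (Ident A K) (k \<cdot> s))"
  unfolding is_kernel_def Q_simps
proof (intro conjI allI ballI impI)
  note [simp] = roofD[OF R] is_kernelD(4-7)[OF k]
  have [simp]: "K \<in> Ob A" using src_Ob[of k] by simp
  show "rc s f \<in> Hom Q M N" using Q_HomI[OF R] .
  have KS: "roof K M (Ident A K) (k \<cdot> s)" by (rule loc_roof) simp_all
  show "rc (Ident A K) (k \<cdot> s) \<in> Hom Q K M" using Q_HomI[OF KS] .
  show "rc (Ident A K) (k \<cdot> s) \<odot> rc s f = Zero Q K N"
    by (subst comp_rc_aligned[OF KS R]) (simp_all add: Q_Zero[of "Ident A K" K N] sig_id)
  fix T Y assume "Y \<in> Hom Q T M" and z: "Y \<odot> rc s f = Zero Q T N"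
  then obtain t g where Y: "roof T M t g" "Y = rc t g" by (auto elim: Q_HomE)
  note [simp] = roofD[OF Y(1)]
  obtain p q where [simp]: "arr p" "arr q" "sig p" "src q = src p" "tgt p = src t" "tgt q = src s"
    and e: "p \<cdot> g = q \<cdot> s" by (rule ore[of s g]) simp_all
  have "q \<cdot> f \<in> Hom A (src p) N" by (simp add: hom_iff)
  then obtain J j where j: "is_kernel A (src p) N (q \<cdot> f) J j" using kernel by blast
  note [simp] = is_kernelD(4-6)[OF j]
  obtain u where u: "arr u" "src u = J" "tgt u = K" "u \<cdot> k = j \<cdot> q"
    by (rule kernel_lift[OF k, of "j \<cdot> q"]) (use is_kernelD(7)[OF j] in simp_all)
  have U: "roof T K (j \<cdot> (p \<cdot> t)) u" "rc (j \<cdot> (p \<cdot> t)) u \<odot> rc (Ident A K) (k \<cdot> s) = rc t g"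
    by (rule Q_kernel_lift[OF R k Y(1) z[unfolded Y(2)] _ _ _ _ _ _ e j u]; simp)+
  show "\<exists>!X. X \<in> Hom Q T K \<and> X \<odot> rc (Ident A K) (k \<cdot> s) = Y"
  proof (rule ex1I[of _ "rc (j \<cdot> (p \<cdot> t)) u"])
    show "rc (j \<cdot> (p \<cdot> t)) u \<in> Hom Q T K \<and> rc (j \<cdot> (p \<cdot> t)) u \<odot> rc (Ident A K) (k \<cdot> s) = Y"
      using Q_HomI[OF U(1)] U(2) Y(2) by simp
    fix X assume X: "X \<in> Hom Q T K \<and> X \<odot> rc (Ident A K) (k \<cdot> s) = Y"
    obtain r a b where ab: "roof T K r a" "X = rc r a" "roof T K r b" "rc (j \<cdot> (p \<cdot> t)) u = rc r b"
      using Q_pairE[OF X[THEN conjunct1] Q_HomI[OF U(1)]] .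
    note [simp] = roofD[OF ab(1)] roofD[OF ab(3)]
    have R': "roof T M r (a \<cdot> (k \<cdot> s))" "roof T M r (b \<cdot> (k \<cdot> s))" by (rule roofI; simp)+
    have "rc r (a \<cdot> (k \<cdot> s)) = rc r (b \<cdot> (k \<cdot> s))"
      using X U(2) Y(2) comp_loc[OF ab(1), of "k \<cdot> s"] comp_loc[OF ab(3), of "k \<cdot> s"] unfolding ab by simp
    then have "(a \<cdot> k) \<cdot> s \<approx> (b \<cdot> k) \<cdot> s" using rc_cong_iff[OF R'] by simp
    then have "a \<cdot> k \<approx> b \<cdot> k" by (rule cong_cancel_right) simp_all
    then have "a \<approx> b" by (rule cong_mono_cancel[OF _ is_kernelD(8)[OF k]]) simp_all
    then show "X = rc (j \<cdot> (p \<cdot> t)) u" unfolding ab(2,4) using rc_cong_iff[OF ab(1,3)] by simp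
  qed
qed

text \<open>Every morphism of the quotient is also a right fraction \<open>h w\<inverse>\<close>.\<close>

lemma right_fraction:
  assumes Y: "roof N T t g" and h: "arr h" "src h = N" "arr w" "src w = T" "tgt h = tgt w" "t \<cdot> h = g \<cdot> w"
  shows "rc t g \<odot> rc (Ident A T) w = rc (Ident A N) h"
proof -
  note [simp] = roofD[OF Y] h(1-5)
  have "rc t g \<odot> rc (Ident A T) w = rc t (t \<cdot> h)" by (subst comp_loc[OF Y]) (simp_all add: h(6))
  also have "\<dots> = rc (Ident A N) h"
    by (rule rc_eqI[of N "tgt w" _ _ _ _ "Ident A (src t)" t]) (auto intro!: roofI cong_refl sig_id)
  finally show ?thesis .
qed

text \<open>The factor \<open>c\<close> expands the right fraction; it leaves room to divide out an
  obstruction in the target before descending along an epi.\<close>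

lemma right_fraction_inverse:
  assumes Y: "roof N T t g" and h: "arr h" "src h = N" "arr w" "src w = T" "tgt h = tgt w" "t \<cdot> h = g \<cdot> w"
    and c: "arr c" "src c = tgt w" "sig (w \<cdot> c)"
  shows "rc (Ident A N) (h \<cdot> c) \<odot> rc (w \<cdot> c) (Ident A T) = rc t g"
proof -
  note [simp] = roofD[OF Y] h(1-5) c
  have W: "roof T (tgt c) (Ident A T) (w \<cdot> c)" "roof (tgt c) T (w \<cdot> c) (Ident A T)"
    by (auto intro!: roofI sig_id)
  have "rc (Ident A N) (h \<cdot> c) = rc t g \<odot> rc (Ident A T) (w \<cdot> c)"
    by (rule right_fraction[OF Y, symmetric]) (use h(6) comp_reduce[OF h(6), of c] in simp_all)
  then have "rc (Ident A N) (h \<cdot> c) \<odot> rc (w \<cdot> c) (Ident A T) =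
      rc t g \<odot> (rc (Ident A T) (w \<cdot> c) \<odot> rc (w \<cdot> c) (Ident A T))"
    using Q_assoc[OF Q_HomI[OF Y] Q_HomI[OF W(1)] Q_HomI[OF W(2)]] by simp
  also have "\<dots> = rc t g" unfolding comp_cancel[OF W] by (subst comp_loc[OF Y]) simp_all
  finally show ?thesis .
qed

text \<open>Multiplying by \<open>w\<close> clears the denominator of the second factor, so the
  vanishing composite becomes the class of \<open>f \<cdot> h\<close> over \<open>s\<close>.\<close>

lemma right_fraction_zero:
  assumes Y: "roof N T t g" and h: "arr h" "src h = N" "arr w" "src w = T" "tgt h = tgt w" "t \<cdot> h = g \<cdot> w"
    and X: "roof M N s f" and z: "rc s f \<odot> rc t g = Zero Q M T"
  shows "small (f \<cdot> h)"
proof -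
  note [simp] = roofD[OF Y] roofD[OF X] h(1-5)
  have "rc s (f \<cdot> h) = rc s f \<odot> rc (Ident A N) h" by (subst comp_loc[OF X]) simp_all
  also have "\<dots> = (rc s f \<odot> rc t g) \<odot> rc (Ident A T) w"
    unfolding right_fraction[OF Y h, symmetric]
    by (rule Q_assoc[OF Q_HomI[OF X] Q_HomI[OF Y] Q_HomI[OF loc_roof[OF h(3,4) refl]], symmetric])
  also have "\<dots> = Zero Q M (tgt w)"
    unfolding z by (rule Q_zero_comp[OF Q_HomI[OF loc_roof]]) simp_all
  finally show ?thesis using rc_zero_iff[of M "tgt w" s "f \<cdot> h"] by (simp add: roofI)
qed

text \<open>The test fraction is rewritten as \<open>h w\<inverse>\<close>, because a morphism of
  \<open>A\<close> out of \<open>N\<close> is needed for the descent along \<open>e\<close>. The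
  obstruction \<open>f \<cdot> h\<close> is small; \<open>c\<close> divides it out and enlarges the
  right denominator to \<open>w \<cdot> c\<close>.\<close>

lemma Q_cokernel_colift:
  assumes R: "roof M N s f" and e: "is_cokernel A (src s) N f E e" and Y: "roof N T t g"
    and z: "rc s f \<odot> rc t g = Zero Q M T"
    and h: "arr h" "src h = N" "arr w" "src w = T" "tgt h = tgt w" "t \<cdot> h = g \<cdot> w" and w: "sig w"
    and c: "is_cokernel A (src s) (tgt w) (f \<cdot> h) D c"
    and u: "arr u" "src u = E" "tgt u = D" "e \<cdot> u = h \<cdot> c"
  shows "roof E D (Ident A E) u" "roof D T (w \<cdot> c) (Ident A T)"
    "rc (Ident A N) e \<odot> (rc (Ident A E) u \<odot> rc (w \<cdot> c) (Ident A T)) = rc t g"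
proof -
  note [simp] = roofD[OF R] roofD[OF Y] h(1-5) w is_cokernelD(4-6)[OF e] is_cokernelD(4-6)[OF c] u(1-3)
  have [simp]: "E \<in> Ob A" using tgt_Ob[of e] by simp
  have "sig c" using sig_cokernel[OF right_fraction_zero[OF Y h R z] c] .
  then have [simp]: "sig (w \<cdot> c)" by (simp add: sig_comp)
  show U: "roof E D (Ident A E) u" by (rule loc_roof) simp_all
  show W: "roof D T (w \<cdot> c) (Ident A T)" by (rule roofI) simp_all
  have E: "roof N E (Ident A N) e" by (rule loc_roof) simp_all
  have "rc (Ident A N) e \<odot> (rc (Ident A E) u \<odot> rc (w \<cdot> c) (Ident A T)) =
      rc (Ident A N) (h \<cdot> c) \<odot> rc (w \<cdot> c) (Ident A T)"
    unfolding Q_assoc[OF Q_HomI[OF E] Q_HomI[OF U] Q_HomI[OF W], symmetric]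
    by (subst comp_loc[OF E]) (simp_all add: u(4))
  also have "\<dots> = rc t g" by (rule right_fraction_inverse[OF Y h]) simp_all
  finally show "rc (Ident A N) e \<odot> (rc (Ident A E) u \<odot> rc (w \<cdot> c) (Ident A T)) = rc t g" .
qed

lemma Q_is_cokernel:
  assumes R: "roof M N s f" and e: "is_cokernel A (src s) N f E e"
  shows "is_cokernel Q M N (rc s f) E (rc (Ident A N) e)"
  unfolding is_cokernel_def Q_simps
proof (intro conjI allI ballI impI)
  note [simp] = roofD[OF R] is_cokernelD(4-7)[OF e]
  have [simp]: "E \<in> Ob A" using tgt_Ob[of e] by simp
  show "rc s f \<in> Hom Q M N" using Q_HomI[OF R] .
  have E: "roof N E (Ident A N) e" by (rule loc_roof) simp_all
  show "rc (Ident A N) e \<in> Hom Q N E" using Q_HomI[OF E] .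
  show "rc s f \<odot> rc (Ident A N) e = Zero Q M E"
    by (subst comp_loc[OF R]) (simp_all add: Q_Zero[of s M E])
  fix T Y assume "Y \<in> Hom Q N T" and z: "rc s f \<odot> Y = Zero Q M T"
  then obtain t g where Y: "roof N T t g" "Y = rc t g" by (auto elim: Q_HomE)
  note [simp] = roofD[OF Y(1)]
  obtain w h where wh [simp]: "arr w" "arr h" "sig w" "tgt h = tgt w" "src w = T" "src h = N"
    and gw: "g \<cdot> w = t \<cdot> h" by (rule coore[of t g]) simp_all
  have "f \<cdot> h \<in> Hom A (src s) (tgt w)" by (simp add: hom_iff)
  then obtain D c where c: "is_cokernel A (src s) (tgt w) (f \<cdot> h) D c" using cokernel by blast
  note [simp] = is_cokernelD(4-6)[OF c]
  obtain u where u: "arr u" "tgt u = D" "src u = E" "e \<cdot> u = h \<cdot> c"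
    by (rule cokernel_colift[OF e, of "h \<cdot> c"]) (use is_cokernelD(7)[OF c] in simp_all)
  note U = Q_cokernel_colift[OF R e Y(1) z[unfolded Y(2)] wh(2,6,1,5,4) gw[symmetric] wh(3) c u(1,3,2,4)]
  show "\<exists>!X. X \<in> Hom Q E T \<and> rc (Ident A N) e \<odot> X = Y"
  proof (rule ex1I[of _ "rc (Ident A E) u \<odot> rc (w \<cdot> c) (Ident A T)"])
    show *: "rc (Ident A E) u \<odot> rc (w \<cdot> c) (Ident A T) \<in> Hom Q E T \<and>
      rc (Ident A N) e \<odot> (rc (Ident A E) u \<odot> rc (w \<cdot> c) (Ident A T)) = Y"
      using Q_comp_hom[OF Q_HomI[OF U(1)] Q_HomI[OF U(2)]] U(3) Y(2) by simp
    fix X assume X: "X \<in> Hom Q E T \<and> rc (Ident A N) e \<odot> X = Y"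
    obtain r a b where ab: "roof E T r a" "X = rc r a" "roof E T r b"
      "rc (Ident A E) u \<odot> rc (w \<cdot> c) (Ident A T) = rc r b"
      using Q_pairE[OF X[THEN conjunct1] *[THEN conjunct1]] .
    note [simp] = roofD[OF ab(1)] roofD[OF ab(3)]
    \<comment> \<open>For uniqueness both candidates are turned into right fractions over one
      denominator \<open>?v\<close>, by a second Ore square on top of the first. Only then do the
      numerators start at \<open>E\<close>, where the epi \<open>e\<close> can be cancelled.\<close>
    obtain v y where [simp]: "arr v" "arr y" "sig v" "tgt y = tgt v" "src v = T" "src y = E"
      and v: "a \<cdot> v = r \<cdot> y" by (rule coore[of r a]) simp_all
    obtain v' y' where [simp]: "arr v'" "arr y'" "sig v'" "tgt y' = tgt v'" "src v' = tgt v" "src y' = E"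
      and v': "(b \<cdot> v) \<cdot> v' = r \<cdot> y'" by (rule coore[of r "b \<cdot> v"]) simp_all
    let ?v = "v \<cdot> v'"
    have fr: "r \<cdot> (y \<cdot> v') = a \<cdot> ?v" "r \<cdot> y' = b \<cdot> ?v"
      using comp_reduce[OF v, of v'] v' by simp_all
    have V: "roof T (tgt v') (Ident A T) ?v" by (rule loc_roof) simp_all
    have "rc (Ident A N) (e \<cdot> (y \<cdot> v')) = rc (Ident A N) e \<odot> (rc r a \<odot> rc (Ident A T) ?v)"
      by (subst right_fraction[OF ab(1) _ _ _ _ _ fr(1)], simp_all, subst comp_loc[OF E]) simp_all
    also have "\<dots> = Y \<odot> rc (Ident A T) ?v"
      using Q_assoc[OF Q_HomI[OF E] Q_HomI[OF ab(1)] Q_HomI[OF V]] X ab(2) by simp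
    also have "\<dots> = rc (Ident A N) e \<odot> (rc r b \<odot> rc (Ident A T) ?v)"
      using Q_assoc[OF Q_HomI[OF E] Q_HomI[OF ab(3)] Q_HomI[OF V]] * ab(4) by simp
    also have "\<dots> = rc (Ident A N) (e \<cdot> y')"
      by (subst right_fraction[OF ab(3) _ _ _ _ _ fr(2)], simp_all, subst comp_loc[OF E]) simp_all
    finally have "e \<cdot> (y \<cdot> v') \<approx> e \<cdot> y'"
      using rc_cong_iff[OF loc_roof loc_roof, of "e \<cdot> (y \<cdot> v')" N "tgt v'" "e \<cdot> y'"] by simp
    then have "y \<cdot> v' \<approx> y'" by (rule cong_epi_cancel[OF _ is_cokernelD(8)[OF e]]) simp_all
    then have "r \<cdot> (y \<cdot> v') \<approx> r \<cdot> y'" by (rule cong_comp_left) simp_all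
    then have "a \<cdot> ?v \<approx> b \<cdot> ?v" unfolding fr .
    then have "a \<approx> b" by (rule cong_cancel_right) (simp_all add: sig_comp)
    then show "X = rc (Ident A E) u \<odot> rc (w \<cdot> c) (Ident A T)"
      unfolding ab(2,4) using rc_cong_iff[OF ab(1,3)] by simp
  qed
qed

section \<open>Normality of monomorphisms and epimorphisms\<close>

lemma mono_Q_small:
  assumes R: "roof K M s f" and m: "is_mono Q K M (rc s f)" and x: "arr x" "tgt x = src s" "small (x \<cdot> f)"
  shows "small x"
proof -
  note [simp] = roofD[OF R] x(1,2)
  have X: "roof (src x) K (Ident A (src x)) (x \<cdot> s)" by (rule loc_roof) simp_all
  have XF: "roof (src x) M (Ident A (src x)) (x \<cdot> f)" by (rule loc_roof) simp_all
  \<comment> \<open>The mono is tested on \<open>x \<cdot> s\<close>, the morphism into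
    \<open>K\<close> that cancels the denominator of the fraction.\<close>
  have "rc (Ident A (src x)) (x \<cdot> s) \<odot> rc s f = rc (Ident A (src x)) (x \<cdot> f)"
    by (rule comp_rc_aligned[OF X R]) simp_all
  also have "\<dots> = Zero Q (src x) K \<odot> rc s f"
    using rc_zero_iff[OF XF] x(3) Q_zero_comp[OF Q_HomI[OF R], of "src x"] by simp
  finally have "rc (Ident A (src x)) (x \<cdot> s) = Zero Q (src x) K"
    using m Q_HomI[OF X] Q_Zero_hom[of "src x" K] unfolding is_mono_def Q_simps by simp
  then have "small (x \<cdot> s)" using rc_zero_iff[OF X] by simp
  then show ?thesis by (rule sig_small_right[rotated]) simp_all
qed

lemma epi_Q_small:
  assumes R: "roof N M s f" and m: "is_epi Q N M (rc s f)" and x: "arr x" "src x = M" "small (f \<cdot> x)"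
  shows "small x"
proof -
  note [simp] = roofD[OF R] x(1,2)
  have X: "roof M (tgt x) (Ident A M) x" by (rule loc_roof) simp_all
  have XF: "roof N (tgt x) s (f \<cdot> x)" by (rule roofI) simp_all
  have "rc s f \<odot> rc (Ident A M) x = rc s (f \<cdot> x)"
    by (rule comp_loc[OF R]) simp_all
  also have "\<dots> = rc s f \<odot> Zero Q M (tgt x)"
    using rc_zero_iff[OF XF] x(3) Q_comp_zero[OF Q_HomI[OF R], of "tgt x"] by simp
  finally have "rc (Ident A M) x = Zero Q M (tgt x)"
    using m Q_HomI[OF X] Q_Zero_hom[of M "tgt x"] unfolding is_epi_def Q_simps by simp
  then show "small x" using rc_zero_iff[OF X] by simp
qed

text \<open>When \<open>s\<inverse> f\<close> is mono, the epi \<open>d\<close> onto the image of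
  \<open>f\<close> lies in \<open>sig\<close>. The fraction and the image inclusion \<open>i\<close>
  then differ by the isomorphism \<open>d\<inverse> s\<close>, and the lift along \<open>i\<close>
  is made in \<open>A\<close>, after restriction to the kernel \<open>j\<close> of the small
  \<open>g \<cdot> e\<close>.\<close>

lemma Q_mono_lift:
  assumes R: "roof K M s f" and m: "is_mono Q K M (rc s f)"
    and e: "is_cokernel A (src s) M f E e" and i: "is_kernel A M E e I i"
    and d: "arr d" "src d = src s" "tgt d = I" "d \<cdot> i = f"
    and T: "roof T M t g" and z: "rc t g \<odot> rc (Ident A M) e = Zero Q T E"
    and j: "is_kernel A (src t) E (g \<cdot> e) J j"
    and v: "arr v" "src v = J" "tgt v = I" "v \<cdot> i = j \<cdot> g"
  shows "roof T I (j \<cdot> t) v" "roof I K d s" "(rc (j \<cdot> t) v \<odot> rc d s) \<odot> rc s f = rc t g"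
proof -
  note [simp] = roofD[OF R] roofD[OF T] is_cokernelD(4-6)[OF e] is_kernelD(4-6)[OF i] d(1-3)
    is_kernelD(4-6)[OF j] v(1-3)
  have GE: "roof T E t (g \<cdot> e)" by (rule roofI) simp_all
  have "small (g \<cdot> e)" using z rc_zero_iff[OF GE] comp_loc[OF T, of e] by simp
  then have sj [simp]: "sig j" using sig_kernel[OF _ j] by blast
  have de: "is_epi A (src s) I d" by (rule image_epi[OF _ _ e i d]) simp_all
  have [simp]: "I \<in> Ob A" using src_Ob[of i] by simp
  \<comment> \<open>What \<open>d\<close> kills is killed by \<open>f\<close> and is small because
    the fraction is mono in the quotient; the cokernel side is trivial as \<open>d\<close> is epi in
    \<open>A\<close>.\<close>
  have sd: "sig d"
  proof (rule sigI)
    fix x assume x: "arr x" "tgt x = src d" "x \<cdot> d = Zero A (src x) (tgt d)"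
    have "x \<cdot> f = Zero A (src x) M" using comp_reduce[OF x(3), of i] d(4) x(1,2) by simp
    then show "small x" using mono_Q_small[OF R m, of x] x small_zero[of "src x" M] by simp
  next
    fix y assume y: "arr y" "src y = tgt d" "d \<cdot> y = Zero A (src d) (tgt y)"
    have "y = Zero A I (tgt y)" by (rule epi_zero[OF de]) (use y in simp_all)
    then show "small y" using small_zero[of I "tgt y"] y(1) by simp
  qed simp
  show V: "roof T I (j \<cdot> t) v" by (rule roofI) (simp_all add: sig_comp)
  show D: "roof I K d s" by (rule roofI) (simp_all add: sd)
  have DF: "roof I M d (d \<cdot> i)" by (rule roofI) (simp_all add: sd)
  have JG: "roof T M (j \<cdot> t) (j \<cdot> g)" "rc t g = rc (j \<cdot> t) (j \<cdot> g)"
    by (rule rc_expand[OF T]; simp add: sig_comp)+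
  have I: "rc d (d \<cdot> i) = rc (Ident A I) i"
    by (rule rc_eqI[OF DF loc_roof, of i "Ident A (src s)" d]) (simp_all add: sd cong_refl)
  have "(rc (j \<cdot> t) v \<odot> rc d s) \<odot> rc s f = rc (j \<cdot> t) v \<odot> (rc d s \<odot> rc s f)"
    using Q_assoc Q_HomI V D R by blast
  also have "rc d s \<odot> rc s f = rc (Ident A I) i"
    unfolding comp_cancel[OF D R] I[symmetric] d(4) ..
  also have "rc (j \<cdot> t) v \<odot> rc (Ident A I) i = rc t g"
    by (subst comp_loc[OF V]) (simp_all add: v(4) JG)
  finally show "(rc (j \<cdot> t) v \<odot> rc d s) \<odot> rc s f = rc t g" .
qed

text \<open>When \<open>s\<inverse> f\<close> is epi, the image inclusion \<open>i\<close> lies in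
  \<open>sig\<close> and can serve as denominator of the colift. Its numerator \<open>v\<close> is
  the descent of \<open>s \<cdot> (h \<cdot> c)\<close> along \<open>d\<close>, possible because
  \<open>c\<close> divides out \<open>(k \<cdot> s) \<cdot> h\<close>.\<close>

lemma Q_epi_colift:
  assumes R: "roof N M s f" and m: "is_epi Q N M (rc s f)"
    and k: "is_kernel A (src s) M f K k" and d: "is_cokernel A K (src s) k I d"
    and i: "arr i" "src i = I" "tgt i = M" "d \<cdot> i = f"
    and Y: "roof N T t g" and z: "rc (Ident A K) (k \<cdot> s) \<odot> rc t g = Zero Q K T"
    and h: "arr h" "src h = N" "arr w" "src w = T" "tgt h = tgt w" "t \<cdot> h = g \<cdot> w" and w: "sig w"
    and c: "is_cokernel A K (tgt w) ((k \<cdot> s) \<cdot> h) D c"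
    and v: "arr v" "src v = I" "tgt v = D" "d \<cdot> v = s \<cdot> (h \<cdot> c)"
  shows "roof M D i v" "roof D T (w \<cdot> c) (Ident A T)"
    "rc s f \<odot> (rc i v \<odot> rc (w \<cdot> c) (Ident A T)) = rc t g"
proof -
  note [simp] = roofD[OF R] roofD[OF Y] is_kernelD(4-6)[OF k] is_cokernelD(4-6)[OF d] i(1-3)
    h(1-5) w is_cokernelD(4-6)[OF c] v(1-3)
  have KS: "roof K N (Ident A K) (k \<cdot> s)" by (rule loc_roof) simp_all
  have "small ((k \<cdot> s) \<cdot> h)" by (rule right_fraction_zero[OF Y h KS z])
  then have "sig c" using sig_cokernel[OF _ c] by blast
  then have [simp]: "sig (w \<cdot> c)" by (simp add: sig_comp)
  have mi: "is_mono A I M i" by (rule image_mono[OF k d i])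
  have [simp]: "I \<in> Ob A" using tgt_Ob[of d] by simp
  have [simp]: "sig i"
  proof (rule sigI)
    fix y assume y: "arr y" "src y = tgt i" "i \<cdot> y = Zero A (src i) (tgt y)"
    have "f \<cdot> y = d \<cdot> (i \<cdot> y)" unfolding i(4)[symmetric] using y(1,2) by simp
    also have "\<dots> = Zero A (src s) (tgt y)" unfolding y(3) using y(1) by simp
    finally show "small y" using epi_Q_small[OF R m, of y] y(1,2) small_zero[of "src s" "tgt y"] by simp
  next
    fix x assume x: "arr x" "tgt x = src i" "x \<cdot> i = Zero A (src x) (tgt i)"
    have "x = Zero A (src x) I" by (rule mono_zero[OF mi]) (use x in simp_all)
    then show "small x" using small_zero[of "src x" I] x(1) by simp
  qed simp
  show V: "roof M D i v" by (rule roofI) simp_all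
  show W: "roof D T (w \<cdot> c) (Ident A T)" by (rule roofI) simp_all
  have R': "roof N M s (d \<cdot> i)" using R i(4) by simp
  have "rc s (d \<cdot> i) \<odot> rc i v = rc s (d \<cdot> v)" by (rule comp_rc_aligned[OF R' V]) simp_all
  also have "\<dots> = rc (Ident A N) (h \<cdot> c)"
    unfolding v(4)
    by (rule rc_eqI[of N D _ _ _ _ "Ident A (src s)" s]) (auto intro!: roofI cong_refl sig_id)
  finally have fv: "rc s f \<odot> rc i v = rc (Ident A N) (h \<cdot> c)" unfolding i(4) .
  have "rc s f \<odot> (rc i v \<odot> rc (w \<cdot> c) (Ident A T)) = (rc s f \<odot> rc i v) \<odot> rc (w \<cdot> c) (Ident A T)"
    using Q_assoc Q_HomI V W R by metis
  also have "\<dots> = rc t g" unfolding fv by (rule right_fraction_inverse[OF Y h]) simp_all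
  finally show "rc s f \<odot> (rc i v \<odot> rc (w \<cdot> c) (Ident A T)) = rc t g" .
qed

text \<open>The cokernel \<open>Y\<close> is arbitrary, while \<open>Q_mono_lift\<close> refers to
  the cokernel \<open>e\<close> of the numerator in \<open>A\<close>. The class of \<open>e\<close>
  factors through \<open>Y\<close>, so a morphism killed by \<open>Y\<close> is killed by it.
  Uniqueness is the mono property.\<close>

lemma Q_mono_normal:
  assumes m: "is_mono Q K M X" and c: "is_cokernel Q K M X E Y" shows "is_kernel Q M E Y K X"
  unfolding is_kernel_def Q_simps
proof (intro conjI allI ballI impI)
  obtain s f where X: "roof K M s f" "X = rc s f" using m unfolding is_mono_def by (auto elim: Q_HomE)
  note [simp] = roofD[OF X(1)]
  show "Y \<in> Hom Q M E" "X \<in> Hom Q K M" "X \<odot> Y = Zero Q K E" using c unfolding is_cokernel_def by simp_all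
  have "f \<in> Hom A (src s) M" by (simp add: hom_iff)
  then obtain D e where e: "is_cokernel A (src s) M f D e" using cokernel by blast
  note [simp] = is_cokernelD(4-7)[OF e]
  have [simp]: "D \<in> Ob A" using tgt_Ob[of e] by simp
  have "e \<in> Hom A M D" by (simp add: hom_iff)
  then obtain I i where i: "is_kernel A M D e I i" using kernel by blast
  note [simp] = is_kernelD(4-7)[OF i]
  obtain d where d: "arr d" "src d = src f" "tgt d = I" "d \<cdot> i = f"
    by (rule kernel_lift[OF i, of f]) simp_all
  have le: "rc (Ident A M) e \<in> Hom Q M D" by (intro Q_HomI loc_roof) simp_all
  have "X \<odot> rc (Ident A M) e = Zero Q K D"
    using Q_is_cokernel[OF X(1) e] unfolding is_cokernel_def X(2) by simp
  then obtain U where U: "U \<in> Hom Q E D" "Y \<odot> U = rc (Ident A M) e"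
    using c le unfolding is_cokernel_def Q_simps by blast
  fix T Z assume Z: "Z \<in> Hom Q T M" "Z \<odot> Y = Zero Q T E"
  obtain t g where t: "roof T M t g" "Z = rc t g" using Z(1) by (rule Q_HomE)
  note [simp] = roofD[OF t(1)]
  have "Y \<in> Hom Q M E" using c unfolding is_cokernel_def by simp
  then have z: "rc t g \<odot> rc (Ident A M) e = Zero Q T D"
    using Q_assoc[OF Z(1) _ U(1), of Y] U(2) Z(2) Q_zero_comp[OF U(1), of T] t(2) by simp
  have "g \<cdot> e \<in> Hom A (src t) D" by (simp add: hom_iff)
  then obtain J j where j: "is_kernel A (src t) D (g \<cdot> e) J j" using kernel by blast
  note [simp] = is_kernelD(4-6)[OF j]
  obtain v where v: "arr v" "src v = J" "tgt v = I" "v \<cdot> i = j \<cdot> g"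
    by (rule kernel_lift[OF i, of "j \<cdot> g"]) (use is_kernelD(7)[OF j] in simp_all)
  have d': "src d = src s" using d(2) by simp
  note L = Q_mono_lift[OF X(1) m[unfolded X(2)] e i d(1) d' d(3,4) t(1) z j v]
  have LL: "rc (j \<cdot> t) v \<odot> rc d s \<in> Hom Q T K" using Q_comp_hom Q_HomI L(1,2) by blast
  show "\<exists>!V. V \<in> Hom Q T K \<and> V \<odot> X = Z"
    using LL L(3) m unfolding is_mono_def Q_simps X(2) t(2) by (metis (no_types, lifting))
qed

lemma Q_epi_normal:
  assumes m: "is_epi Q N M X" and c: "is_kernel Q N M X E Y" shows "is_cokernel Q E N Y M X"
  unfolding is_cokernel_def Q_simps
proof (intro conjI allI ballI impI)
  obtain s f where X: "roof N M s f" "X = rc s f" using m unfolding is_epi_def by (auto elim: Q_HomE)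
  note [simp] = roofD[OF X(1)]
  show Y: "Y \<in> Hom Q E N" and "X \<in> Hom Q N M" "Y \<odot> X = Zero Q E M" using c unfolding is_kernel_def by simp_all
  have "f \<in> Hom A (src s) M" by (simp add: hom_iff)
  then obtain K k where k: "is_kernel A (src s) M f K k" using kernel by blast
  note [simp] = is_kernelD(4-7)[OF k]
  have [simp]: "K \<in> Ob A" using src_Ob[of k] by simp
  have "k \<in> Hom A K (src s)" by (simp add: hom_iff)
  then obtain I d where d: "is_cokernel A K (src s) k I d" using cokernel by blast
  note [simp] = is_cokernelD(4-7)[OF d]
  obtain i where i: "arr i" "tgt i = tgt f" "src i = I" "d \<cdot> i = f"
    by (rule cokernel_colift[OF d, of f]) simp_all
  have lk: "rc (Ident A K) (k \<cdot> s) \<in> Hom Q K N" by (intro Q_HomI loc_roof) simp_all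
  have "rc (Ident A K) (k \<cdot> s) \<odot> X = Zero Q K M"
    using Q_is_kernel[OF X(1) k] unfolding is_kernel_def X(2) by simp
  then obtain U where U: "U \<in> Hom Q K E" "U \<odot> Y = rc (Ident A K) (k \<cdot> s)"
    using c lk unfolding is_kernel_def Q_simps by blast
  fix T Z assume Z: "Z \<in> Hom Q N T" "Y \<odot> Z = Zero Q E T"
  obtain t g where t: "roof N T t g" "Z = rc t g" using Z(1) by (rule Q_HomE)
  note [simp] = roofD[OF t(1)]
  have z: "rc (Ident A K) (k \<cdot> s) \<odot> rc t g = Zero Q K T"
    using Q_assoc[OF U(1) Y Z(1)] U(2) Z(2) Q_comp_zero[OF U(1), of T] t(2) by simp
  obtain w h where wh [simp]: "arr w" "arr h" "sig w" "tgt h = tgt w" "src w = T" "src h = N"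
    and gw: "g \<cdot> w = t \<cdot> h" by (rule coore[of t g]) simp_all
  have "(k \<cdot> s) \<cdot> h \<in> Hom A K (tgt w)" by (simp add: hom_iff)
  then obtain D c where c: "is_cokernel A K (tgt w) ((k \<cdot> s) \<cdot> h) D c" using cokernel by blast
  note [simp] = is_cokernelD(4-6)[OF c]
  obtain v where v: "arr v" "tgt v = D" "src v = I" "d \<cdot> v = s \<cdot> (h \<cdot> c)"
    by (rule cokernel_colift[OF d, of "s \<cdot> (h \<cdot> c)"]) (use is_cokernelD(7)[OF c] in simp_all)
  have i': "tgt i = M" using i(2) by simp
  note L = Q_epi_colift[OF X(1) m[unfolded X(2)] k d i(1,3) i' i(4) t(1) z wh(2,6,1,5,4) gw[symmetric] wh(3) c v(1,3,2,4)]
  have LL: "rc i v \<odot> rc (w \<cdot> c) (Ident A T) \<in> Hom Q M T" using Q_comp_hom Q_HomI L(1,2) by blast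
  show "\<exists>!V. V \<in> Hom Q M T \<and> X \<odot> V = Z"
    using LL L(3) m unfolding is_epi_def Q_simps X(2) t(2) by (metis (no_types, lifting))
qed

theorem abelian_category_serre_quotient: "abelian_category Q"
proof (rule abelian_category.intro; (unfold Q_simps)?)
  show "M \<in> Ob A \<and> N \<in> Ob A" if h: "X \<in> Hom Q M N" for X M N
    using that roofD(7,8) by (auto elim!: Q_HomE)
  show "M = M' \<and> N = N'" if h: "X \<in> Hom Q M N" "X \<in> Hom Q M' N'" for X M N M' N'
  proof -
    obtain s f where X: "roof M N s f" "X = rc s f" using h(1) by (rule Q_HomE)
    obtain t g where Y: "roof M' N' t g" "X = rc t g" using h(2) by (rule Q_HomE)
    \<comment> \<open>Classes are non-empty, and a triple determines its ends.\<close>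
    obtain i h p where r: "(i, h, p) \<in> serre_reps A C M N" "teq s f (Ident A N) i h p"
      using triple_of_roof_ex[OF X(1)] .
    then have "(i, h, p) \<in> X" using rc_iff[OF X(1)] X(2) by simp
    then have "(i, h, p) \<in> serre_reps A C M' N'" using rc_iff[OF Y(1)] Y(2) by simp
    then show ?thesis using serre_reps_unique[OF r(1)] by simp
  qed
  show "Ident Q M \<in> Hom Q M M" if "M \<in> Ob A" for M
    using that Q_Ident Q_HomI ident_roof by simp
  show "X \<odot> Y \<in> Hom Q L N" if h: "X \<in> Hom Q L M" "Y \<in> Hom Q M N" for X Y L M N
    using Q_comp_hom that .
  show "Ident Q M \<odot> X = X" if h: "X \<in> Hom Q M N" for X M N
  proof -
    obtain s f where X: "roof M N s f" "X = rc s f" using h by (rule Q_HomE)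
    note [simp] = roofD[OF X(1)]
    have "rc (Ident A M) (Ident A M) = rc s s"
      by (rule rc_eqI[of M M _ _ _ _ s "Ident A (src s)"]) (auto intro!: roofI cong_refl sig_id)
    moreover have "roof M M s s" by (rule roofI) simp_all
    ultimately show ?thesis using comp_cancel[OF _ X(1)] by (simp add: Q_Ident X(2))
  qed
  show "X \<odot> Ident Q N = X" if h: "X \<in> Hom Q M N" for X M N
  proof -
    obtain s f where X: "roof M N s f" "X = rc s f" using h by (rule Q_HomE)
    note [simp] = roofD[OF X(1)]
    show ?thesis by (simp add: Q_Ident X(2) comp_loc[OF X(1)])
  qed
  show "(X \<odot> Y) \<odot> Z = X \<odot> (Y \<odot> Z)" if h: "X \<in> Hom Q K L" "Y \<in> Hom Q L M" "Z \<in> Hom Q M N" for X Y Z K L M N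
    using Q_assoc that .
  show "comm_group (hom_group Q M N)" if "M \<in> Ob A" "N \<in> Ob A" for M N
    using Q_comm_group that .
  show "X \<odot> serre_add A C M N Y Z = serre_add A C L N (X \<odot> Y) (X \<odot> Z)"
    if h: "X \<in> Hom Q L M" "Y \<in> Hom Q M N" "Z \<in> Hom Q M N" for X Y Z L M N
    using Q_comp_add that .
  show "serre_add A C L M X Y \<odot> Z = serre_add A C L N (X \<odot> Z) (Y \<odot> Z)"
    if h: "X \<in> Hom Q L M" "Y \<in> Hom Q L M" "Z \<in> Hom Q M N" for X Y Z L M N
    using Q_add_comp that .
  show "\<exists>Z. is_zero_object Q Z" using zero_object Q_zero_object by blast
  show "\<exists>P p q. is_product Q M N P p q" if "M \<in> Ob A" "N \<in> Ob A" for M N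
    using product[OF that] Q_is_product by blast
  show "\<exists>K Y. is_kernel Q M N X K Y" if h: "X \<in> Hom Q M N" for X M N
  proof -
    obtain s f where X: "roof M N s f" "X = rc s f" using h by (rule Q_HomE)
    then have "f \<in> Hom A (src s) N" using roofD[OF X(1)] by (simp add: hom_iff)
    then show ?thesis using kernel Q_is_kernel[OF X(1)] X(2) by blast
  qed
  show "\<exists>E Y. is_cokernel Q M N X E Y" if h: "X \<in> Hom Q M N" for X M N
  proof -
    obtain s f where X: "roof M N s f" "X = rc s f" using h by (rule Q_HomE)
    then have "f \<in> Hom A (src s) N" using roofD[OF X(1)] by (simp add: hom_iff)
    then show ?thesis using cokernel Q_is_cokernel[OF X(1)] X(2) by blast
  qed
qed (use Q_mono_normal Q_epi_normal in blast)+

text \<open>\<open>Minus\<close> is defined through group inverses; uniqueness of differences,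
  available in the quotient as an Abelian category, avoids computing them.\<close>

lemma Minus_rc:
  assumes R: "roof M N s f" and R': "roof M N s g"
  shows "roof M N s (f \<ominus> g)" "Minus Q M N (rc s f) (rc s g) = rc s (f \<ominus> g)"
proof -
  note [simp] = roofD[OF R] roofD[OF R']
  show D: "roof M N s (f \<ominus> g)" by (rule roofI) simp_all
  interpret Q: abelian_category Q by (rule abelian_category_serre_quotient)
  have h: "rc s (f \<ominus> g) \<in> Hom Q M N" "rc s g \<in> Hom Q M N" using Q_HomI D R' by blast+
  then have [simp]: "Q.src (rc s g) = M" "Q.tgt (rc s g) = N" and h': "Q.arr (rc s (f \<ominus> g))" "Q.arr (rc s g)"
    "Q.src (rc s (f \<ominus> g)) = M" "Q.tgt (rc s (f \<ominus> g)) = N"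
    unfolding Q.hom_iff by simp_all
  have "rc s f \<in> Hom Q M N" using Q_HomI R by blast
  then have hf: "Q.src (rc s f) = M" "Q.tgt (rc s f) = N" unfolding Q.hom_iff by simp_all
  have "rc s (f \<ominus> g) = Q.minus (rc s f) (rc s g)"
  proof (rule Q.minus_unique)
    show "Q.plus (rc s (f \<ominus> g)) (rc s g) = rc s f"
      unfolding Q.plus_def h'(3,4) Q_simps add_rc(2)[OF D R'] by simp
  qed (use h' in simp_all)
  then show "Minus Q M N (rc s f) (rc s g) = rc s (f \<ominus> g)"
    unfolding Q.minus_def hf by simp
qed

end

section \<open>Computing with partial recursive functions\<close>

lemma pr_bind:
  "partial_recursive f \<Longrightarrow> partial_recursive g \<Longrightarrow> partial_recursive (\<lambda>n. Option.bind (g n) f)"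
  by (rule partial_recursive.comp)

lemma pr_const: "partial_recursive (\<lambda>_. Some c)"
proof (induction c)
  case 0
  then show ?case by (rule partial_recursive.zero)
next
  case (Suc c)
  from pr_bind[OF partial_recursive.succ this] show ?case by simp
qed

lemma pr_id: "partial_recursive Some"
  using partial_recursive.pair[OF partial_recursive.fst partial_recursive.snd] by simp

lemma pr_prod_encode:
  "partial_recursive f \<Longrightarrow> partial_recursive g \<Longrightarrow>
    partial_recursive (\<lambda>n. Option.bind (f n) (\<lambda>a. Option.bind (g n) (\<lambda>b. Some (prod_encode (a, b)))))"
  by (rule partial_recursive.pair)

lemma pr_pred: "partial_recursive (\<lambda>n. Some (n - 1))"
proof -
  \<comment> \<open>From the coded arguments \<open>(a, (i, v))\<close> this extracts the stage
    \<open>i\<close>. The last stage before \<open>k\<close> is the predecessor, and the base value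
    covers \<open>0\<close>.\<close>
  let ?g = "\<lambda>x. Option.bind (Some (snd (prod_decode x))) (\<lambda>x. Some (fst (prod_decode x)))"
  have g: "partial_recursive ?g" by (rule pr_bind[OF partial_recursive.fst partial_recursive.snd])
  have "partial_recursive (\<lambda>n. case prod_decode n of (a, k) \<Rightarrow>
      rec_nat (Some 0) (\<lambda>i r. Option.bind r (\<lambda>v. ?g (prod_encode (a, prod_encode (i, v))))) k)"
    by (rule partial_recursive.prim_rec[OF pr_const g])
  also have "(\<lambda>n. case prod_decode n of (a, k) \<Rightarrow>
      rec_nat (Some 0) (\<lambda>i r. Option.bind r (\<lambda>v. ?g (prod_encode (a, prod_encode (i, v))))) k) =
      (\<lambda>n. Some (snd (prod_decode n) - 1))"
  proof
    fix n
    have "rec_nat (Some 0) (\<lambda>i r. Option.bind r (\<lambda>v. Some i)) k = Some (k - 1)" for k :: nat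
      by (induction k) simp_all
    then show "(case prod_decode n of (a, k) \<Rightarrow>
        rec_nat (Some 0) (\<lambda>i r. Option.bind r (\<lambda>v. ?g (prod_encode (a, prod_encode (i, v))))) k) =
      Some (snd (prod_decode n) - 1)" by (simp split: prod.split)
  qed
  finally show ?thesis
    using pr_bind[OF _ pr_prod_encode[OF pr_id pr_id], of "\<lambda>n. Some (snd (prod_decode n) - 1)"] by simp
qed

text \<open>Codes are of type \<open>nat option\<close>: all operations on them are strict, so that the computability
  of a term does not depend on the conditions under which it is defined.\<close>

definition nth_code :: "nat \<Rightarrow> nat \<Rightarrow> nat option" where
  "nth_code i r = Some (fst (prod_decode (((\<lambda>r. snd (prod_decode (r - 1))) ^^ i) r - 1)))"

text \<open>\<open>list_encode\<close> on partial values. The nested binds copy the forms of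
  \<open>pair\<close> and \<open>succ\<close> in the definition of partial recursive
  functions.\<close>

fun opt_list :: "nat option list \<Rightarrow> nat option" where
  "opt_list [] = Some 0"
| "opt_list (x # xs) =
    Option.bind (Option.bind x (\<lambda>a. Option.bind (opt_list xs) (\<lambda>b. Some (prod_encode (a, b))))) (\<lambda>n. Some (Suc n))"

text \<open>An algorithm returns the code of a list. Selecting one component per call lets terms be
  written as if every algorithm had a single output.\<close>

definition call :: "(nat \<Rightarrow> nat option) \<Rightarrow> nat \<Rightarrow> nat option list \<Rightarrow> nat option" where
  "call a i xs = Option.bind (Option.bind (opt_list xs) a) (nth_code i)"

text \<open>The second argument need not be defined if the first one is \<open>0\<close>: the algorithms need not
  terminate on candidates that represent no morphism.\<close>

definition guard :: "nat option \<Rightarrow> nat option \<Rightarrow> nat option" where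
  "guard b x = Option.bind b (\<lambda>k. if k = 0 then Some 0 else x)"

text \<open>A non-empty list is coded by the successor of the pair of its head and the code of its
  tail; hence the predecessor before each decoding.\<close>

lemma nth_code_encode: "i < length xs \<Longrightarrow> nth_code i (list_encode xs) = Some (xs ! i)"
proof -
  have *: "((\<lambda>r. snd (prod_decode (r - 1))) ^^ i) (list_encode xs) = list_encode (drop i xs)" if "i \<le> length xs" for i
    using that
  proof (induction i)
    case (Suc i)
    then have "drop i xs = xs ! i # drop (Suc i) xs" by (simp add: Cons_nth_drop_Suc)
    with Suc show ?case by simp
  qed simp
  assume i: "i < length xs"
  then have "drop i xs = xs ! i # drop (Suc i) xs" by (simp add: Cons_nth_drop_Suc)
  then show ?thesis using *[of i] i by (simp add: nth_code_def)
qed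

lemma opt_list_Some: "opt_list (map Some ns) = Some (list_encode ns)"
  by (induction ns) simp_all

lemma call_returns:
  "returns a ns ys \<Longrightarrow> xs = map Some ns \<Longrightarrow> i < length ys \<Longrightarrow> call a i xs = Some (ys ! i)"
  by (simp add: call_def opt_list_Some returns_def nth_code_encode)

lemma guard_bool: "guard (Some (of_bool b)) x = (if b then x else Some (of_bool False))"
  by (simp add: guard_def)

lemma pr_nth_code: "partial_recursive (nth_code i)"
proof -
  have tl: "partial_recursive (\<lambda>r. Some (snd (prod_decode (r - 1))))"
    using pr_bind[OF partial_recursive.snd pr_pred] by simp
  have "partial_recursive (\<lambda>r. Some (((\<lambda>r. snd (prod_decode (r - 1))) ^^ i) r))"
  proof (induction i)
    case (Suc i)
    from pr_bind[OF tl this] show ?case by simp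
  qed (simp add: pr_id)
  from pr_bind[OF pr_bind[OF partial_recursive.fst pr_pred] this]
  show ?thesis by (simp add: nth_code_def[abs_def])
qed

lemma pr_nth: "partial_recursive x \<Longrightarrow> partial_recursive (\<lambda>e. Option.bind (x e) (nth_code i))"
  by (rule pr_bind[OF pr_nth_code])

lemma pr_list_Nil: "partial_recursive (\<lambda>e. opt_list [])"
  by (simp add: pr_const)

lemma pr_list_Cons:
  "partial_recursive x \<Longrightarrow> partial_recursive (\<lambda>e. opt_list (xs e)) \<Longrightarrow>
    partial_recursive (\<lambda>e. opt_list (x e # xs e))"
  using pr_bind[OF partial_recursive.succ pr_prod_encode] by simp

lemma pr_call:
  "partial_recursive a \<Longrightarrow> partial_recursive (\<lambda>e. opt_list (xs e)) \<Longrightarrow> partial_recursive (\<lambda>e. call a i (xs e))"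
  unfolding call_def by (intro pr_nth pr_bind)

text \<open>A conditional by primitive recursion on the value of the test: the base value
  \<open>0\<close> is reached without evaluating \<open>x\<close>, and every step returns
  \<open>x\<close>. This is how \<open>x\<close> may diverge when the test fails.\<close>

lemma pr_guard:
  assumes b: "partial_recursive b" and x: "partial_recursive x"
  shows "partial_recursive (\<lambda>e. guard (b e) (x e))"
proof -
  let ?g = "\<lambda>n. Option.bind (Some (fst (prod_decode n))) x"
  have g: "partial_recursive ?g" by (rule pr_bind[OF x partial_recursive.fst])
  have "partial_recursive (\<lambda>n. case prod_decode n of (a, k) \<Rightarrow>
      rec_nat (Some 0) (\<lambda>i r. Option.bind r (\<lambda>v. ?g (prod_encode (a, prod_encode (i, v))))) k)"
    by (rule partial_recursive.prim_rec[OF pr_const g])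
  also have "(\<lambda>n. case prod_decode n of (a, k) \<Rightarrow>
      rec_nat (Some 0) (\<lambda>i r. Option.bind r (\<lambda>v. ?g (prod_encode (a, prod_encode (i, v))))) k) =
      (\<lambda>n. guard (Some (snd (prod_decode n))) (x (fst (prod_decode n))))"
  proof
    fix n
    have "rec_nat (Some 0) (\<lambda>i r. Option.bind r (\<lambda>v. x a)) k = guard (Some k) (x a)" for a and k :: nat
    proof (induction k)
      case (Suc k)
      then show ?case by (cases "k = 0"; cases "x a") (simp_all add: guard_def)
    qed (simp add: guard_def)
    then show "(case prod_decode n of (a, k) \<Rightarrow>
        rec_nat (Some 0) (\<lambda>i r. Option.bind r (\<lambda>v. ?g (prod_encode (a, prod_encode (i, v))))) k) =
      guard (Some (snd (prod_decode n))) (x (fst (prod_decode n)))" by (simp split: prod.split)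
  qed
  finally have "partial_recursive (\<lambda>n. Option.bind
      (Option.bind (Some n) (\<lambda>a. Option.bind (b n) (\<lambda>b. Some (prod_encode (a, b)))))
      (\<lambda>n. guard (Some (snd (prod_decode n))) (x (fst (prod_decode n)))))"
    by (rule pr_bind[OF _ pr_prod_encode[OF pr_id b]])
  also have "(\<lambda>n. Option.bind
      (Option.bind (Some n) (\<lambda>a. Option.bind (b n) (\<lambda>b. Some (prod_encode (a, b)))))
      (\<lambda>n. guard (Some (snd (prod_decode n))) (x (fst (prod_decode n))))) = (\<lambda>e. guard (b e) (x e))"
    by (simp add: fun_eq_iff guard_def split: bind_split)
  finally show ?thesis .
qed

lemmas pr_intros = pr_list_Nil pr_list_Cons pr_call pr_guard pr_nth pr_nth_code

section \<open>Codes of objects and morphisms\<close>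

type_synonym code = "nat option"

text \<open>The algorithms take the codes of source and target as arguments besides that of the
  morphism, so the three travel together, each possibly undefined.\<close>

datatype mcode = Mcode (csrc: code) (ctgt: code) (ccode: code)

text \<open>Computability in the input \<open>e\<close> of a family of coded morphisms, with no
  demand that its values be valid codes.\<close>

definition prm :: "(nat \<Rightarrow> mcode) \<Rightarrow> bool" where
  "prm x \<longleftrightarrow> partial_recursive (\<lambda>e. csrc (x e)) \<and> partial_recursive (\<lambda>e. ctgt (x e)) \<and>
    partial_recursive (\<lambda>e. ccode (x e))"

lemma prm_code:
  "prm x \<Longrightarrow> partial_recursive (\<lambda>e. csrc (x e))" "prm x \<Longrightarrow> partial_recursive (\<lambda>e. ctgt (x e))"
  "prm x \<Longrightarrow> partial_recursive (\<lambda>e. ccode (x e))"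
  by (simp_all add: prm_def)

lemma prm_Mcode:
  "partial_recursive m \<Longrightarrow> partial_recursive n \<Longrightarrow> partial_recursive f \<Longrightarrow> prm (\<lambda>e. Mcode (m e) (n e) (f e))"
  by (simp add: prm_def)

text \<open>Here the algorithms have names, so that terms can be built from them; the decision
  procedure for \<open>C\<close> is one of them.\<close>

locale serre_codes = thick_subcategory A C
  for A :: "('o, 'm) category_data" (structure) and C :: "'o set" +
  fixes P :: "('o, 'm) presentation"
    and a_id a_comp a_mem a_eq a_add a_sub a_zero a_zob a_prod a_pair a_ker a_lift a_cok a_colift a_thick ::
      "nat \<Rightarrow> nat option"
  assumes presentation: "is_presentation A P"
    and pr_algs: "partial_recursive a_id" "partial_recursive a_comp" "partial_recursive a_mem"
      "partial_recursive a_eq" "partial_recursive a_add" "partial_recursive a_sub" "partial_recursive a_zero"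
      "partial_recursive a_zob" "partial_recursive a_prod" "partial_recursive a_pair" "partial_recursive a_ker"
      "partial_recursive a_lift" "partial_recursive a_cok" "partial_recursive a_colift" "partial_recursive a_thick"
    and id: "m \<in> obj_codes P \<Longrightarrow> \<exists>i\<in>hom_codes A P m m. returns a_id [m] [i] \<and> mor P i = Ident A (obj P m)"
    and comp: "f \<in> hom_codes A P l m \<Longrightarrow> g \<in> hom_codes A P m n \<Longrightarrow>
      \<exists>h\<in>hom_codes A P l n. returns a_comp [l, m, n, f, g] [h] \<and> mor P h = mor P f \<cdot> mor P g"
    and mem: "m \<in> obj_codes P \<Longrightarrow> n \<in> obj_codes P \<Longrightarrow> f \<in> mor_data P \<Longrightarrow>
      returns a_mem [m, n, f] [of_bool (f \<in> hom_codes A P m n)]"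
    and eq: "f \<in> hom_codes A P m n \<Longrightarrow> g \<in> hom_codes A P m n \<Longrightarrow>
      returns a_eq [m, n, f, g] [of_bool (mor P f = mor P g)]"
    and add: "f \<in> hom_codes A P m n \<Longrightarrow> g \<in> hom_codes A P m n \<Longrightarrow>
      \<exists>h\<in>hom_codes A P m n. returns a_add [m, n, f, g] [h] \<and>
        mor P h = Add A (obj P m) (obj P n) (mor P f) (mor P g)"
    and sub: "f \<in> hom_codes A P m n \<Longrightarrow> g \<in> hom_codes A P m n \<Longrightarrow>
      \<exists>h\<in>hom_codes A P m n. returns a_sub [m, n, f, g] [h] \<and>
        mor P h = Minus A (obj P m) (obj P n) (mor P f) (mor P g)"
    and zero: "m \<in> obj_codes P \<Longrightarrow> n \<in> obj_codes P \<Longrightarrow>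
      \<exists>h\<in>hom_codes A P m n. returns a_zero [m, n] [h] \<and> mor P h = Zero A (obj P m) (obj P n)"
    and zob: "\<exists>z\<in>obj_codes P. returns a_zob [] [z] \<and> is_zero_object A (obj P z)"
    and prod: "m1 \<in> obj_codes P \<Longrightarrow> m2 \<in> obj_codes P \<Longrightarrow>
      \<exists>p\<in>obj_codes P. \<exists>p1\<in>hom_codes A P p m1. \<exists>p2\<in>hom_codes A P p m2.
          returns a_prod [m1, m2] [p, p1, p2] \<and>
          is_product A (obj P m1) (obj P m2) (obj P p) (mor P p1) (mor P p2) \<and>
          (\<forall>n. \<forall>f1\<in>hom_codes A P n m1. \<forall>f2\<in>hom_codes A P n m2. \<exists>u\<in>hom_codes A P n p.
            returns a_pair [m1, m2, n, f1, f2] [u] \<and>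
            mor P u \<cdot> mor P p1 = mor P f1 \<and> mor P u \<cdot> mor P p2 = mor P f2)"
    and ker: "f \<in> hom_codes A P m n \<Longrightarrow> \<exists>k\<in>obj_codes P. \<exists>i\<in>hom_codes A P k m.
          returns a_ker [m, n, f] [k, i] \<and>
          is_kernel A (obj P m) (obj P n) (mor P f) (obj P k) (mor P i) \<and>
          (\<forall>l. \<forall>t\<in>hom_codes A P l m. mor P t \<cdot> mor P f = Zero A (obj P l) (obj P n) \<longrightarrow>
            (\<exists>u\<in>hom_codes A P l k. returns a_lift [m, n, f, l, t] [u] \<and> mor P u \<cdot> mor P i = mor P t))"
    and cok: "f \<in> hom_codes A P m n \<Longrightarrow> \<exists>c\<in>obj_codes P. \<exists>e\<in>hom_codes A P n c.
          returns a_cok [m, n, f] [c, e] \<and>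
          is_cokernel A (obj P m) (obj P n) (mor P f) (obj P c) (mor P e) \<and>
          (\<forall>l. \<forall>t\<in>hom_codes A P n l. mor P f \<cdot> mor P t = Zero A (obj P m) (obj P l) \<longrightarrow>
            (\<exists>u\<in>hom_codes A P c l. returns a_colift [m, n, f, l, t] [u] \<and> mor P e \<cdot> mor P u = mor P t))"
    and thickd: "m \<in> obj_codes P \<Longrightarrow> returns a_thick [m] [of_bool (obj P m \<in> C)]"
begin

section \<open>Valid codes and the operations of A on them\<close>

definition ob :: "code \<Rightarrow> bool" where "ob m \<longleftrightarrow> (\<exists>k\<in>obj_codes P. m = Some k)"

definition oval :: "code \<Rightarrow> 'o" where "oval m = obj P (the m)"

text \<open>Soundness of the operations assumes this validity, whereas their computability does
  not.\<close>

definition mo :: "mcode \<Rightarrow> bool" where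
  "mo x \<longleftrightarrow> (\<exists>m n f. x = Mcode (Some m) (Some n) (Some f) \<and> f \<in> hom_codes A P m n)"

definition mval :: "mcode \<Rightarrow> 'm" where "mval x = mor P (the (ccode x))"

lemma moE:
  assumes "mo x"
  obtains m n f where "x = Mcode (Some m) (Some n) (Some f)" "f \<in> hom_codes A P m n"
    "m \<in> obj_codes P" "n \<in> obj_codes P" "mor P f \<in> Hom A (obj P m) (obj P n)"
  using assms unfolding mo_def hom_codes_def by blast

lemma mo_simps [simp]:
  assumes "mo x"
  shows "ob (csrc x)" "ob (ctgt x)" "arr (mval x)" "src (mval x) = oval (csrc x)" "tgt (mval x) = oval (ctgt x)"
  using assms by (auto elim!: moE simp: ob_def mval_def oval_def hom_iff)

lemma ob_Ob [simp]: "ob m \<Longrightarrow> oval m \<in> Ob A"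
  using presentation unfolding is_presentation_def ob_def oval_def obj_codes_def obj_def by (force simp: ran_def)

definition idC :: "code \<Rightarrow> mcode" where "idC m = Mcode m m (call a_id 0 [m])"

definition compC :: "mcode \<Rightarrow> mcode \<Rightarrow> mcode" where
  "compC x y = Mcode (csrc x) (ctgt y) (call a_comp 0 [csrc x, ctgt x, ctgt y, ccode x, ccode y])"

definition addC :: "mcode \<Rightarrow> mcode \<Rightarrow> mcode" where
  "addC x y = Mcode (csrc x) (ctgt x) (call a_add 0 [csrc x, ctgt x, ccode x, ccode y])"

definition subC :: "mcode \<Rightarrow> mcode \<Rightarrow> mcode" where
  "subC x y = Mcode (csrc x) (ctgt x) (call a_sub 0 [csrc x, ctgt x, ccode x, ccode y])"

definition zeroC :: "code \<Rightarrow> code \<Rightarrow> mcode" where "zeroC m n = Mcode m n (call a_zero 0 [m, n])"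

definition prodC :: "code \<Rightarrow> code \<Rightarrow> code" where "prodC m n = call a_prod 0 [m, n]"

definition fstC :: "code \<Rightarrow> code \<Rightarrow> mcode" where "fstC m n = Mcode (prodC m n) m (call a_prod 1 [m, n])"

definition sndC :: "code \<Rightarrow> code \<Rightarrow> mcode" where "sndC m n = Mcode (prodC m n) n (call a_prod 2 [m, n])"

definition pairC :: "mcode \<Rightarrow> mcode \<Rightarrow> mcode" where
  "pairC x y = Mcode (csrc x) (prodC (ctgt x) (ctgt y))
    (call a_pair 0 [ctgt x, ctgt y, csrc x, ccode x, ccode y])"

definition kerC :: "mcode \<Rightarrow> mcode" where
  "kerC x = Mcode (call a_ker 0 [csrc x, ctgt x, ccode x]) (csrc x) (call a_ker 1 [csrc x, ctgt x, ccode x])"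

definition liftC :: "mcode \<Rightarrow> mcode \<Rightarrow> mcode" where
  "liftC x y = Mcode (csrc y) (csrc (kerC x)) (call a_lift 0 [csrc x, ctgt x, ccode x, csrc y, ccode y])"

definition cokC :: "mcode \<Rightarrow> mcode" where
  "cokC x = Mcode (ctgt x) (call a_cok 0 [csrc x, ctgt x, ccode x]) (call a_cok 1 [csrc x, ctgt x, ccode x])"

definition coliftC :: "mcode \<Rightarrow> mcode \<Rightarrow> mcode" where
  "coliftC x y = Mcode (ctgt (cokC x)) (ctgt y) (call a_colift 0 [csrc x, ctgt x, ccode x, ctgt y, ccode y])"

lemmas op_defs = idC_def compC_def addC_def subC_def zeroC_def fstC_def sndC_def pairC_def kerC_def liftC_def
  cokC_def coliftC_def

lemma op_src_tgt [simp]: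
  "csrc (idC m) = m" "ctgt (idC m) = m" "csrc (compC x y) = csrc x" "ctgt (compC x y) = ctgt y"
  "csrc (addC x y) = csrc x" "ctgt (addC x y) = ctgt x" "csrc (subC x y) = csrc x" "ctgt (subC x y) = ctgt x"
  "csrc (zeroC m n) = m" "ctgt (zeroC m n) = n" "csrc (fstC m n) = prodC m n" "ctgt (fstC m n) = m"
  "csrc (sndC m n) = prodC m n" "ctgt (sndC m n) = n" "csrc (pairC x y) = csrc x"
  "ctgt (pairC x y) = prodC (ctgt x) (ctgt y)" "ctgt (kerC x) = csrc x" "csrc (cokC x) = ctgt x"
  "csrc (liftC x y) = csrc y" "ctgt (liftC x y) = csrc (kerC x)"
  "csrc (coliftC x y) = ctgt (cokC x)" "ctgt (coliftC x y) = ctgt y"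
  by (simp_all add: op_defs)

text \<open>Partiality absorbs the preconditions of the operations, so computability is read off the
  structure of a term.\<close>

lemma pr_ops:
  "partial_recursive m \<Longrightarrow> prm (\<lambda>e. idC (m e))"
  "prm x \<Longrightarrow> prm y \<Longrightarrow> prm (\<lambda>e. compC (x e) (y e))"
  "prm x \<Longrightarrow> prm y \<Longrightarrow> prm (\<lambda>e. addC (x e) (y e))"
  "prm x \<Longrightarrow> prm y \<Longrightarrow> prm (\<lambda>e. subC (x e) (y e))"
  "partial_recursive m \<Longrightarrow> partial_recursive n \<Longrightarrow> prm (\<lambda>e. zeroC (m e) (n e))"
  "partial_recursive m \<Longrightarrow> partial_recursive n \<Longrightarrow> partial_recursive (\<lambda>e. prodC (m e) (n e))"
  "partial_recursive m \<Longrightarrow> partial_recursive n \<Longrightarrow> prm (\<lambda>e. fstC (m e) (n e))"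
  "partial_recursive m \<Longrightarrow> partial_recursive n \<Longrightarrow> prm (\<lambda>e. sndC (m e) (n e))"
  "prm x \<Longrightarrow> prm y \<Longrightarrow> prm (\<lambda>e. pairC (x e) (y e))"
  "prm x \<Longrightarrow> prm (\<lambda>e. kerC (x e))"
  "prm x \<Longrightarrow> prm y \<Longrightarrow> prm (\<lambda>e. liftC (x e) (y e))"
  "prm x \<Longrightarrow> prm (\<lambda>e. cokC (x e))"
  "prm x \<Longrightarrow> prm y \<Longrightarrow> prm (\<lambda>e. coliftC (x e) (y e))"
  unfolding op_defs prodC_def mcode.sel by (intro prm_Mcode pr_intros pr_algs prm_code; assumption)+

lemma Hom_minus: "f \<in> Hom A K N \<Longrightarrow> Minus A K N f g = f \<ominus> g" and Hom_plus: "f \<in> Hom A K N \<Longrightarrow> Add A K N f g = f \<oplus> g"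
  by (simp_all add: hom_iff minus_def plus_def)

lemma idC [simp]: assumes "ob m" shows "mo (idC m)" "mval (idC m) = Ident A (oval m)"
proof -
  obtain k where k: "k \<in> obj_codes P" "m = Some k" using assms ob_def by blast
  obtain i where i: "i \<in> hom_codes A P k k" "returns a_id [k] [i]" "mor P i = Ident A (obj P k)" using id[OF k(1)] by blast
  have "call a_id 0 [m] = Some i" using call_returns[OF i(2), of "[m]" 0] k(2) by simp
  then show "mo (idC m)" "mval (idC m) = Ident A (oval m)" using i k by (auto simp: idC_def mo_def mval_def oval_def)
qed

lemma compC [simp]:
  assumes "mo x" "mo y" "ctgt x = csrc y" shows "mo (compC x y)" "mval (compC x y) = mval x \<cdot> mval y"
proof -
  obtain l m f where x: "x = Mcode (Some l) (Some m) (Some f)" "f \<in> hom_codes A P l m" using assms(1) mo_def by blast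
  obtain n g where y: "y = Mcode (Some m) (Some n) (Some g)" "g \<in> hom_codes A P m n" using assms(2,3) x mo_def by auto
  obtain h where h: "h \<in> hom_codes A P l n" "returns a_comp [l, m, n, f, g] [h]" "mor P h = mor P f \<cdot> mor P g"
    using comp[OF x(2) y(2)] by blast
  have "ccode (compC x y) = Some h" using call_returns[OF h(2), of _ 0] x y by (simp add: compC_def)
  then show "mo (compC x y)" "mval (compC x y) = mval x \<cdot> mval y"
    using h x(1) y(1) by (auto simp: compC_def mo_def mval_def)
qed

lemma addC [simp]:
  assumes "mo x" "mo y" "csrc x = csrc y" "ctgt x = ctgt y" shows "mo (addC x y)" "mval (addC x y) = mval x \<oplus> mval y"
proof -
  obtain m n f where x: "x = Mcode (Some m) (Some n) (Some f)" "f \<in> hom_codes A P m n" using assms(1) mo_def by blast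
  obtain g where y: "y = Mcode (Some m) (Some n) (Some g)" "g \<in> hom_codes A P m n" using assms(2-4) x mo_def by auto
  obtain h where h: "h \<in> hom_codes A P m n" "returns a_add [m, n, f, g] [h]"
    "mor P h = Add A (obj P m) (obj P n) (mor P f) (mor P g)" using add[OF x(2) y(2)] by blast
  have "ccode (addC x y) = Some h" using call_returns[OF h(2), of _ 0] x y by (simp add: addC_def)
  moreover have "mor P f \<in> Hom A (obj P m) (obj P n)" using x(2) by (simp add: hom_codes_def)
  ultimately show "mo (addC x y)" "mval (addC x y) = mval x \<oplus> mval y"
    using h x(1) y(1) Hom_plus by (auto simp: addC_def mo_def mval_def)
qed

lemma subC [simp]:
  assumes "mo x" "mo y" "csrc x = csrc y" "ctgt x = ctgt y" shows "mo (subC x y)" "mval (subC x y) = mval x \<ominus> mval y"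
proof -
  obtain m n f where x: "x = Mcode (Some m) (Some n) (Some f)" "f \<in> hom_codes A P m n" using assms(1) mo_def by blast
  obtain g where y: "y = Mcode (Some m) (Some n) (Some g)" "g \<in> hom_codes A P m n" using assms(2-4) x mo_def by auto
  obtain h where h: "h \<in> hom_codes A P m n" "returns a_sub [m, n, f, g] [h]"
    "mor P h = Minus A (obj P m) (obj P n) (mor P f) (mor P g)" using sub[OF x(2) y(2)] by blast
  have "ccode (subC x y) = Some h" using call_returns[OF h(2), of _ 0] x y by (simp add: subC_def)
  moreover have "mor P f \<in> Hom A (obj P m) (obj P n)" using x(2) by (simp add: hom_codes_def)
  ultimately show "mo (subC x y)" "mval (subC x y) = mval x \<ominus> mval y"
    using h x(1) y(1) Hom_minus by (auto simp: subC_def mo_def mval_def)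
qed

lemma zeroC [simp]: assumes "ob m" "ob n" shows "mo (zeroC m n)" "mval (zeroC m n) = Zero A (oval m) (oval n)"
proof -
  obtain k l where k: "k \<in> obj_codes P" "m = Some k" "l \<in> obj_codes P" "n = Some l" using assms ob_def by blast
  obtain i where i: "i \<in> hom_codes A P k l" "returns a_zero [k, l] [i]" "mor P i = Zero A (obj P k) (obj P l)"
    using zero[OF k(1,3)] by blast
  have "call a_zero 0 [m, n] = Some i" using call_returns[OF i(2), of "[m, n]" 0] k by simp
  then show "mo (zeroC m n)" "mval (zeroC m n) = Zero A (oval m) (oval n)" using i k by (auto simp: zeroC_def mo_def mval_def oval_def)
qed

lemma prodC:
  assumes "ob m" "ob n"
  shows "ob (prodC m n)" "mo (fstC m n)" "mo (sndC m n)"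
    "is_product A (oval m) (oval n) (oval (prodC m n)) (mval (fstC m n)) (mval (sndC m n))"
    "\<And>x y. mo x \<Longrightarrow> mo y \<Longrightarrow> csrc x = csrc y \<Longrightarrow> ctgt x = m \<Longrightarrow> ctgt y = n \<Longrightarrow>
      mo (pairC x y) \<and> mval (pairC x y) \<cdot> mval (fstC m n) = mval x \<and> mval (pairC x y) \<cdot> mval (sndC m n) = mval y"
proof -
  obtain k l where k: "k \<in> obj_codes P" "m = Some k" "l \<in> obj_codes P" "n = Some l" using assms ob_def by blast
  obtain p p1 p2 where p: "p \<in> obj_codes P" "p1 \<in> hom_codes A P p k" "p2 \<in> hom_codes A P p l"
      "returns a_prod [k, l] [p, p1, p2]" "is_product A (obj P k) (obj P l) (obj P p) (mor P p1) (mor P p2)"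
    and u: "\<forall>n. \<forall>f1\<in>hom_codes A P n k. \<forall>f2\<in>hom_codes A P n l. \<exists>u\<in>hom_codes A P n p.
        returns a_pair [k, l, n, f1, f2] [u] \<and>
        mor P u \<cdot> mor P p1 = mor P f1 \<and> mor P u \<cdot> mor P p2 = mor P f2" using prod[OF k(1,3)] by blast
  have [simp]: "call a_prod 0 [Some k, Some l] = Some p" "call a_prod (Suc 0) [Some k, Some l] = Some p1"
    "call a_prod 2 [Some k, Some l] = Some p2"
    using call_returns[OF p(4), of "[Some k, Some l]"] by simp_all
  show "ob (prodC m n)" "mo (fstC m n)" "mo (sndC m n)"
    "is_product A (oval m) (oval n) (oval (prodC m n)) (mval (fstC m n)) (mval (sndC m n))"
    using p k by (auto simp: prodC_def fstC_def sndC_def mo_def mval_def ob_def oval_def)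
  fix x y assume xy: "mo x" "mo y" "csrc x = csrc y" "ctgt x = m" "ctgt y = n"
  obtain a f where x: "x = Mcode (Some a) (Some k) (Some f)" "f \<in> hom_codes A P a k" using xy k mo_def by auto
  obtain g where y: "y = Mcode (Some a) (Some l) (Some g)" "g \<in> hom_codes A P a l" using xy k x mo_def by auto
  obtain v where v: "v \<in> hom_codes A P a p" "returns a_pair [k, l, a, f, g] [v]"
    "mor P v \<cdot> mor P p1 = mor P f" "mor P v \<cdot> mor P p2 = mor P g" using u x(2) y(2) by blast
  have "ccode (pairC x y) = Some v" using call_returns[OF v(2), of _ 0] x y by (simp add: pairC_def)
  then show "mo (pairC x y) \<and> mval (pairC x y) \<cdot> mval (fstC m n) = mval x \<and> mval (pairC x y) \<cdot> mval (sndC m n) = mval y"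
    using x(1) y(1) v k by (auto simp: pairC_def mo_def mval_def prodC_def fstC_def sndC_def)
qed

lemma kerC:
  assumes "mo x"
  shows "mo (kerC x)" "is_kernel A (oval (csrc x)) (oval (ctgt x)) (mval x) (oval (csrc (kerC x))) (mval (kerC x))"
    "\<And>y. mo y \<Longrightarrow> ctgt y = csrc x \<Longrightarrow> mval y \<cdot> mval x = Zero A (oval (csrc y)) (oval (ctgt x)) \<Longrightarrow>
      mo (liftC x y) \<and> mval (liftC x y) \<cdot> mval (kerC x) = mval y"
proof -
  obtain m n f where x: "x = Mcode (Some m) (Some n) (Some f)" "f \<in> hom_codes A P m n" using assms mo_def by blast
  obtain k i where k: "k\<in>obj_codes P" "i\<in>hom_codes A P k m" "returns a_ker [m, n, f] [k, i]"
      "is_kernel A (obj P m) (obj P n) (mor P f) (obj P k) (mor P i)"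
    and u: "\<forall>l. \<forall>t\<in>hom_codes A P l m. mor P t \<cdot> mor P f = Zero A (obj P l) (obj P n) \<longrightarrow>
      (\<exists>u\<in>hom_codes A P l k. returns a_lift [m, n, f, l, t] [u] \<and> mor P u \<cdot> mor P i = mor P t)"
    using ker[OF x(2)] by blast
  have [simp]: "kerC (Mcode (Some m) (Some n) (Some f)) = Mcode (Some k) (Some m) (Some i)"
    using call_returns[OF k(3), of _ 0] call_returns[OF k(3), of _ 1] by (simp add: kerC_def)
  show "mo (kerC x)" "is_kernel A (oval (csrc x)) (oval (ctgt x)) (mval x) (oval (csrc (kerC x))) (mval (kerC x))"
    using k x by (auto simp: mo_def mval_def oval_def)
  fix y assume y0: "mo y" "ctgt y = csrc x" "mval y \<cdot> mval x = Zero A (oval (csrc y)) (oval (ctgt x))"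
  then obtain l g where y: "y = Mcode (Some l) (Some m) (Some g)" "g \<in> hom_codes A P l m" using x mo_def by auto
  obtain v where v: "v \<in> hom_codes A P l k" "returns a_lift [m, n, f, l, g] [v]" "mor P v \<cdot> mor P i = mor P g"
    using u y(2) y0(3) x(1) y(1) by (auto simp: mval_def oval_def)
  have "ccode (liftC x y) = Some v" using call_returns[OF v(2), of _ 0] x y by (simp add: liftC_def)
  then show "mo (liftC x y) \<and> mval (liftC x y) \<cdot> mval (kerC x) = mval y"
    using x(1) y(1) v by (auto simp: liftC_def mo_def mval_def)
qed

lemma cokC:
  assumes "mo x"
  shows "mo (cokC x)" "is_cokernel A (oval (csrc x)) (oval (ctgt x)) (mval x) (oval (ctgt (cokC x))) (mval (cokC x))"
    "\<And>y. mo y \<Longrightarrow> csrc y = ctgt x \<Longrightarrow> mval x \<cdot> mval y = Zero A (oval (csrc x)) (oval (ctgt y)) \<Longrightarrow>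
      mo (coliftC x y) \<and> mval (cokC x) \<cdot> mval (coliftC x y) = mval y"
proof -
  obtain m n f where x: "x = Mcode (Some m) (Some n) (Some f)" "f \<in> hom_codes A P m n" using assms mo_def by blast
  obtain k i where k: "k\<in>obj_codes P" "i\<in>hom_codes A P n k" "returns a_cok [m, n, f] [k, i]"
      "is_cokernel A (obj P m) (obj P n) (mor P f) (obj P k) (mor P i)"
    and u: "\<forall>l. \<forall>t\<in>hom_codes A P n l. mor P f \<cdot> mor P t = Zero A (obj P m) (obj P l) \<longrightarrow>
      (\<exists>u\<in>hom_codes A P k l. returns a_colift [m, n, f, l, t] [u] \<and> mor P i \<cdot> mor P u = mor P t)"
    using cok[OF x(2)] by blast
  have [simp]: "cokC (Mcode (Some m) (Some n) (Some f)) = Mcode (Some n) (Some k) (Some i)"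
    using call_returns[OF k(3), of _ 0] call_returns[OF k(3), of _ 1] by (simp add: cokC_def)
  show "mo (cokC x)" "is_cokernel A (oval (csrc x)) (oval (ctgt x)) (mval x) (oval (ctgt (cokC x))) (mval (cokC x))"
    using k x by (auto simp: mo_def mval_def oval_def)
  fix y assume y0: "mo y" "csrc y = ctgt x" "mval x \<cdot> mval y = Zero A (oval (csrc x)) (oval (ctgt y))"
  then obtain l g where y: "y = Mcode (Some n) (Some l) (Some g)" "g \<in> hom_codes A P n l" using x mo_def by auto
  obtain v where v: "v \<in> hom_codes A P k l" "returns a_colift [m, n, f, l, g] [v]" "mor P i \<cdot> mor P v = mor P g"
    using u y(2) y0(3) x(1) y(1) by (auto simp: mval_def oval_def)
  have "ccode (coliftC x y) = Some v" using call_returns[OF v(2), of _ 0] x y by (simp add: coliftC_def)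
  then show "mo (coliftC x y) \<and> mval (cokC x) \<cdot> mval (coliftC x y) = mval y"
    using x(1) y(1) v by (auto simp: coliftC_def mo_def mval_def)
qed

section \<open>Tests, pullbacks and pushouts on codes\<close>

definition thickC :: "code \<Rightarrow> code" where "thickC m = call a_thick 0 [m]"

definition eqC :: "mcode \<Rightarrow> mcode \<Rightarrow> code" where
  "eqC x y = call a_eq 0 [csrc x, ctgt x, ccode x, ccode y]"

text \<open>The object tested is the image of \<open>x\<close>.\<close>

definition smallC :: "mcode \<Rightarrow> code" where "smallC x = thickC (csrc (kerC (cokC x)))"

text \<open>Equality of morphisms is decidable in \<open>A\<close>, so a vanishing kernel is
  recognised by comparing its inclusion with a zero morphism.\<close>

definition monoC :: "mcode \<Rightarrow> code" where "monoC x = eqC (kerC x) (zeroC (csrc (kerC x)) (csrc x))"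

definition epiC :: "mcode \<Rightarrow> code" where "epiC x = eqC (cokC x) (zeroC (ctgt x) (ctgt (cokC x)))"

definition pbC :: "mcode \<Rightarrow> mcode \<Rightarrow> mcode" where
  "pbC x y = kerC (subC (compC (fstC (csrc x) (csrc y)) x) (compC (sndC (csrc x) (csrc y)) y))"

definition pb1 :: "mcode \<Rightarrow> mcode \<Rightarrow> mcode" where "pb1 x y = compC (pbC x y) (fstC (csrc x) (csrc y))"

definition pb2 :: "mcode \<Rightarrow> mcode \<Rightarrow> mcode" where "pb2 x y = compC (pbC x y) (sndC (csrc x) (csrc y))"

text \<open>The product algorithm supplies projections and pairing; pushouts need the injections of
  the biproduct as well, obtained by pairing.\<close>

definition inlC :: "code \<Rightarrow> code \<Rightarrow> mcode" where "inlC m n = pairC (idC m) (zeroC m n)"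

definition inrC :: "code \<Rightarrow> code \<Rightarrow> mcode" where "inrC m n = pairC (zeroC n m) (idC n)"

definition poC :: "mcode \<Rightarrow> mcode \<Rightarrow> mcode" where
  "poC x y = cokC (subC (compC x (inlC (ctgt x) (ctgt y))) (compC y (inrC (ctgt x) (ctgt y))))"

definition po1 :: "mcode \<Rightarrow> mcode \<Rightarrow> mcode" where "po1 x y = compC (inlC (ctgt x) (ctgt y)) (poC x y)"

definition po2 :: "mcode \<Rightarrow> mcode \<Rightarrow> mcode" where "po2 x y = compC (inrC (ctgt x) (ctgt y)) (poC x y)"

lemma pr_thickC: "partial_recursive m \<Longrightarrow> partial_recursive (\<lambda>e. thickC (m e))"
  unfolding thickC_def by (intro pr_intros pr_algs)

lemma pr_eqC: "prm x \<Longrightarrow> prm y \<Longrightarrow> partial_recursive (\<lambda>e. eqC (x e) (y e))"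
  unfolding eqC_def by (intro pr_intros pr_algs prm_code)

lemma pr_tests:
  "prm x \<Longrightarrow> partial_recursive (\<lambda>e. smallC (x e))" "prm x \<Longrightarrow> partial_recursive (\<lambda>e. monoC (x e))"
  "prm x \<Longrightarrow> partial_recursive (\<lambda>e. epiC (x e))"
  unfolding smallC_def monoC_def epiC_def
  by (intro pr_thickC pr_eqC prm_code pr_ops; assumption)+

lemma prm_pullback:
  "prm x \<Longrightarrow> prm y \<Longrightarrow> prm (\<lambda>e. pb1 (x e) (y e))" "prm x \<Longrightarrow> prm y \<Longrightarrow> prm (\<lambda>e. pb2 (x e) (y e))"
  "prm x \<Longrightarrow> prm y \<Longrightarrow> prm (\<lambda>e. po1 (x e) (y e))" "prm x \<Longrightarrow> prm y \<Longrightarrow> prm (\<lambda>e. po2 (x e) (y e))"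
  unfolding pb1_def pb2_def pbC_def po1_def po2_def poC_def inlC_def inrC_def
  by (intro prm_code pr_ops; assumption)+

lemma thickC: assumes "ob m" shows "thickC m = Some (of_bool (oval m \<in> C))"
proof -
  obtain k where k: "k \<in> obj_codes P" "m = Some k" using assms ob_def by blast
  show ?thesis using call_returns[OF thickd[OF k(1)], of "[m]" 0] k(2) by (simp add: thickC_def oval_def)
qed

lemma eqC:
  assumes "mo x" "mo y" "csrc x = csrc y" "ctgt x = ctgt y" shows "eqC x y = Some (of_bool (mval x = mval y))"
proof -
  obtain m n f where x: "x = Mcode (Some m) (Some n) (Some f)" "f \<in> hom_codes A P m n" using assms(1) mo_def by blast
  obtain g where y: "y = Mcode (Some m) (Some n) (Some g)" "g \<in> hom_codes A P m n" using assms(2-4) x mo_def by auto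
  show ?thesis using call_returns[OF eq[OF x(2) y(2)], of _ 0] x y by (simp add: eqC_def mval_def)
qed

lemma smallC: assumes [simp]: "mo x" shows "smallC x = Some (of_bool (small (mval x)))"
proof -
  note c = cokC[of x] kerC[of "cokC x"]
  have [simp]: "mo (cokC x)" "mo (kerC (cokC x))" using c by simp_all
  have k: "is_kernel A (oval (ctgt x)) (oval (ctgt (cokC x))) (mval (cokC x)) (oval (csrc (kerC (cokC x)))) (mval (kerC (cokC x)))"
    using c(5) by simp
  note [simp] = is_cokernelD(7)[OF c(2)]
  obtain e where e: "arr e" "src e = oval (csrc x)" "tgt e = oval (csrc (kerC (cokC x)))" "e \<cdot> mval (kerC (cokC x)) = mval x"
    by (rule kernel_lift[OF k, of "mval x"]) simp_all
  have ee: "is_epi A (oval (csrc x)) (oval (csrc (kerC (cokC x)))) e"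
    by (rule image_epi[OF _ _ c(2) k e]) simp_all
  have "small (mval x) \<longleftrightarrow> oval (csrc (kerC (cokC x))) \<in> C"
    using small_image[OF ee is_kernelD(8)[OF k]] smallI[of e "mval (kerC (cokC x))"] e by auto
  then show ?thesis by (simp add: smallC_def thickC)
qed

lemma monoC: assumes [simp]: "mo x"
  shows "monoC x = Some (of_bool (is_mono A (oval (csrc x)) (oval (ctgt x)) (mval x)))"
proof -
  note k = kerC[of x, simplified]
  note [simp] = k(1) is_kernelD(7)[OF k(2)]
  have "is_mono A (oval (csrc x)) (oval (ctgt x)) (mval x) \<longleftrightarrow>
    mval (kerC x) = Zero A (oval (csrc (kerC x))) (oval (csrc x))"
  proof
    assume "is_mono A (oval (csrc x)) (oval (ctgt x)) (mval x)"
    from mono_zero[OF this, of "mval (kerC x)"]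
    show "mval (kerC x) = Zero A (oval (csrc (kerC x))) (oval (csrc x))" by simp
  next
    assume z: "mval (kerC x) = Zero A (oval (csrc (kerC x))) (oval (csrc x))"
    show "is_mono A (oval (csrc x)) (oval (ctgt x)) (mval x)"
      unfolding is_mono_iff
    proof (intro conjI allI impI)
      fix y assume y: "arr y" "tgt y = oval (csrc x)" "y \<cdot> mval x = Zero A (src y) (oval (ctgt x))"
      then obtain u where u: "arr u" "src u = src y" "tgt u = oval (csrc (kerC x))" "u \<cdot> mval (kerC x) = y"
        using kernel_lift[OF k(2)] by blast
      then show "y = Zero A (src y) (oval (csrc x))" unfolding z by simp
    qed simp_all
  qed
  then show ?thesis by (simp add: monoC_def eqC)
qed

lemma epiC: assumes [simp]: "mo x"
  shows "epiC x = Some (of_bool (is_epi A (oval (csrc x)) (oval (ctgt x)) (mval x)))"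
proof -
  note k = cokC[of x, simplified]
  note [simp] = k(1) is_cokernelD(7)[OF k(2)]
  have "is_epi A (oval (csrc x)) (oval (ctgt x)) (mval x) \<longleftrightarrow>
    mval (cokC x) = Zero A (oval (ctgt x)) (oval (ctgt (cokC x)))"
  proof
    assume "is_epi A (oval (csrc x)) (oval (ctgt x)) (mval x)"
    from epi_zero[OF this, of "mval (cokC x)"]
    show "mval (cokC x) = Zero A (oval (ctgt x)) (oval (ctgt (cokC x)))" by simp
  next
    assume z: "mval (cokC x) = Zero A (oval (ctgt x)) (oval (ctgt (cokC x)))"
    show "is_epi A (oval (csrc x)) (oval (ctgt x)) (mval x)"
      unfolding is_epi_iff
    proof (intro conjI allI impI)
      fix y assume y: "arr y" "src y = oval (ctgt x)" "mval x \<cdot> y = Zero A (oval (csrc x)) (tgt y)"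
      then obtain u where u: "arr u" "tgt u = tgt y" "src u = oval (ctgt (cokC x))" "mval (cokC x) \<cdot> u = y"
        using cokernel_colift[OF k(2)] by blast
      then show "y = Zero A (oval (ctgt x)) (tgt y)" unfolding z by simp
    qed simp_all
  qed
  then show ?thesis by (simp add: epiC_def eqC)
qed

lemma pb_src_tgt [simp]:
  "csrc (pb2 x y) = csrc (pb1 x y)" "ctgt (pb1 x y) = csrc x" "ctgt (pb2 x y) = csrc y"
  "ctgt (po2 x y) = ctgt (po1 x y)" "csrc (po1 x y) = ctgt x" "csrc (po2 x y) = ctgt y"
  by (simp_all add: pb1_def pb2_def po1_def po2_def inlC_def inrC_def)

lemma pb:
  assumes [simp]: "mo x" "mo y" "ctgt x = ctgt y"
  shows "mo (pb1 x y)" "mo (pb2 x y)" "mval (pb1 x y) \<cdot> mval x = mval (pb2 x y) \<cdot> mval y"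
    "sig (mval y) \<Longrightarrow> sig (mval (pb1 x y))"
proof -
  note p = prodC[of "csrc x" "csrc y", simplified]
  note [simp] = p(1-3)
  let ?d = "subC (compC (fstC (csrc x) (csrc y)) x) (compC (sndC (csrc x) (csrc y)) y)"
  note k = kerC[of ?d, simplified, folded pbC_def]
  note [simp] = k(1)
  have s: "arr (mval y)" "src (mval y) = oval (csrc y)" "tgt (mval y) = oval (ctgt y)"
    "arr (mval x)" "src (mval x) = oval (csrc x)" "tgt (mval x) = oval (ctgt y)" by simp_all
  have c: "ctgt (pbC x y) = prodC (csrc x) (csrc y)" by (simp add: pbC_def)
  show "mo (pb1 x y)" "mo (pb2 x y)" unfolding pb1_def pb2_def by (simp_all add: c)
  show "mval (pb1 x y) \<cdot> mval x = mval (pb2 x y) \<cdot> mval y"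
    using pullback_commutes[OF p(4) s k(2)] by (simp add: pb1_def pb2_def c)
  show "sig (mval y) \<Longrightarrow> sig (mval (pb1 x y))"
    using pullback_sig[OF p(4) s k(2)] by (simp add: pb1_def c)
qed

lemma po:
  assumes [simp]: "mo x" "mo y" "csrc x = csrc y"
  shows "mo (po1 x y)" "mo (po2 x y)" "mval x \<cdot> mval (po1 x y) = mval y \<cdot> mval (po2 x y)"
    "sig (mval y) \<Longrightarrow> sig (mval (po1 x y))"
proof -
  let ?m = "ctgt x" and ?n = "ctgt y"
  note p = prodC[of ?m ?n, simplified]
  note [simp] = p(1-3)
  have l: "mo (inlC ?m ?n)" "mval (inlC ?m ?n) \<cdot> mval (fstC ?m ?n) = Ident A (oval ?m)"
    "mval (inlC ?m ?n) \<cdot> mval (sndC ?m ?n) = Zero A (oval ?m) (oval ?n)"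
    using p(5)[of "idC ?m" "zeroC ?m ?n"] by (simp_all add: inlC_def)
  have r: "mo (inrC ?m ?n)" "mval (inrC ?m ?n) \<cdot> mval (fstC ?m ?n) = Zero A (oval ?n) (oval ?m)"
    "mval (inrC ?m ?n) \<cdot> mval (sndC ?m ?n) = Ident A (oval ?n)"
    using p(5)[of "zeroC ?n ?m" "idC ?n"] by (simp_all add: inrC_def)
  have [simp]: "csrc (inlC ?m ?n) = ?m" "ctgt (inlC ?m ?n) = prodC ?m ?n"
    "csrc (inrC ?m ?n) = ?n" "ctgt (inrC ?m ?n) = prodC ?m ?n" by (simp_all add: inlC_def inrC_def)
  note [simp] = l(1) r(1)
  \<comment> \<open>The computed product of \<open>A\<close> doubles as the coproduct on which the
    pushout is built.\<close>
  have cp: "is_product (opc A) (oval ?m) (oval ?n) (oval (prodC ?m ?n)) (mval (inlC ?m ?n)) (mval (inrC ?m ?n))"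
    by (rule is_product_opc[OF p(4)]) (simp_all add: l r)
  let ?d = "subC (compC x (inlC ?m ?n)) (compC y (inrC ?m ?n))"
  note k = cokC[of ?d, simplified, folded poC_def]
  note [simp] = k(1)
  have c: "csrc (poC x y) = prodC ?m ?n" by (simp add: poC_def)
  show "mo (po1 x y)" "mo (po2 x y)" unfolding po1_def po2_def by (simp_all add: c)
  have s: "arr (mval y)" "tgt (mval y) = oval ?n" "src (mval y) = oval (csrc y)"
    "arr (mval x)" "tgt (mval x) = oval ?m" "src (mval x) = oval (csrc y)" by simp_all
  show "sig (mval y) \<Longrightarrow> sig (mval (po1 x y))"
    using pushout_sig(1)[OF cp s k(2)] by (simp add: po1_def c)
  show "mval x \<cdot> mval (po1 x y) = mval y \<cdot> mval (po2 x y)"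
    using pushout_commutes[OF cp s k(2)] by (simp add: po1_def po2_def c)
qed

end

section \<open>Left fractions on codes\<close>

datatype rcode = Rcode (den: mcode) (num: mcode)

definition prr :: "(nat \<Rightarrow> rcode) \<Rightarrow> bool" where
  "prr x \<longleftrightarrow> prm (\<lambda>e. den (x e)) \<and> prm (\<lambda>e. num (x e))"

lemma prr_code: "prr x \<Longrightarrow> prm (\<lambda>e. den (x e))" "prr x \<Longrightarrow> prm (\<lambda>e. num (x e))"
  by (simp_all add: prr_def)

lemma prr_Rcode: "prm x \<Longrightarrow> prm y \<Longrightarrow> prr (\<lambda>e. Rcode (x e) (y e))"
  by (simp add: prr_def)

context serre_codes
begin

definition rv :: "rcode \<Rightarrow> code \<Rightarrow> code \<Rightarrow> bool" where
  "rv x m n \<longleftrightarrow> mo (den x) \<and> mo (num x) \<and> csrc (num x) = csrc (den x) \<and> sig (mval (den x)) \<and>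
    ctgt (den x) = m \<and> ctgt (num x) = n"

definition cls :: "rcode \<Rightarrow> ('m \<times> 'm \<times> 'm) set" where "cls x = rc (mval (den x)) (mval (num x))"

lemma rvD:
  assumes "rv x m n"
  shows "mo (den x)" "mo (num x)" "csrc (num x) = csrc (den x)" "sig (mval (den x))" "ctgt (den x) = m"
    "ctgt (num x) = n" "ob m" "ob n"
  using assms mo_simps(2) by (auto simp: rv_def)

lemma rv_roof: "rv x m n \<Longrightarrow> roof (oval m) (oval n) (mval (den x)) (mval (num x))"
  by (auto simp: rv_def roof_def)

text \<open>The Ore square for \<open>num x\<close> and \<open>den y\<close> is the computed
  pullback, whose first leg lies in \<open>sig\<close>.\<close>

definition rcomp :: "rcode \<Rightarrow> rcode \<Rightarrow> rcode" where
  "rcomp x y = Rcode (compC (pb1 (num x) (den y)) (den x)) (compC (pb2 (num x) (den y)) (num y))"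

definition radd :: "rcode \<Rightarrow> rcode \<Rightarrow> rcode" where
  "radd x y = Rcode (compC (pb1 (den x) (den y)) (den x))
    (addC (compC (pb1 (den x) (den y)) (num x)) (compC (pb2 (den x) (den y)) (num y)))"

definition rsub :: "rcode \<Rightarrow> rcode \<Rightarrow> rcode" where
  "rsub x y = Rcode (compC (pb1 (den x) (den y)) (den x))
    (subC (compC (pb1 (den x) (den y)) (num x)) (compC (pb2 (den x) (den y)) (num y)))"

definition rpair :: "rcode \<Rightarrow> rcode \<Rightarrow> rcode" where
  "rpair x y = Rcode (compC (pb1 (den x) (den y)) (den x))
    (pairC (compC (pb1 (den x) (den y)) (num x)) (compC (pb2 (den x) (den y)) (num y)))"

definition rloc :: "mcode \<Rightarrow> rcode" where "rloc x = Rcode (idC (csrc x)) x"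

text \<open>For \<open>x\<close> in \<open>sig\<close> this is the inverse of \<open>rloc x\<close>
  in the quotient.\<close>

definition rinv :: "mcode \<Rightarrow> rcode" where "rinv x = Rcode x (idC (csrc x))"

lemma prr_ops:
  "prr x \<Longrightarrow> prr y \<Longrightarrow> prr (\<lambda>e. rcomp (x e) (y e))" "prr x \<Longrightarrow> prr y \<Longrightarrow> prr (\<lambda>e. radd (x e) (y e))"
  "prr x \<Longrightarrow> prr y \<Longrightarrow> prr (\<lambda>e. rsub (x e) (y e))" "prr x \<Longrightarrow> prr y \<Longrightarrow> prr (\<lambda>e. rpair (x e) (y e))"
  "prm z \<Longrightarrow> prr (\<lambda>e. rloc (z e))" "prm z \<Longrightarrow> prr (\<lambda>e. rinv (z e))"
  unfolding rcomp_def radd_def rsub_def rpair_def rloc_def rinv_def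
  by (intro prr_Rcode prr_code pr_ops prm_pullback prm_code; assumption)+

lemma rcomp:
  assumes x: "rv x l m" and y: "rv y m n"
  shows "rv (rcomp x y) l n" "cls (rcomp x y) = cls x \<odot> cls y"
proof -
  note [simp] = rvD[OF x] rvD[OF y]
  note p = pb[of "num x" "den y", simplified]
  note [simp] = p
  show "rv (rcomp x y) l n" by (simp add: rv_def rcomp_def sig_comp)
  show "cls (rcomp x y) = cls x \<odot> cls y"
    unfolding cls_def
    by (subst comp_rc(2)[OF rv_roof[OF x] rv_roof[OF y], of "mval (pb1 (num x) (den y))" "mval (pb2 (num x) (den y))"])
      (simp_all add: rcomp_def sig_comp)
qed

text \<open>The pullback of the two denominators gives a common one. Its two expressions, through
  \<open>den x\<close> and through \<open>den y\<close>, have equal values, so both fractions are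
  written with the first.\<close>

lemma rcommon:
  assumes x: "rv x m n" and y: "rv y m n'"
  defines "p \<equiv> pb1 (den x) (den y)" and "q \<equiv> pb2 (den x) (den y)"
  shows "rv (Rcode (compC p (den x)) (compC p (num x))) m n"
    "rv (Rcode (compC p (den x)) (compC q (num y))) m n'"
    "cls x = rc (mval (compC p (den x))) (mval (compC p (num x)))"
    "cls y = rc (mval (compC p (den x))) (mval (compC q (num y)))"
proof -
  note [simp] = rvD[OF x] rvD[OF y]
  note p = pb[of "den x" "den y", simplified, folded p_def q_def]
  note [simp] = p(1,2,4)
  have [simp]: "csrc q = csrc p" "ctgt p = csrc (den x)" "ctgt q = csrc (den y)" by (simp_all add: p_def q_def)
  have s: "sig (mval p \<cdot> mval (den x))" by (simp add: sig_comp)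
  have s': "sig (mval q \<cdot> mval (den y))" using s unfolding p(3) .
  show "rv (Rcode (compC p (den x)) (compC p (num x))) m n"
    "rv (Rcode (compC p (den x)) (compC q (num y))) m n'" using s by (simp_all add: rv_def)
  show "cls x = rc (mval (compC p (den x))) (mval (compC p (num x)))"
    using rc_expand(2)[OF rv_roof[OF x] _ _ s] by (simp add: cls_def)
  show "cls y = rc (mval (compC p (den x))) (mval (compC q (num y)))"
    using rc_expand(2)[OF rv_roof[OF y] _ _ s'] by (simp add: cls_def p(3))
qed

lemma radd:
  assumes x: "rv x m n" and y: "rv y m n"
  shows "rv (radd x y) m n" "cls (radd x y) = serre_add A C (oval m) (oval n) (cls x) (cls y)"
proof -
  note c = rcommon[OF x y]
  note [simp] = rvD[OF c(1), simplified] rvD[OF c(2), simplified]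
  show "rv (radd x y) m n" by (simp add: rv_def radd_def)
  show "cls (radd x y) = serre_add A C (oval m) (oval n) (cls x) (cls y)"
    using add_rc(2)[OF rv_roof[OF c(1)], simplified, OF rv_roof[OF c(2), simplified]]
    unfolding c(3,4) by (simp add: radd_def cls_def)
qed

lemma rsub:
  assumes x: "rv x m n" and y: "rv y m n"
  shows "rv (rsub x y) m n" "cls (rsub x y) = Minus Q (oval m) (oval n) (cls x) (cls y)"
proof -
  note c = rcommon[OF x y]
  note [simp] = rvD[OF c(1), simplified] rvD[OF c(2), simplified]
  show "rv (rsub x y) m n" by (simp add: rv_def rsub_def)
  show "cls (rsub x y) = Minus Q (oval m) (oval n) (cls x) (cls y)"
    using Minus_rc(2)[OF rv_roof[OF c(1)], simplified, OF rv_roof[OF c(2), simplified]]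
    unfolding c(3,4) by (simp add: rsub_def cls_def)
qed

lemma rloc: "mo x \<Longrightarrow> rv (rloc x) (csrc x) (ctgt x)" "mo x \<Longrightarrow> cls (rloc x) = rc (Ident A (oval (csrc x))) (mval x)"
  by (simp_all add: rv_def rloc_def cls_def sig_id)

lemma rinv:
  "mo x \<Longrightarrow> sig (mval x) \<Longrightarrow> rv (rinv x) (ctgt x) (csrc x)"
  "mo x \<Longrightarrow> cls (rinv x) = rc (mval x) (Ident A (oval (csrc x)))"
  by (simp_all add: rv_def rinv_def cls_def)

lemma rpair:
  assumes x: "rv x k m" and y: "rv y k n"
  shows "rv (rpair x y) k (prodC m n)" "cls (rpair x y) \<odot> cls (rloc (fstC m n)) = cls x"
    "cls (rpair x y) \<odot> cls (rloc (sndC m n)) = cls y"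
proof -
  note c = rcommon[OF x y]
  note [simp] = rvD[OF c(1), simplified] rvD[OF c(2), simplified]
  note [simp] = rvD[OF x] rvD[OF y]
  note p = prodC[of m n, simplified]
  note [simp] = p(1-3)
  let ?p = "pb1 (den x) (den y)" and ?q = "pb2 (den x) (den y)"
  let ?u = "pairC (compC ?p (num x)) (compC ?q (num y))"
  have u: "mo ?u" "mval ?u \<cdot> mval (fstC m n) = mval (compC ?p (num x))" "mval ?u \<cdot> mval (sndC m n) = mval (compC ?q (num y))"
    using p(5)[of "compC ?p (num x)" "compC ?q (num y)"] by simp_all
  note [simp] = u(1)
  show v: "rv (rpair x y) k (prodC m n)" by (simp add: rv_def rpair_def)
  note R = rv_roof[OF v]
  show "cls (rpair x y) \<odot> cls (rloc (fstC m n)) = cls x" "cls (rpair x y) \<odot> cls (rloc (sndC m n)) = cls y"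
    using comp_loc[OF R, of "mval (fstC m n)"] comp_loc[OF R, of "mval (sndC m n)"] u(2,3)
    unfolding c(3,4) by (simp_all add: cls_def rloc(2)[unfolded cls_def] rpair_def)
qed

end

context thick_subcategory
begin

lemma serre_class_hom: "t \<in> serre_reps A C K N \<Longrightarrow> serre_class A C t \<in> Hom Q K N"
  by (simp add: serre_quotient_def quotientI)

text \<open>For the mono lift: the cokernel given as input need not be the computed one. Each
  \<open>W\<close> with vanishing \<open>X \<odot> W\<close> factors through the given
  \<open>Y\<close>, so the vanishing condition passes to the computed cokernel.\<close>

lemma cokernel_annihilates:
  assumes c: "is_cokernel Q K N X E Y" and Z: "Z \<in> Hom Q T N" "Z \<odot> Y = Zero Q T E"
    and W: "W \<in> Hom Q N D" "X \<odot> W = Zero Q K D"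
  shows "Z \<odot> W = Zero Q T D"
proof -
  obtain U where U: "U \<in> Hom Q E D" "Y \<odot> U = W"
    using c W unfolding is_cokernel_def Q_simps by blast
  have Y: "Y \<in> Hom Q N E" using c unfolding is_cokernel_def by simp
  have "T \<in> Ob A" using Z(1) roofD(7) by (auto elim: Q_HomE)
  then show ?thesis using Q_assoc[OF Z(1) Y U(1)] U(2) Z(2) Q_zero_comp[OF U(1), of T] by simp
qed

lemma kernel_annihilates:
  assumes c: "is_kernel Q N K X E Y" and Z: "Z \<in> Hom Q N T" "Y \<odot> Z = Zero Q E T"
    and W: "W \<in> Hom Q D N" "W \<odot> X = Zero Q D K"
  shows "W \<odot> Z = Zero Q D T"
proof -
  obtain U where U: "U \<in> Hom Q D E" "U \<odot> Y = W"
    using c W unfolding is_kernel_def Q_simps by blast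
  have Y: "Y \<in> Hom Q E N" using c unfolding is_kernel_def by simp
  have "T \<in> Ob A" using Z(1) roofD(8) by (auto elim: Q_HomE)
  then show ?thesis using Q_assoc[OF U(1) Y Z(1)] U(2) Z(2) Q_comp_zero[OF U(1), of T] by simp
qed

end

section \<open>Terms for the algorithms of the quotient\<close>

definition nthC :: "nat \<Rightarrow> code \<Rightarrow> code" where "nthC i x = Option.bind x (nth_code i)"

lemma pr_nthC: "partial_recursive x \<Longrightarrow> partial_recursive (\<lambda>e. nthC i (x e))"
  unfolding nthC_def by (rule pr_nth)

lemma nthC: "i < length xs \<Longrightarrow> nthC i (Some (list_encode xs)) = Some (xs ! i)"
  by (simp add: nthC_def nth_code_encode)

text \<open>Input components are given as a function of their position and output components as a
  list of terms, so that computability of \<open>alg F\<close> reduces to that of the terms.\<close>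

definition alg :: "((nat \<Rightarrow> code) \<Rightarrow> code list) \<Rightarrow> nat \<Rightarrow> nat option" where
  "alg F = (\<lambda>e. opt_list (F (\<lambda>i. nth_code i e)))"

lemma returns_alg:
  "(\<And>a. (\<And>i. i < length ns \<Longrightarrow> a i = Some (ns ! i)) \<Longrightarrow> F a = map Some ys) \<Longrightarrow> returns (alg F) ns ys"
  by (simp add: returns_def alg_def nth_code_encode opt_list_Some)

context serre_codes
begin

abbreviation PS :: "('o, ('m \<times> 'm \<times> 'm) set) presentation" where "PS \<equiv> serre_presentation A C P"

text \<open>The image of the denominator is formed as a coimage, the cokernel of the kernel
  \<open>k\<close>: the mono \<open>i\<close> and the middle morphism \<open>g\<close> are then both
  colifts along the same cokernel.\<close>

definition tri :: "rcode \<Rightarrow> code" where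
  "tri x = (let k = kerC (den x); i = coliftC k (den x); p = cokC (compC k (num x));
      g = coliftC k (compC (num x) p)
    in opt_list [csrc i, ctgt p, ccode i, ccode g, ccode p])"

text \<open>A coded triple lists at positions 0 to 4 the objects \<open>M'\<close> and
  \<open>N/N'\<close>, the mono, the middle morphism and the epi. Its outer ends are not stored and
  come from the input.\<close>

definition denC :: "code \<Rightarrow> code \<Rightarrow> mcode" where "denC m x = Mcode (nthC 0 x) m (nthC 2 x)"

definition midC :: "code \<Rightarrow> mcode" where "midC x = Mcode (nthC 0 x) (nthC 1 x) (nthC 3 x)"

definition quoC :: "code \<Rightarrow> code \<Rightarrow> mcode" where "quoC n x = Mcode n (nthC 1 x) (nthC 4 x)"

definition roofC :: "code \<Rightarrow> code \<Rightarrow> code \<Rightarrow> rcode" where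
  "roofC m n x = Rcode (compC (pb1 (midC x) (quoC n x)) (denC m x)) (pb2 (midC x) (quoC n x))"

definition memC :: "mcode \<Rightarrow> code" where "memC x = call a_mem 0 [csrc x, ctgt x, ccode x]"

text \<open>The three memberships are decided first, since the remaining tests are only guaranteed
  to terminate on valid codes; \<open>guard\<close> keeps them from running otherwise.\<close>

definition homC :: "code \<Rightarrow> code \<Rightarrow> code \<Rightarrow> code" where
  "homC m n x = guard (memC (denC m x)) (guard (memC (midC x)) (guard (memC (quoC n x))
    (guard (monoC (denC m x)) (guard (thickC (ctgt (cokC (denC m x))))
    (guard (epiC (quoC n x)) (thickC (csrc (kerC (quoC n x)))))))))"

text \<open>The local names match the parameters of \<open>Q_kernel_lift\<close>. The definitions
  that follow are related in the same way to \<open>Q_cokernel_colift\<close>,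
  \<open>Q_mono_lift\<close> and \<open>Q_epi_colift\<close>.\<close>

definition rlift :: "rcode \<Rightarrow> rcode \<Rightarrow> rcode" where
  "rlift x y = (let p = pb1 (num y) (den x); q = pb2 (num y) (den x); j = kerC (compC q (num x))
    in Rcode (compC j (compC p (den y))) (liftC (num x) (compC j q)))"

definition rcolift :: "rcode \<Rightarrow> rcode \<Rightarrow> rcode" where
  "rcolift x y = (let w = po1 (num y) (den y); h = po2 (num y) (den y); c = cokC (compC (num x) h)
    in rcomp (rloc (coliftC (num x) (compC h c))) (rinv (compC w c)))"

definition rmono_lift :: "rcode \<Rightarrow> rcode \<Rightarrow> rcode" where
  "rmono_lift x y = (let e = cokC (num x); j = kerC (compC (num y) e)
    in rcomp (Rcode (compC j (den y)) (liftC e (compC j (num y)))) (Rcode (liftC e (num x)) (den x)))"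

definition repi_colift :: "rcode \<Rightarrow> rcode \<Rightarrow> rcode" where
  "repi_colift x y = (let k = kerC (num x); w = po1 (num y) (den y); h = po2 (num y) (den y);
      c = cokC (compC (compC k (den x)) h)
    in rcomp (Rcode (coliftC k (num x)) (coliftC k (compC (den x) (compC h c)))) (rinv (compC w c)))"

lemma pr_tri: "prr x \<Longrightarrow> partial_recursive (\<lambda>e. tri (x e))"
  unfolding tri_def Let_def by (intro pr_list_Nil pr_list_Cons prm_code pr_ops prr_code; assumption)

lemma prm_parts:
  "partial_recursive m \<Longrightarrow> partial_recursive x \<Longrightarrow> prm (\<lambda>e. denC (m e) (x e))"
  "partial_recursive x \<Longrightarrow> prm (\<lambda>e. midC (x e))"
  "partial_recursive m \<Longrightarrow> partial_recursive x \<Longrightarrow> prm (\<lambda>e. quoC (m e) (x e))"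
  unfolding denC_def midC_def quoC_def by (intro prm_Mcode pr_nthC; assumption)+

lemma prr_roofC:
  "partial_recursive m \<Longrightarrow> partial_recursive n \<Longrightarrow> partial_recursive x \<Longrightarrow> prr (\<lambda>e. roofC (m e) (n e) (x e))"
  unfolding roofC_def by (intro prr_Rcode pr_ops prm_pullback prm_parts)

lemma pr_homC:
  "partial_recursive m \<Longrightarrow> partial_recursive n \<Longrightarrow> partial_recursive x \<Longrightarrow>
    partial_recursive (\<lambda>e. homC (m e) (n e) (x e))"
  unfolding homC_def memC_def
  by (intro pr_guard pr_call pr_list_Nil pr_list_Cons pr_algs pr_tests pr_thickC prm_code pr_ops prm_parts)

lemma prr_lifts:
  "prr x \<Longrightarrow> prr y \<Longrightarrow> prr (\<lambda>e. rlift (x e) (y e))" "prr x \<Longrightarrow> prr y \<Longrightarrow> prr (\<lambda>e. rcolift (x e) (y e))"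
  "prr x \<Longrightarrow> prr y \<Longrightarrow> prr (\<lambda>e. rmono_lift (x e) (y e))" "prr x \<Longrightarrow> prr y \<Longrightarrow> prr (\<lambda>e. repi_colift (x e) (y e))"
  unfolding rlift_def rcolift_def rmono_lift_def repi_colift_def Let_def
  by (intro prr_ops prr_Rcode pr_ops prm_pullback prr_code; assumption)+

lemma presentation_simps [simp]:
  "obj_of PS = obj_of P" "obj_codes PS = obj_codes P" "obj PS = obj P"
  by (simp_all add: serre_presentation_def obj_codes_def obj_def fun_eq_iff)

lemma mor_of_PS:
  "mor_of PS (list_encode [m', q, i, f, e]) =
    (if \<exists>m n. i \<in> hom_codes A P m' m \<and> f \<in> hom_codes A P m' q \<and> e \<in> hom_codes A P n q \<and>
        (mor P i, mor P f, mor P e) \<in> serre_reps A C (obj P m) (obj P n)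
     then Some (serre_class A C (mor P i, mor P f, mor P e)) else None)"
  unfolding serre_presentation_def presentation.simps list_encode_inverse list.case ..

lemma dom_mor_of_PS:
  assumes "x \<in> dom (mor_of PS)"
  obtains m' q i f e m n where "x = list_encode [m', q, i, f, e]"
    "i \<in> hom_codes A P m' m" "f \<in> hom_codes A P m' q" "e \<in> hom_codes A P n q"
    "(mor P i, mor P f, mor P e) \<in> serre_reps A C (obj P m) (obj P n)"
proof -
  have "\<exists>m' q i f e. list_decode x = [m', q, i, f, e]"
    using assms unfolding serre_presentation_def by (auto split: list.splits)
  then obtain m' q i f e where "list_decode x = [m', q, i, f, e]" by blast
  then have x: "x = list_encode [m', q, i, f, e]" using list_decode_inverse[of x] by simp
  then show ?thesis using assms that mor_of_PS[of m' q i f e] by (auto split: if_splits)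
qed

text \<open>\<open>mor_of\<close> asks only for some ends, and an object may have several codes. Hom
  sets of the quotient are disjoint, so the class fixes its ends as objects, and the condition
  transfers to the codes \<open>m\<close> and \<open>n\<close> at hand.\<close>

lemma hom_codes_PS:
  "list_encode [m', q, i, f, e] \<in> hom_codes Q PS m n \<longleftrightarrow>
    i \<in> hom_codes A P m' m \<and> f \<in> hom_codes A P m' q \<and> e \<in> hom_codes A P n q \<and>
    (mor P i, mor P f, mor P e) \<in> serre_reps A C (obj P m) (obj P n)" (is "?x \<in> _ \<longleftrightarrow> ?R m n")
  and mor_PS: "list_encode [m', q, i, f, e] \<in> hom_codes Q PS m n \<Longrightarrow>
    mor PS (list_encode [m', q, i, f, e]) = serre_class A C (mor P i, mor P f, mor P e)"
proof -
  interpret Q: abelian_category Q by (rule abelian_category_serre_quotient)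
  have m: "mor PS ?x = serre_class A C (mor P i, mor P f, mor P e)" if "?x \<in> dom (mor_of PS)"
    using that mor_of_PS[of m' q i f e] by (auto simp: mor_def split: if_splits)
  then show "?x \<in> hom_codes Q PS m n \<Longrightarrow> mor PS ?x = serre_class A C (mor P i, mor P f, mor P e)"
    by (simp add: hom_codes_def)
  show "?x \<in> hom_codes Q PS m n \<longleftrightarrow> ?R m n"
  proof
    assume x: "?x \<in> hom_codes Q PS m n"
    then have d: "?x \<in> dom (mor_of PS)" and mn: "m \<in> obj_codes P" "n \<in> obj_codes P"
      and h: "mor PS ?x \<in> Hom Q (obj P m) (obj P n)" unfolding hom_codes_def by simp_all
    from d obtain k l where kl: "?R k l" using mor_of_PS[of m' q i f e] by (auto split: if_splits)
    then have "(mor P i, mor P f, mor P e) \<in> serre_reps A C (obj P k) (obj P l)" by blast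
    then have "obj P m = obj P k \<and> obj P n = obj P l"
      using Q.hom_disjoint[OF h[unfolded m[OF d]] serre_class_hom] by blast
    then show "?R m n" using kl mn by (simp add: hom_codes_def)
  next
    assume R: "?R m n"
    then have "\<exists>m n. ?R m n" by blast
    then have "mor_of PS ?x = Some (serre_class A C (mor P i, mor P f, mor P e))"
      unfolding mor_of_PS by (rule if_P)
    then have d: "?x \<in> dom (mor_of PS)" by blast
    have "mor PS ?x \<in> Hom Q (obj P m) (obj P n)" unfolding m[OF d] using R serre_class_hom by blast
    then show "?x \<in> hom_codes Q PS m n" using d R unfolding hom_codes_def by simp
  qed
qed

lemma oval_Some [simp]: "oval (Some m) = obj P m"
  by (simp add: oval_def)

lemma mo_Mcode [simp]: "mo (Mcode (Some m) (Some n) (Some f)) \<longleftrightarrow> f \<in> hom_codes A P m n"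
  "mval (Mcode a b (Some f)) = mor P f"
  by (auto simp: mo_def mval_def)

lemma ob_Some [simp]: "ob (Some m) \<longleftrightarrow> m \<in> obj_codes P"
  by (simp add: ob_def)

lemma mo_tgt: "mo x \<Longrightarrow> ctgt x = Some n \<Longrightarrow> \<exists>m f. x = Mcode (Some m) (Some n) (Some f) \<and> f \<in> hom_codes A P m n"
  and mo_src: "mo x \<Longrightarrow> csrc x = Some m \<Longrightarrow> \<exists>n f. x = Mcode (Some m) (Some n) (Some f) \<and> f \<in> hom_codes A P m n"
  and mo_src_tgt: "mo x \<Longrightarrow> csrc x = Some m \<Longrightarrow> ctgt x = Some n \<Longrightarrow>
    \<exists>f. x = Mcode (Some m) (Some n) (Some f) \<and> f \<in> hom_codes A P m n"
  by (auto simp: mo_def)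

lemma obj_Ob [simp]: "m \<in> obj_codes P \<Longrightarrow> obj P m \<in> Ob A"
  using ob_Ob[of "Some m"] by simp

text \<open>The commuting square of the computed pullback is exactly the compatibility that
  \<open>roof_triple\<close> requires.\<close>

lemma roofC:
  assumes x: "x \<in> hom_codes Q PS m n"
  shows "rv (roofC (Some m) (Some n) (Some x)) (Some m) (Some n)"
    "cls (roofC (Some m) (Some n) (Some x)) = mor PS x"
proof -
  have "x \<in> dom (mor_of PS)" using x by (simp add: hom_codes_def)
  then obtain m' q i f e where e: "x = list_encode [m', q, i, f, e]" by (rule dom_mor_of_PS)
  note h = x[unfolded e hom_codes_PS] and c = mor_PS[OF x[unfolded e]]
  have parts: "denC (Some m) (Some x) = Mcode (Some m') (Some m) (Some i)"
    "midC (Some x) = Mcode (Some m') (Some q) (Some f)"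
    "quoC (Some n) (Some x) = Mcode (Some n) (Some q) (Some e)"
    unfolding denC_def midC_def quoC_def e by (simp_all add: nthC del: list_encode.simps)
  have [simp]: "i \<in> hom_codes A P m' m" "f \<in> hom_codes A P m' q" "e \<in> hom_codes A P n q"
    "(mor P i, mor P f, mor P e) \<in> serre_reps A C (obj P m) (obj P n)" using h by simp_all
  have [simp]: "sig (mor P i)" "sig (mor P e)"
    using fractionD(1,7)[OF serre_reps_fraction] h by blast+
  define u where "u = pb1 (Mcode (Some m') (Some q) (Some f)) (Mcode (Some n) (Some q) (Some e))"
  define v where "v = pb2 (Mcode (Some m') (Some q) (Some f)) (Mcode (Some n) (Some q) (Some e))"
  have uv: "mo u" "mo v" "mval u \<cdot> mor P f = mval v \<cdot> mor P e" "sig (mval u)"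
    "ctgt u = Some m'" "ctgt v = Some n" "csrc v = csrc u"
    using pb[of "Mcode (Some m') (Some q) (Some f)" "Mcode (Some n) (Some q) (Some e)"]
    by (simp_all add: u_def v_def)
  have i: "arr (mor P i)" "src (mor P i) = obj P m'" "tgt (mor P i) = obj P m"
    using mo_simps[of "Mcode (Some m') (Some m) (Some i)"] by simp_all
  note [simp] = uv i
  have r: "roofC (Some m) (Some n) (Some x) = Rcode (compC u (Mcode (Some m') (Some m) (Some i))) v"
    unfolding roofC_def parts u_def v_def ..
  show R: "rv (roofC (Some m) (Some n) (Some x)) (Some m) (Some n)"
    unfolding r by (simp add: rv_def sig_comp)
  note R' = rv_roof[OF R]
  have "teq (mval (den (roofC (Some m) (Some n) (Some x)))) (mval (num (roofC (Some m) (Some n) (Some x))))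
    (Ident A (obj P n)) (mor P i) (mor P f) (mor P e)"
    by (rule roof_triple[of "obj P m" "obj P n" _ _ _ _ _ "mval u"]) (use R' in \<open>simp_all add: r\<close>)
  from serre_class_rc[OF _ _ this, of "obj P m"]
  show "cls (roofC (Some m) (Some n) (Some x)) = mor PS x"
    unfolding e c cls_def using R' unfolding e by simp
qed

lemma tri:
  assumes x: "rv x (Some m) (Some n)"
  shows "\<exists>h\<in>hom_codes Q PS m n. tri x = Some h \<and> mor PS h = cls x"
proof -
  note [simp] = rvD[OF x] rvD(7,8)[OF x, simplified]
  define k where "k = kerC (den x)"
  define i where "i = coliftC k (den x)"
  define p where "p = cokC (compC k (num x))"
  define g where "g = coliftC k (compC (num x) p)"
  have k: "mo k" "is_kernel A (oval (csrc (den x))) (obj P m) (mval (den x)) (oval (csrc k)) (mval k)"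
    "ctgt k = csrc (den x)"
    using kerC[of "den x"] by (simp_all add: k_def)
  note [simp] = k(1,3) is_kernelD(7)[OF k(2)]
  have i: "mo i" "mval (cokC k) \<cdot> mval i = mval (den x)" "csrc i = ctgt (cokC k)" "ctgt i = Some m"
    using cokC(3)[of k "den x"] by (simp_all add: i_def)
  note [simp] = i(1,3,4)
  note d = cokC(1,2)[of k, simplified]
  note [simp] = d(1) is_cokernelD(7)[OF d(2)]
  have p: "mo p" "is_cokernel A (oval (csrc k)) (obj P n) (mval k \<cdot> mval (num x)) (oval (ctgt p)) (mval p)"
    "csrc p = Some n"
    using cokC(1,2)[of "compC k (num x)"] by (simp_all add: p_def)
  note [simp] = p(1,3)
  have kfp: "mval k \<cdot> (mval (num x) \<cdot> mval p) = Zero A (oval (csrc k)) (oval (ctgt p))"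
    using is_cokernelD(7)[OF p(2)] by simp
  have g: "mo g" "mval (cokC k) \<cdot> mval g = mval (num x) \<cdot> mval p" "csrc g = ctgt (cokC k)" "ctgt g = ctgt p"
    using cokC(3)[of k "compC (num x) p"] kfp by (simp_all add: g_def)
  note [simp] = g(1,3,4)
  have mi: "is_mono A (oval (ctgt (cokC k))) (obj P m) (mval i)"
    by (rule image_mono[OF k(2)]) (use d i(2) in simp_all)
  have si: "sig (mval i)"
    by (rule sig_mono_factor[OF mi, of "mval (cokC k)"]) (simp_all add: i(2))
  have "small (mval k)"
    by (rule sig_small_right[of "mval (den x)"]) (simp_all add: small_zero)
  then have "small (mval k \<cdot> mval (num x))" by (rule small_comp_right) simp_all
  then have sp: "sig (mval p)" using sig_cokernel[OF _ p(2)] by blast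
  have ee: "is_epi A (src (mval (den x))) (oval (ctgt (cokC k))) (mval (cokC k))"
    using is_cokernelD(8)[OF d(2)] by simp
  note R = rv_roof[OF x, simplified]
  have t: "(mval i, mval g, mval p) \<in> serre_reps A C (obj P m) (obj P n)"
    "teq (mval (den x)) (mval (num x)) (Ident A (obj P n)) (mval i) (mval g) (mval p)"
    by (rule triple_of_roof[OF R ee mi si i(2) is_cokernelD(8)[OF p(2)] sp]; simp add: g(2))+
  \<comment> \<open>The mathematical content is settled at this point; the valid terms are now
    replaced by explicit numbers so that the triple can be encoded.\<close>
  obtain q i' where i': "i = Mcode (Some q) (Some m) (Some i')" "i' \<in> hom_codes A P q m"
    using mo_tgt[OF i(1,4)] by blast
  obtain r p' where p': "p = Mcode (Some n) (Some r) (Some p')" "p' \<in> hom_codes A P n r"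
    using mo_src[OF p(1,3)] by blast
  have "csrc g = Some q" "ctgt g = Some r" using g(3,4) i(3) i'(1) p'(1) by simp_all
  then obtain g' where g': "g = Mcode (Some q) (Some r) (Some g')" "g' \<in> hom_codes A P q r"
    using mo_src_tgt[OF g(1)] by blast
  have h: "list_encode [q, r, i', g', p'] \<in> hom_codes Q PS m n"
    unfolding hom_codes_PS using i' p' g' t by simp
  have "tri x = Some (list_encode [q, r, i', g', p'])"
    unfolding tri_def Let_def k_def[symmetric] i_def[symmetric] p_def[symmetric] g_def[symmetric]
    using i' p' g' opt_list_Some[of "[q, r, i', g', p']"] by simp
  moreover have "mor PS (list_encode [q, r, i', g', p']) = cls x"
    unfolding mor_PS[OF h] cls_def using serre_class_rc[OF R t] i' p' g' by simp
  ultimately show ?thesis using h by blast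
qed

lemma rlift:
  assumes x: "rv x m n" and y: "rv y l m" and z: "cls y \<odot> cls x = Zero Q (oval l) (oval n)"
  shows "rv (rlift x y) l (csrc (kerC (num x)))"
    "cls (rlift x y) \<odot> rc (Ident A (oval (csrc (kerC (num x))))) (mval (kerC (num x)) \<cdot> mval (den x)) = cls y"
proof -
  note [simp] = rvD[OF x] rvD[OF y]
  define p where "p = pb1 (num y) (den x)"
  define q where "q = pb2 (num y) (den x)"
  have pq: "mo p" "mo q" "mval p \<cdot> mval (num y) = mval q \<cdot> mval (den x)" "sig (mval p)"
    "ctgt p = csrc (den y)" "ctgt q = csrc (den x)" "csrc q = csrc p"
    using pb[of "num y" "den x"] by (simp_all add: p_def q_def)
  note [simp] = pq(1,2,4-7)
  define j where "j = kerC (compC q (num x))"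
  have j: "mo j" "is_kernel A (oval (csrc p)) (oval n) (mval q \<cdot> mval (num x)) (oval (csrc j)) (mval j)" "ctgt j = csrc p"
    using kerC(1,2)[of "compC q (num x)"] by (simp_all add: j_def)
  note [simp] = j(1,3)
  define u where "u = liftC (num x) (compC j q)"
  have u: "mo u" "mval u \<cdot> mval (kerC (num x)) = mval j \<cdot> mval q" "csrc u = csrc j" "ctgt u = csrc (kerC (num x))"
    using kerC(3)[of "num x" "compC j q"] is_kernelD(7)[OF j(2)] by (simp_all add: u_def)
  note [simp] = u(1,3,4)
  have k: "is_kernel A (src (mval (den x))) (oval n) (mval (num x)) (oval (csrc (kerC (num x)))) (mval (kerC (num x)))"
    using kerC(2)[of "num x"] by simp
  have L: "roof (oval l) (oval (csrc (kerC (num x)))) (mval j \<cdot> (mval p \<cdot> mval (den y))) (mval u)"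
    "rc (mval j \<cdot> (mval p \<cdot> mval (den y))) (mval u) \<odot>
      rc (Ident A (oval (csrc (kerC (num x))))) (mval (kerC (num x)) \<cdot> mval (den x)) = rc (mval (den y)) (mval (num y))"
    by (rule Q_kernel_lift[OF rv_roof[OF x] k rv_roof[OF y] z[unfolded cls_def] _ _ _ _ _ _ pq(3), of "oval (csrc j)"];
      simp add: u(2) j(2))+
  have r: "rlift x y = Rcode (compC j (compC p (den y))) u"
    by (simp add: rlift_def Let_def p_def q_def j_def u_def)
  show "rv (rlift x y) l (csrc (kerC (num x)))"
    unfolding r using roofD(1)[OF L(1)] by (simp add: rv_def)
  show "cls (rlift x y) \<odot> rc (Ident A (oval (csrc (kerC (num x))))) (mval (kerC (num x)) \<cdot> mval (den x)) = cls y"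
    unfolding r cls_def using L(2) by simp
qed

text \<open>The pushout of numerator and denominator moves the denominator to the right;
  \<open>w\<close> is the leg opposite to \<open>den y\<close> and inherits \<open>sig\<close> from
  it.\<close>

lemma right_fraction_code:
  assumes y: "rv y n l"
  defines "w \<equiv> po1 (num y) (den y)" and "h \<equiv> po2 (num y) (den y)"
  shows "mo w" "mo h" "csrc w = l" "csrc h = n" "ctgt h = ctgt w" "sig (mval w)"
    "mval (den y) \<cdot> mval h = mval (num y) \<cdot> mval w"
  using po[of "num y" "den y"] rvD[OF y] by (simp_all add: w_def h_def)

lemma rcolift:
  assumes x: "rv x m n" and y: "rv y n l" and z: "cls x \<odot> cls y = Zero Q (oval m) (oval l)"
  shows "rv (rcolift x y) (ctgt (cokC (num x))) l"
    "rc (Ident A (oval n)) (mval (cokC (num x))) \<odot> cls (rcolift x y) = cls y"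
proof -
  note [simp] = rvD[OF x] rvD[OF y]
  define w where "w = po1 (num y) (den y)"
  define h where "h = po2 (num y) (den y)"
  note wh = right_fraction_code[OF y, folded w_def h_def]
  note [simp] = wh(1-6)
  define c where "c = cokC (compC (num x) h)"
  have c: "mo c" "is_cokernel A (oval (csrc (den x))) (oval (ctgt w)) (mval (num x) \<cdot> mval h) (oval (ctgt c)) (mval c)"
    "csrc c = ctgt w"
    using cokC(1,2)[of "compC (num x) h"] by (simp_all add: c_def)
  note [simp] = c(1,3)
  define u where "u = coliftC (num x) (compC h c)"
  have u: "mo u" "mval (cokC (num x)) \<cdot> mval u = mval h \<cdot> mval c" "csrc u = ctgt (cokC (num x))" "ctgt u = ctgt c"
    using cokC(3)[of "num x" "compC h c"] is_cokernelD(7)[OF c(2)] by (simp_all add: u_def)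
  note [simp] = u(1,3,4)
  have e: "is_cokernel A (src (mval (den x))) (oval n) (mval (num x)) (oval (ctgt (cokC (num x)))) (mval (cokC (num x)))"
    using cokC(2)[of "num x"] by simp
  have c': "is_cokernel A (src (mval (den x))) (tgt (mval w)) (mval (num x) \<cdot> mval h) (oval (ctgt c)) (mval c)"
    using c(2) by simp
  have L: "roof (oval (ctgt c)) (oval l) (mval w \<cdot> mval c) (Ident A (oval l))"
    "rc (Ident A (oval n)) (mval (cokC (num x))) \<odot>
      (rc (Ident A (oval (ctgt (cokC (num x))))) (mval u) \<odot> rc (mval w \<cdot> mval c) (Ident A (oval l))) =
      rc (mval (den y)) (mval (num y))"
    by (rule Q_cokernel_colift[OF rv_roof[OF x] e rv_roof[OF y] z[unfolded cls_def] _ _ _ _ _ wh(7) wh(6) c' _ _ _ u(2)]; simp)+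
  have wc: "mo (compC w c)" "sig (mval (compC w c))" using roofD(1)[OF L(1)] by simp_all
  have r: "rcolift x y = rcomp (rloc u) (rinv (compC w c))"
    by (simp add: rcolift_def Let_def w_def h_def c_def u_def)
  have U: "rv (rloc u) (ctgt (cokC (num x))) (ctgt c)" using rloc(1)[of u] by simp
  have W: "rv (rinv (compC w c)) (ctgt c) l" using rinv(1)[OF wc] by simp
  show "rv (rcolift x y) (ctgt (cokC (num x))) l" unfolding r by (rule rcomp(1)[OF U W])
  show "rc (Ident A (oval n)) (mval (cokC (num x))) \<odot> cls (rcolift x y) = cls y"
    unfolding r rcomp(2)[OF U W] rloc(2)[OF u(1)] rinv(2)[OF wc(1)] using L(2) by (simp add: cls_def)
qed

lemma rmono_lift:
  assumes x: "rv x k m" and y: "rv y l m" and mono: "is_mono Q (oval k) (oval m) (cls x)"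
    and z: "cls y \<odot> rc (Ident A (oval m)) (mval (cokC (num x))) = Zero Q (oval l) (oval (ctgt (cokC (num x))))"
  shows "rv (rmono_lift x y) l k" "cls (rmono_lift x y) \<odot> cls x = cls y"
proof -
  note [simp] = rvD[OF x] rvD[OF y]
  define e where "e = cokC (num x)"
  have e: "mo e" "is_cokernel A (src (mval (den x))) (oval m) (mval (num x)) (oval (ctgt e)) (mval e)" "csrc e = m"
    using cokC(1,2)[of "num x"] by (simp_all add: e_def)
  note [simp] = e(1,3)
  have i: "mo (kerC e)" "is_kernel A (oval m) (oval (ctgt e)) (mval e) (oval (csrc (kerC e))) (mval (kerC e))"
    using kerC(1,2)[of e] by simp_all
  note [simp] = i(1)
  define j where "j = kerC (compC (num y) e)"
  have j: "mo j" "is_kernel A (src (mval (den y))) (oval (ctgt e)) (mval (num y) \<cdot> mval e) (oval (csrc j)) (mval j)"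
    "ctgt j = csrc (den y)"
    using kerC(1,2)[of "compC (num y) e"] by (simp_all add: j_def)
  note [simp] = j(1,3)
  define v where "v = liftC e (compC j (num y))"
  have v: "mo v" "mval v \<cdot> mval (kerC e) = mval j \<cdot> mval (num y)" "csrc v = csrc j" "ctgt v = csrc (kerC e)"
    using kerC(3)[of e "compC j (num y)"] is_kernelD(7)[OF j(2)] by (simp_all add: v_def)
  define d where "d = liftC e (num x)"
  have d: "mo d" "mval d \<cdot> mval (kerC e) = mval (num x)" "csrc d = csrc (den x)" "ctgt d = csrc (kerC e)"
    using kerC(3)[of e "num x"] is_cokernelD(7)[OF e(2)] by (simp_all add: d_def)
  note [simp] = v(1,3,4) d(1,3,4)
  have L: "roof (oval l) (oval (csrc (kerC e))) (mval j \<cdot> mval (den y)) (mval v)"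
    "roof (oval (csrc (kerC e))) (oval k) (mval d) (mval (den x))"
    "(rc (mval j \<cdot> mval (den y)) (mval v) \<odot> rc (mval d) (mval (den x))) \<odot> rc (mval (den x)) (mval (num x)) =
      rc (mval (den y)) (mval (num y))"
    by (rule Q_mono_lift[OF rv_roof[OF x] mono[unfolded cls_def] e(2) i(2) _ _ _ d(2) rv_roof[OF y]
          z[folded e_def, unfolded cls_def] j(2) _ _ _ v(2)]; simp)+
  have V: "rv (Rcode (compC j (den y)) v) l (csrc (kerC e))" "rv (Rcode d (den x)) (csrc (kerC e)) k"
    using roofD(1)[OF L(1)] roofD(1)[OF L(2)] by (simp_all add: rv_def)
  have r: "rmono_lift x y = rcomp (Rcode (compC j (den y)) v) (Rcode d (den x))"
    by (simp add: rmono_lift_def Let_def e_def j_def v_def d_def)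
  show "rv (rmono_lift x y) l k" unfolding r by (rule rcomp(1)[OF V])
  show "cls (rmono_lift x y) \<odot> cls x = cls y"
    unfolding r rcomp(2)[OF V] using L(3) by (simp add: cls_def)
qed

lemma repi_colift:
  assumes x: "rv x n m" and y: "rv y n l" and epi: "is_epi Q (oval n) (oval m) (cls x)"
    and z: "rc (Ident A (oval (csrc (kerC (num x))))) (mval (kerC (num x)) \<cdot> mval (den x)) \<odot> cls y =
      Zero Q (oval (csrc (kerC (num x)))) (oval l)"
  shows "rv (repi_colift x y) m l" "cls x \<odot> cls (repi_colift x y) = cls y"
proof -
  note [simp] = rvD[OF x] rvD[OF y]
  define k where "k = kerC (num x)"
  have k: "mo k" "is_kernel A (src (mval (den x))) (oval m) (mval (num x)) (oval (csrc k)) (mval k)"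
    "ctgt k = csrc (den x)"
    using kerC(1,2)[of "num x"] by (simp_all add: k_def)
  note [simp] = k(1,3)
  have d: "mo (cokC k)" "is_cokernel A (oval (csrc k)) (src (mval (den x))) (mval k) (oval (ctgt (cokC k))) (mval (cokC k))"
    using cokC(1,2)[of k] by simp_all
  note [simp] = d(1)
  define w where "w = po1 (num y) (den y)"
  define h where "h = po2 (num y) (den y)"
  note wh = right_fraction_code[OF y, folded w_def h_def]
  note [simp] = wh(1-6)
  define c where "c = cokC (compC (compC k (den x)) h)"
  have c: "mo c" "is_cokernel A (oval (csrc k)) (tgt (mval w)) ((mval k \<cdot> mval (den x)) \<cdot> mval h) (oval (ctgt c)) (mval c)"
    "csrc c = ctgt w"
    using cokC(1,2)[of "compC (compC k (den x)) h"] by (simp_all add: c_def)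
  note [simp] = c(1,3)
  define i where "i = coliftC k (num x)"
  have i: "mo i" "mval (cokC k) \<cdot> mval i = mval (num x)" "csrc i = ctgt (cokC k)" "ctgt i = m"
    using cokC(3)[of k "num x"] is_kernelD(7)[OF k(2)] by (simp_all add: i_def)
  define v where "v = coliftC k (compC (den x) (compC h c))"
  have v: "mo v" "mval (cokC k) \<cdot> mval v = mval (den x) \<cdot> (mval h \<cdot> mval c)" "csrc v = ctgt (cokC k)" "ctgt v = ctgt c"
    using cokC(3)[of k "compC (den x) (compC h c)"] is_cokernelD(7)[OF c(2)] by (simp_all add: v_def)
  note [simp] = v(1,3,4) i(1,3,4)
  have L: "roof (oval m) (oval (ctgt c)) (mval i) (mval v)"
    "roof (oval (ctgt c)) (oval l) (mval w \<cdot> mval c) (Ident A (oval l))"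
    "rc (mval (den x)) (mval (num x)) \<odot> (rc (mval i) (mval v) \<odot> rc (mval w \<cdot> mval c) (Ident A (oval l))) =
      rc (mval (den y)) (mval (num y))"
    by (rule Q_epi_colift[OF rv_roof[OF x] epi[unfolded cls_def] k(2) d(2) _ _ _ i(2) rv_roof[OF y]
          z[folded k_def, unfolded cls_def] _ _ _ _ _ wh(7) wh(6) c(2) _ _ _ v(2)]; simp)+
  have wc: "mo (compC w c)" "sig (mval (compC w c))" using roofD(1)[OF L(2)] by simp_all
  have V: "rv (Rcode i v) m (ctgt c)" using roofD(1)[OF L(1)] by (simp add: rv_def)
  have W: "rv (rinv (compC w c)) (ctgt c) l" using rinv(1)[OF wc] by simp
  have r: "repi_colift x y = rcomp (Rcode i v) (rinv (compC w c))"
    by (simp add: repi_colift_def Let_def k_def w_def h_def c_def i_def v_def)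
  show "rv (repi_colift x y) m l" unfolding r by (rule rcomp(1)[OF V W])
  show "cls x \<odot> cls (repi_colift x y) = cls y"
    unfolding r rcomp(2)[OF V W] rinv(2)[OF wc(1)] using L(3) by (simp add: cls_def)
qed

section \<open>Membership in Hom sets and the presentation of the quotient\<close>

lemma memC:
  assumes "m \<in> obj_codes P" "n \<in> obj_codes P" "f \<in> mor_data P"
  shows "memC (Mcode (Some m) (Some n) (Some f)) = Some (of_bool (f \<in> hom_codes A P m n))"
  using call_returns[OF mem[OF assms], of _ 0] by (simp add: memC_def)

lemma homC:
  assumes m: "m \<in> obj_codes P" and n: "n \<in> obj_codes P" and x: "x \<in> mor_data PS"
  shows "homC (Some m) (Some n) (Some x) = Some (of_bool (x \<in> hom_codes Q PS m n))"
proof -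
  obtain m' q i f e where e: "x = list_encode [m', q, i, f, e]" and d: "m' \<in> obj_codes P" "q \<in> obj_codes P"
      "i \<in> mor_data P" "f \<in> mor_data P" "e \<in> mor_data P"
    using x unfolding serre_presentation_def by auto
  have parts: "denC (Some m) (Some x) = Mcode (Some m') (Some m) (Some i)"
    "midC (Some x) = Mcode (Some m') (Some q) (Some f)"
    "quoC (Some n) (Some x) = Mcode (Some n) (Some q) (Some e)"
    unfolding denC_def midC_def quoC_def e by (simp_all add: nthC del: list_encode.simps)
  \<comment> \<open>The definition asks for some cokernel and some kernel with object in
    \<open>C\<close>, while the test inspects the computed ones; both are equivalent to membership
    in \<open>sig\<close>.\<close>
  have s: "is_mono A (obj P m') (obj P m) (mor P i) \<and> oval (ctgt (cokC (Mcode (Some m') (Some m) (Some i)))) \<in> C \<and>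
      is_epi A (obj P n) (obj P q) (mor P e) \<and> oval (csrc (kerC (Mcode (Some n) (Some q) (Some e)))) \<in> C \<longleftrightarrow>
      (mor P i, mor P f, mor P e) \<in> serre_reps A C (obj P m) (obj P n)"
    if h: "i \<in> hom_codes A P m' m" "f \<in> hom_codes A P m' q" "e \<in> hom_codes A P n q"
  proof -
    have mo: "mo (Mcode (Some m') (Some m) (Some i))" "mo (Mcode (Some m') (Some q) (Some f))"
      "mo (Mcode (Some n) (Some q) (Some e))" using h by simp_all
    have [simp]: "src (mor P i) = obj P m'" "tgt (mor P e) = obj P q" "arr (mor P f)"
      "src (mor P f) = obj P m'" "tgt (mor P f) = obj P q"
      using mo_simps[OF mo(1)] mo_simps[OF mo(2)] mo_simps[OF mo(3)] by simp_all
    note c = cokC(1,2)[OF mo(1), simplified] and k = kerC(1,2)[OF mo(3), simplified]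
    have "sig (mor P i) \<longleftrightarrow> oval (ctgt (cokC (Mcode (Some m') (Some m) (Some i)))) \<in> C"
      if i: "is_mono A (obj P m') (obj P m) (mor P i)"
    proof
      assume "sig (mor P i)"
      then have "small (mval (cokC (Mcode (Some m') (Some m) (Some i))))"
        using is_cokernelD[OF c(2)] is_monoD[OF i] unfolding sig_def by simp
      then show "oval (ctgt (cokC (Mcode (Some m') (Some m) (Some i)))) \<in> C"
        using small_epi[OF is_cokernelD(8)[OF c(2)]] by blast
    qed (use sig_mono_iff[OF i] c(2) in blast)
    moreover have "sig (mor P e) \<longleftrightarrow> oval (csrc (kerC (Mcode (Some n) (Some q) (Some e)))) \<in> C"
      if i: "is_epi A (obj P n) (obj P q) (mor P e)"
    proof
      assume "sig (mor P e)"
      then have "small (mval (kerC (Mcode (Some n) (Some q) (Some e))))"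
        using is_kernelD[OF k(2)] is_epiD[OF i] unfolding sig_def by simp
      then show "oval (csrc (kerC (Mcode (Some n) (Some q) (Some e)))) \<in> C"
        using small_mono[OF is_kernelD(8)[OF k(2)]] by blast
    qed (use sig_epi_iff[OF i] k(2) in blast)
    ultimately show ?thesis by (auto simp: serre_reps_iff)
  qed
  have x_hom: "x \<in> hom_codes Q PS m n \<longleftrightarrow> i \<in> hom_codes A P m' m \<and> f \<in> hom_codes A P m' q \<and> e \<in> hom_codes A P n q \<and>
      (mor P i, mor P f, mor P e) \<in> serre_reps A C (obj P m) (obj P n)"
    unfolding e by (rule hom_codes_PS)
  show ?thesis
  proof (cases "i \<in> hom_codes A P m' m \<and> f \<in> hom_codes A P m' q \<and> e \<in> hom_codes A P n q")
    case True
    then have mo: "mo (Mcode (Some m') (Some m) (Some i))" "mo (Mcode (Some n) (Some q) (Some e))" by simp_all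
    have ob: "ob (ctgt (cokC (Mcode (Some m') (Some m) (Some i))))" "ob (csrc (kerC (Mcode (Some n) (Some q) (Some e))))"
      using mo_simps(2)[OF cokC(1)[OF mo(1)]] mo_simps(1)[OF kerC(1)[OF mo(2)]] .
    show ?thesis
      unfolding homC_def parts memC[OF d(1) m d(3)] memC[OF d(1,2,4)] memC[OF n d(2,5)] monoC[OF mo(1)] epiC[OF mo(2)]
        thickC[OF ob(1)] thickC[OF ob(2)] guard_bool x_hom
      using True s by auto
  next
    \<comment> \<open>A membership guard already answers \<open>0\<close>, and the terms behind it,
      possibly undefined, are not evaluated.\<close>
    case False
    then show ?thesis
      unfolding homC_def parts memC[OF d(1) m d(3)] memC[OF d(1,2,4)] memC[OF n d(2,5)] guard_bool x_hom
      by auto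
  qed
qed

text \<open>Each class contains a triple whose objects and morphisms all have codes in
  \<open>P\<close>, and these assemble to a code of the class.\<close>

lemma is_presentation_PS: "is_presentation Q PS"
  unfolding is_presentation_def
proof (intro conjI)
  show "ran (obj_of PS) = Ob Q" using presentation by (simp add: is_presentation_def)
  show "dom (mor_of PS) \<subseteq> mor_data PS"
  proof
    fix x assume "x \<in> dom (mor_of PS)"
    then obtain m' q i f e m n where *: "x = list_encode [m', q, i, f, e]"
      "i \<in> hom_codes A P m' m" "f \<in> hom_codes A P m' q" "e \<in> hom_codes A P n q" by (rule dom_mor_of_PS)
    moreover have "dom (mor_of P) \<subseteq> mor_data P" using presentation by (simp add: is_presentation_def)
    ultimately show "x \<in> mor_data PS" unfolding serre_presentation_def hom_codes_def by auto
  qed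
  show "ran (mor_of PS) = (\<Union>K\<in>Ob Q. \<Union>N\<in>Ob Q. Hom Q K N)"
  proof (intro equalityI subsetI)
    fix X assume "X \<in> ran (mor_of PS)"
    then obtain x where x: "mor_of PS x = Some X" by (auto simp: ran_def)
    then have "x \<in> dom (mor_of PS)" by blast
    then obtain m' q i f e m n where *: "x = list_encode [m', q, i, f, e]"
      "i \<in> hom_codes A P m' m" "f \<in> hom_codes A P m' q" "e \<in> hom_codes A P n q"
      "(mor P i, mor P f, mor P e) \<in> serre_reps A C (obj P m) (obj P n)" by (rule dom_mor_of_PS)
    then have h: "x \<in> hom_codes Q PS m n" unfolding * hom_codes_PS by simp
    then have "X \<in> Hom Q (obj P m) (obj P n)" "m \<in> obj_codes P" "n \<in> obj_codes P"
      using x by (simp_all add: hom_codes_def mor_def)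
    then show "X \<in> (\<Union>K\<in>Ob Q. \<Union>N\<in>Ob Q. Hom Q K N)" using obj_Ob by (metis (no_types, lifting) Q_simps(1) UN_I)
  next
    fix X assume "X \<in> (\<Union>K\<in>Ob Q. \<Union>N\<in>Ob Q. Hom Q K N)"
    then obtain K N where X: "X \<in> Hom Q K N" "K \<in> Ob A" "N \<in> Ob A" by auto
    then obtain i f p where r: "(i, f, p) \<in> serre_reps A C K N" and c: "X = serre_class A C (i, f, p)"
      unfolding serre_quotient_def by (auto elim!: quotientE)
    note F = fractionD[OF serre_reps_fraction[OF r]]
    have oc: "\<exists>m\<in>obj_codes P. obj P m = L" if "L \<in> Ob A" for L
    proof -
      have "L \<in> ran (obj_of P)" using that presentation by (simp add: is_presentation_def)
      then obtain m where "obj_of P m = Some L" unfolding ran_def by blast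
      then show ?thesis by (intro bexI[of _ m]) (auto simp: obj_codes_def obj_def)
    qed
    have mc: "\<exists>c. mor_of P c = Some g" if "arr g" for g
    proof -
      have "g \<in> (\<Union>M\<in>Ob A. \<Union>N\<in>Ob A. Hom A M N)" using arr_Hom[OF that] src_Ob[OF that] tgt_Ob[OF that] by blast
      then have "g \<in> ran (mor_of P)" using presentation by (simp add: is_presentation_def)
      then show ?thesis unfolding ran_def by blast
    qed
    obtain m n m' q where o: "m \<in> obj_codes P" "obj P m = K" "n \<in> obj_codes P" "obj P n = N"
      "m' \<in> obj_codes P" "obj P m' = src i" "q \<in> obj_codes P" "obj P q = tgt p"
      using oc[OF X(2)] oc[OF X(3)] oc[OF src_Ob[OF F(2)]] oc[OF tgt_Ob[OF F(8)]] by blast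
    obtain ic fc pc where mm: "mor_of P ic = Some i" "mor_of P fc = Some f" "mor_of P pc = Some p"
      using mc[OF F(2)] mc[OF F(4)] mc[OF F(8)] by blast
    let ?x = "list_encode [m', q, ic, fc, pc]"
    have "ic \<in> hom_codes A P m' m" "fc \<in> hom_codes A P m' q" "pc \<in> hom_codes A P n q"
      using F o mm by (auto simp: hom_codes_def mor_def hom_iff)
    moreover have "mor P ic = i" "mor P fc = f" "mor P pc = p" using mm by (simp_all add: mor_def)
    ultimately have h: "?x \<in> hom_codes Q PS m n" unfolding hom_codes_PS using r o by simp
    have "mor PS ?x = X"
      unfolding mor_PS[OF h] using c \<open>mor P ic = i\<close> \<open>mor P fc = f\<close> \<open>mor P pc = p\<close> by simp
    moreover have "?x \<in> dom (mor_of PS)" using h unfolding hom_codes_def by blast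
    then obtain Y where "mor_of PS ?x = Some Y" by blast
    ultimately have "mor_of PS ?x = Some X" unfolding mor_def by (simp only: option.sel)
    then show "X \<in> ran (mor_of PS)" by (rule ranI)
  qed
qed

lemma hom_codesD:
  assumes "x \<in> hom_codes Q PS m n"
  shows "m \<in> obj_codes P" "n \<in> obj_codes P" "mor PS x \<in> Hom Q (obj P m) (obj P n)"
  using assms by (simp_all add: hom_codes_def)

section \<open>Verification of the required algorithms\<close>

lemma tri_loc:
  assumes "mo x" "csrc x = Some m" "ctgt x = Some n"
  shows "\<exists>h\<in>hom_codes Q PS m n. tri (rloc x) = Some h \<and> mor PS h = rc (Ident A (obj P m)) (mval x)"
  using tri[of "rloc x" m n] rloc[of x] assms by simp

lemma ob_code: "ob m \<Longrightarrow> \<exists>k\<in>obj_codes P. m = Some k"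
  by (simp add: ob_def)

lemma pr_alg: "partial_recursive (\<lambda>e. opt_list (F (\<lambda>i. nth_code i e))) \<Longrightarrow> partial_recursive (alg F)"
  unfolding alg_def .

lemmas pr_alg_intros = pr_alg pr_list_Nil pr_list_Cons pr_nth_code pr_tri pr_homC pr_tests prm_code prr_code
  prr_roofC prr_ops prr_lifts pr_ops pr_call pr_algs

theorem constructively_abelian_serre_quotient: "constructively_abelian Q PS"
proof (intro constructively_abelian.intro abelian_category_serre_quotient constructively_abelian_axioms.intro
    is_presentation_PS; (unfold presentation_simps Q_simps)?)
  show "\<exists>a. partial_recursive a \<and> (\<forall>m\<in>obj_codes P. \<exists>i\<in>hom_codes Q PS m m.
      returns a [m] [i] \<and> mor PS i = Ident Q (obj P m))"
  proof (intro exI conjI ballI)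
    let ?F = "\<lambda>a. [tri (rloc (idC (a 0)))]"
    show "partial_recursive (alg ?F)" by (intro pr_alg_intros)
    fix m assume m: "m \<in> obj_codes P"
    obtain h where "h \<in> hom_codes Q PS m m" "tri (rloc (idC (Some m))) = Some h"
      "mor PS h = Ident Q (obj P m)"
      using tri_loc[of "idC (Some m)" m m] m Q_Ident[of "obj P m"] by auto
    then show "\<exists>i\<in>hom_codes Q PS m m. returns (alg ?F) [m] [i] \<and> mor PS i = Ident Q (obj P m)"
      by (intro bexI[of _ h] conjI returns_alg) auto
  qed
  show "\<exists>a. partial_recursive a \<and> (\<forall>l m n. \<forall>f\<in>hom_codes Q PS l m. \<forall>g\<in>hom_codes Q PS m n.
      \<exists>h\<in>hom_codes Q PS l n. returns a [l, m, n, f, g] [h] \<and> mor PS h = mor PS f \<odot> mor PS g)"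
  proof (intro exI conjI ballI allI)
    let ?F = "\<lambda>a. [tri (rcomp (roofC (a 0) (a 1) (a 3)) (roofC (a 1) (a 2) (a 4)))]"
    show "partial_recursive (alg ?F)" by (intro pr_alg_intros)
    fix l m n f g assume f: "f \<in> hom_codes Q PS l m" and g: "g \<in> hom_codes Q PS m n"
    note r = rcomp[OF roofC(1)[OF f] roofC(1)[OF g]]
    obtain h where h: "h \<in> hom_codes Q PS l n" "mor PS h = mor PS f \<odot> mor PS g"
      "tri (rcomp (roofC (Some l) (Some m) (Some f)) (roofC (Some m) (Some n) (Some g))) = Some h"
      using tri[OF r(1)] r(2) roofC(2)[OF f] roofC(2)[OF g] by auto
    have "returns (alg ?F) [l, m, n, f, g] [h]"
      by (rule returns_alg) (simp add: h(3))
    then show "\<exists>h\<in>hom_codes Q PS l n. returns (alg ?F) [l, m, n, f, g] [h] \<and> mor PS h = mor PS f \<odot> mor PS g"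
      using h(1,2) by blast
  qed
  show "\<exists>a. partial_recursive a \<and> (\<forall>m\<in>obj_codes P. \<forall>n\<in>obj_codes P. \<forall>f\<in>mor_data PS.
      returns a [m, n, f] [of_bool (f \<in> hom_codes Q PS m n)])"
  proof (intro exI conjI ballI)
    let ?F = "\<lambda>a. [homC (a 0) (a 1) (a 2)]"
    show "partial_recursive (alg ?F)" by (intro pr_alg_intros)
    fix m n f assume d: "m \<in> obj_codes P" "n \<in> obj_codes P" "f \<in> mor_data PS"
    show "returns (alg ?F) [m, n, f] [of_bool (f \<in> hom_codes Q PS m n)]"
      by (rule returns_alg) (simp add: homC[OF d])
  qed
  show "\<exists>a. partial_recursive a \<and> (\<forall>m n. \<forall>f\<in>hom_codes Q PS m n. \<forall>g\<in>hom_codes Q PS m n.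
      returns a [m, n, f, g] [of_bool (mor PS f = mor PS g)])"
  proof (intro exI conjI ballI allI)
    \<comment> \<open>Equality is tested on the difference: over a common denominator it is zero
      exactly if its numerator is small.\<close>
    let ?F = "\<lambda>a. [smallC (num (rsub (roofC (a 0) (a 1) (a 2)) (roofC (a 0) (a 1) (a 3))))]"
    show "partial_recursive (alg ?F)" by (intro pr_alg_intros)
    fix m n f g assume f: "f \<in> hom_codes Q PS m n" and g: "g \<in> hom_codes Q PS m n"
    interpret Q: abelian_category Q by (rule abelian_category_serre_quotient)
    let ?d = "rsub (roofC (Some m) (Some n) (Some f)) (roofC (Some m) (Some n) (Some g))"
    note r = rsub[OF roofC(1)[OF f] roofC(1)[OF g], unfolded roofC(2)[OF f] roofC(2)[OF g] oval_Some]
    note hf = hom_codesD(3)[OF f, unfolded Q.hom_iff] and hg = hom_codesD(3)[OF g, unfolded Q.hom_iff]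
    have "mor PS f = mor PS g \<longleftrightarrow> cls ?d = Zero Q (obj P m) (obj P n)"
    proof
      assume "mor PS f = mor PS g"
      then show "cls ?d = Zero Q (obj P m) (obj P n)"
        using Q.minus_self[of "mor PS f"] hf r(2) by (simp add: Q.minus_def)
    next
      assume "cls ?d = Zero Q (obj P m) (obj P n)"
      then show "mor PS f = mor PS g"
        using hf hg r(2) by (intro Q.minus_eq_zero[of "mor PS f" "mor PS g"]) (simp_all add: Q.minus_def)
    qed
    also have "\<dots> \<longleftrightarrow> small (mval (num ?d))"
      using rc_zero_iff[OF rv_roof[OF r(1)]] by (simp add: cls_def)
    finally have "smallC (num ?d) = Some (of_bool (mor PS f = mor PS g))"
      using smallC[OF rvD(2)[OF r(1)]] by simp
    then show "returns (alg ?F) [m, n, f, g] [of_bool (mor PS f = mor PS g)]"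
    proof (intro returns_alg)
      fix a assume a: "\<And>i. i < length [m, n, f, g] \<Longrightarrow> a i = Some ([m, n, f, g] ! i)"
        and s: "smallC (num ?d) = Some (of_bool (mor PS f = mor PS g))"
      show "?F a = map Some [of_bool (mor PS f = mor PS g)]"
        using a[of 0] a[of 1] a[of 2] a[of 3] s by simp
    qed
  qed
  show "\<exists>a. partial_recursive a \<and> (\<forall>m n. \<forall>f\<in>hom_codes Q PS m n. \<forall>g\<in>hom_codes Q PS m n. \<exists>h\<in>hom_codes Q PS m n.
      returns a [m, n, f, g] [h] \<and> mor PS h = serre_add A C (obj P m) (obj P n) (mor PS f) (mor PS g))"
  proof (intro exI conjI ballI allI)
    let ?F = "\<lambda>a. [tri (radd (roofC (a 0) (a 1) (a 2)) (roofC (a 0) (a 1) (a 3)))]"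
    show "partial_recursive (alg ?F)" by (intro pr_alg_intros)
    fix m n f g assume f: "f \<in> hom_codes Q PS m n" and g: "g \<in> hom_codes Q PS m n"
    note r = radd[OF roofC(1)[OF f] roofC(1)[OF g], unfolded roofC(2)[OF f] roofC(2)[OF g] oval_Some]
    obtain h where h: "h \<in> hom_codes Q PS m n" "mor PS h = serre_add A C (obj P m) (obj P n) (mor PS f) (mor PS g)"
      "tri (radd (roofC (Some m) (Some n) (Some f)) (roofC (Some m) (Some n) (Some g))) = Some h"
      using tri[OF r(1)] r(2) by auto
    have "returns (alg ?F) [m, n, f, g] [h]"
      by (rule returns_alg) (simp add: h(3))
    then show "\<exists>h\<in>hom_codes Q PS m n. returns (alg ?F) [m, n, f, g] [h] \<and>
        mor PS h = serre_add A C (obj P m) (obj P n) (mor PS f) (mor PS g)"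
      using h(1,2) by blast
  qed
  show "\<exists>a. partial_recursive a \<and> (\<forall>m n. \<forall>f\<in>hom_codes Q PS m n. \<forall>g\<in>hom_codes Q PS m n. \<exists>h\<in>hom_codes Q PS m n.
      returns a [m, n, f, g] [h] \<and> mor PS h = Minus Q (obj P m) (obj P n) (mor PS f) (mor PS g))"
  proof (intro exI conjI ballI allI)
    let ?F = "\<lambda>a. [tri (rsub (roofC (a 0) (a 1) (a 2)) (roofC (a 0) (a 1) (a 3)))]"
    show "partial_recursive (alg ?F)" by (intro pr_alg_intros)
    fix m n f g assume f: "f \<in> hom_codes Q PS m n" and g: "g \<in> hom_codes Q PS m n"
    note r = rsub[OF roofC(1)[OF f] roofC(1)[OF g], unfolded roofC(2)[OF f] roofC(2)[OF g] oval_Some]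
    obtain h where h: "h \<in> hom_codes Q PS m n" "mor PS h = Minus Q (obj P m) (obj P n) (mor PS f) (mor PS g)"
      "tri (rsub (roofC (Some m) (Some n) (Some f)) (roofC (Some m) (Some n) (Some g))) = Some h"
      using tri[OF r(1)] r(2) by auto
    have "returns (alg ?F) [m, n, f, g] [h]"
      by (rule returns_alg) (simp add: h(3))
    then show "\<exists>h\<in>hom_codes Q PS m n. returns (alg ?F) [m, n, f, g] [h] \<and>
        mor PS h = Minus Q (obj P m) (obj P n) (mor PS f) (mor PS g)"
      using h(1,2) by blast
  qed
  show "\<exists>a. partial_recursive a \<and> (\<forall>m\<in>obj_codes P. \<forall>n\<in>obj_codes P. \<exists>h\<in>hom_codes Q PS m n.
      returns a [m, n] [h] \<and> mor PS h = Zero Q (obj P m) (obj P n))"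
  proof (intro exI conjI ballI)
    let ?F = "\<lambda>a. [tri (rloc (zeroC (a 0) (a 1)))]"
    show "partial_recursive (alg ?F)" by (intro pr_alg_intros)
    fix m n assume m: "m \<in> obj_codes P" and n: "n \<in> obj_codes P"
    obtain h where h: "h \<in> hom_codes Q PS m n" "tri (rloc (zeroC (Some m) (Some n))) = Some h"
      "mor PS h = Zero Q (obj P m) (obj P n)"
      using tri_loc[of "zeroC (Some m) (Some n)" m n] m n Q_Zero[of "Ident A (obj P m)" "obj P m" "obj P n"]
      by (auto simp: sig_id)
    have "returns (alg ?F) [m, n] [h]"
      by (rule returns_alg) (simp add: h(2))
    then show "\<exists>h\<in>hom_codes Q PS m n. returns (alg ?F) [m, n] [h] \<and> mor PS h = Zero Q (obj P m) (obj P n)"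
      using h(1,3) by blast
  qed
  \<comment> \<open>Objects and their codes are those of \<open>A\<close>, so the zero object of
    \<open>A\<close> is returned as it stands.\<close>
  show "\<exists>a. partial_recursive a \<and> (\<exists>z\<in>obj_codes P. returns a [] [z] \<and> is_zero_object Q (obj P z))"
    using zob pr_algs(8) Q_zero_object by blast
  show "\<exists>a b. partial_recursive a \<and> partial_recursive b \<and> (\<forall>m1\<in>obj_codes P. \<forall>m2\<in>obj_codes P.
      \<exists>p\<in>obj_codes P. \<exists>p1\<in>hom_codes Q PS p m1. \<exists>p2\<in>hom_codes Q PS p m2. returns a [m1, m2] [p, p1, p2] \<and>
        is_product Q (obj P m1) (obj P m2) (obj P p) (mor PS p1) (mor PS p2) \<and>
        (\<forall>n. \<forall>f1\<in>hom_codes Q PS n m1. \<forall>f2\<in>hom_codes Q PS n m2. \<exists>u\<in>hom_codes Q PS n p.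
          returns b [m1, m2, n, f1, f2] [u] \<and> mor PS u \<odot> mor PS p1 = mor PS f1 \<and> mor PS u \<odot> mor PS p2 = mor PS f2))"
  proof (intro exI conjI ballI)
    let ?F = "\<lambda>a. [prodC (a 0) (a 1), tri (rloc (fstC (a 0) (a 1))), tri (rloc (sndC (a 0) (a 1)))]"
    let ?G = "\<lambda>a. [tri (rpair (roofC (a 2) (a 0) (a 3)) (roofC (a 2) (a 1) (a 4)))]"
    show "partial_recursive (alg ?F)" "partial_recursive (alg ?G)" by (intro pr_alg_intros)+
    fix m1 m2 assume m: "m1 \<in> obj_codes P" "m2 \<in> obj_codes P"
    note P = prodC[of "Some m1" "Some m2", simplified, OF m]
    obtain p where p: "p \<in> obj_codes P" "prodC (Some m1) (Some m2) = Some p" using ob_code[OF P(1)] by blast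
    obtain p1 where p1: "p1 \<in> hom_codes Q PS p m1" "tri (rloc (fstC (Some m1) (Some m2))) = Some p1"
      "mor PS p1 = rc (Ident A (obj P p)) (mval (fstC (Some m1) (Some m2)))"
      using tri_loc[of "fstC (Some m1) (Some m2)" p m1] P(2) p by auto
    obtain p2 where p2: "p2 \<in> hom_codes Q PS p m2" "tri (rloc (sndC (Some m1) (Some m2))) = Some p2"
      "mor PS p2 = rc (Ident A (obj P p)) (mval (sndC (Some m1) (Some m2)))"
      using tri_loc[of "sndC (Some m1) (Some m2)" p m2] P(3) p by auto
    have "returns (alg ?F) [m1, m2] [p, p1, p2]"
      by (rule returns_alg) (simp add: p p1 p2)
    moreover have "is_product Q (obj P m1) (obj P m2) (obj P p) (mor PS p1) (mor PS p2)"
      using Q_is_product[OF P(4)] p(2) p1(3) p2(3) by simp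
    moreover have "\<exists>u\<in>hom_codes Q PS n p.
        returns (alg ?G) [m1, m2, n, f1, f2] [u] \<and> mor PS u \<odot> mor PS p1 = mor PS f1 \<and> mor PS u \<odot> mor PS p2 = mor PS f2"
      if f: "f1 \<in> hom_codes Q PS n m1" "f2 \<in> hom_codes Q PS n m2" for n f1 f2
    proof -
      note r = rpair[OF roofC(1)[OF f(1)] roofC(1)[OF f(2)], unfolded roofC(2)[OF f(1)] roofC(2)[OF f(2)]
          rloc(2)[OF P(2)] rloc(2)[OF P(3)] p(2) op_src_tgt oval_Some, folded p1(3) p2(3)]
      obtain u where u: "u \<in> hom_codes Q PS n p" "mor PS u \<odot> mor PS p1 = mor PS f1" "mor PS u \<odot> mor PS p2 = mor PS f2"
        "tri (rpair (roofC (Some n) (Some m1) (Some f1)) (roofC (Some n) (Some m2) (Some f2))) = Some u"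
        using tri[OF r(1)] r(2,3) by auto
      have "returns (alg ?G) [m1, m2, n, f1, f2] [u]"
        by (rule returns_alg) (simp add: u(4))
      then show ?thesis using u(1-3) by blast
    qed
    ultimately show "\<exists>p\<in>obj_codes P. \<exists>p1\<in>hom_codes Q PS p m1. \<exists>p2\<in>hom_codes Q PS p m2.
        returns (alg ?F) [m1, m2] [p, p1, p2] \<and>
        is_product Q (obj P m1) (obj P m2) (obj P p) (mor PS p1) (mor PS p2) \<and>
        (\<forall>n. \<forall>f1\<in>hom_codes Q PS n m1. \<forall>f2\<in>hom_codes Q PS n m2. \<exists>u\<in>hom_codes Q PS n p.
          returns (alg ?G) [m1, m2, n, f1, f2] [u] \<and>
          mor PS u \<odot> mor PS p1 = mor PS f1 \<and> mor PS u \<odot> mor PS p2 = mor PS f2)"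
      using p(1) p1(1) p2(1) by blast
  qed
  show "\<exists>a b. partial_recursive a \<and> partial_recursive b \<and> (\<forall>m n. \<forall>f\<in>hom_codes Q PS m n.
      \<exists>k\<in>obj_codes P. \<exists>i\<in>hom_codes Q PS k m. returns a [m, n, f] [k, i] \<and>
        is_kernel Q (obj P m) (obj P n) (mor PS f) (obj P k) (mor PS i) \<and>
        (\<forall>l. \<forall>t\<in>hom_codes Q PS l m. mor PS t \<odot> mor PS f = Zero Q (obj P l) (obj P n) \<longrightarrow>
          (\<exists>u\<in>hom_codes Q PS l k. returns b [m, n, f, l, t] [u] \<and> mor PS u \<odot> mor PS i = mor PS t)))"
  proof (intro exI conjI ballI allI)
    let ?k = "\<lambda>x. compC (kerC (num x)) (den x)"
    let ?F = "\<lambda>a. [csrc (kerC (num (roofC (a 0) (a 1) (a 2)))), tri (rloc (?k (roofC (a 0) (a 1) (a 2))))]"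
    let ?G = "\<lambda>a. [tri (rlift (roofC (a 0) (a 1) (a 2)) (roofC (a 3) (a 0) (a 4)))]"
    show "partial_recursive (alg ?F)" "partial_recursive (alg ?G)" by (intro pr_alg_intros)+
    fix m n f assume f: "f \<in> hom_codes Q PS m n"
    define x where "x = roofC (Some m) (Some n) (Some f)"
    note x = roofC[OF f, folded x_def]
    note [simp] = rvD[OF x(1)]
    note K = kerC(1,2)[of "num x", simplified]
    note [simp] = K(1)
    obtain k where k: "k \<in> obj_codes P" "csrc (kerC (num x)) = Some k" using ob_code[of "csrc (kerC (num x))"] by auto
    obtain i where i: "i \<in> hom_codes Q PS k m" "tri (rloc (?k x)) = Some i"
      "mor PS i = rc (Ident A (obj P k)) (mval (kerC (num x)) \<cdot> mval (den x))"
      using tri_loc[of "?k x" k m] k(2) by auto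
    have "returns (alg ?F) [m, n, f] [k, i]"
      by (rule returns_alg) (simp add: k(2) i(2) flip: x_def)
    moreover have "is_kernel Q (obj P m) (obj P n) (mor PS f) (obj P k) (mor PS i)"
      using Q_is_kernel[OF rv_roof[OF x(1)], of "obj P k" "mval (kerC (num x))"] K(2) k(2) i(3) x(2)
      by (simp add: cls_def)
    moreover have "\<exists>u\<in>hom_codes Q PS l k. returns (alg ?G) [m, n, f, l, t] [u] \<and> mor PS u \<odot> mor PS i = mor PS t"
      if t: "t \<in> hom_codes Q PS l m" and z: "mor PS t \<odot> mor PS f = Zero Q (obj P l) (obj P n)" for l t
    proof -
      note y = roofC[OF t]
      have z': "cls (roofC (Some l) (Some m) (Some t)) \<odot> cls x = Zero Q (oval (Some l)) (oval (Some n))"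
        using z by (simp add: x(2) y(2))
      note r = rlift[OF x(1) y(1) z', unfolded y(2) k(2) oval_Some, folded i(3)]
      obtain u where u: "u \<in> hom_codes Q PS l k" "mor PS u \<odot> mor PS i = mor PS t"
        "tri (rlift x (roofC (Some l) (Some m) (Some t))) = Some u"
        using tri[OF r(1)] r(2) by auto
      have "returns (alg ?G) [m, n, f, l, t] [u]"
        by (rule returns_alg) (simp add: u(3) flip: x_def)
      then show ?thesis using u(1,2) by blast
    qed
    ultimately show "\<exists>k\<in>obj_codes P. \<exists>i\<in>hom_codes Q PS k m. returns (alg ?F) [m, n, f] [k, i] \<and>
        is_kernel Q (obj P m) (obj P n) (mor PS f) (obj P k) (mor PS i) \<and>
        (\<forall>l. \<forall>t\<in>hom_codes Q PS l m. mor PS t \<odot> mor PS f = Zero Q (obj P l) (obj P n) \<longrightarrow>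
          (\<exists>u\<in>hom_codes Q PS l k. returns (alg ?G) [m, n, f, l, t] [u] \<and> mor PS u \<odot> mor PS i = mor PS t))"
      using k(1) i(1) by blast
  qed
  show "\<exists>a b. partial_recursive a \<and> partial_recursive b \<and> (\<forall>m n. \<forall>f\<in>hom_codes Q PS m n.
      \<exists>c\<in>obj_codes P. \<exists>e\<in>hom_codes Q PS n c. returns a [m, n, f] [c, e] \<and>
        is_cokernel Q (obj P m) (obj P n) (mor PS f) (obj P c) (mor PS e) \<and>
        (\<forall>l. \<forall>t\<in>hom_codes Q PS n l. mor PS f \<odot> mor PS t = Zero Q (obj P m) (obj P l) \<longrightarrow>
          (\<exists>u\<in>hom_codes Q PS c l. returns b [m, n, f, l, t] [u] \<and> mor PS e \<odot> mor PS u = mor PS t)))"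
  proof (intro exI conjI ballI allI)
    \<comment> \<open>The denominator is invertible in the quotient, so the cokernel of the
      numerator is returned.\<close>
    let ?F = "\<lambda>a. [ctgt (cokC (num (roofC (a 0) (a 1) (a 2)))), tri (rloc (cokC (num (roofC (a 0) (a 1) (a 2)))))]"
    let ?G = "\<lambda>a. [tri (rcolift (roofC (a 0) (a 1) (a 2)) (roofC (a 1) (a 3) (a 4)))]"
    show "partial_recursive (alg ?F)" "partial_recursive (alg ?G)" by (intro pr_alg_intros)+
    fix m n f assume f: "f \<in> hom_codes Q PS m n"
    define x where "x = roofC (Some m) (Some n) (Some f)"
    note x = roofC[OF f, folded x_def]
    note [simp] = rvD[OF x(1)]
    note K = cokC(1,2)[of "num x", simplified]
    note [simp] = K(1)
    obtain k where k: "k \<in> obj_codes P" "ctgt (cokC (num x)) = Some k" using ob_code[of "ctgt (cokC (num x))"] by auto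
    obtain i where i: "i \<in> hom_codes Q PS n k" "tri (rloc (cokC (num x))) = Some i"
      "mor PS i = rc (Ident A (obj P n)) (mval (cokC (num x)))"
      using tri_loc[of "cokC (num x)" n k] k(2) by auto
    have "returns (alg ?F) [m, n, f] [k, i]"
      by (rule returns_alg) (simp add: k(2) i(2) flip: x_def)
    moreover have "is_cokernel Q (obj P m) (obj P n) (mor PS f) (obj P k) (mor PS i)"
      using Q_is_cokernel[OF rv_roof[OF x(1)], of "obj P k" "mval (cokC (num x))"] K(2) k(2) i(3) x(2)
      by (simp add: cls_def)
    moreover have "\<exists>u\<in>hom_codes Q PS k l. returns (alg ?G) [m, n, f, l, t] [u] \<and> mor PS i \<odot> mor PS u = mor PS t"
      if t: "t \<in> hom_codes Q PS n l" and z: "mor PS f \<odot> mor PS t = Zero Q (obj P m) (obj P l)" for l t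
    proof -
      note y = roofC[OF t]
      have z': "cls x \<odot> cls (roofC (Some n) (Some l) (Some t)) = Zero Q (oval (Some m)) (oval (Some l))"
        using z by (simp add: x(2) y(2))
      note r = rcolift[OF x(1) y(1) z', unfolded y(2) k(2) oval_Some, folded i(3)]
      obtain u where u: "u \<in> hom_codes Q PS k l" "mor PS i \<odot> mor PS u = mor PS t"
        "tri (rcolift x (roofC (Some n) (Some l) (Some t))) = Some u"
        using tri[OF r(1)] r(2) by auto
      have "returns (alg ?G) [m, n, f, l, t] [u]"
        by (rule returns_alg) (simp add: u(3) flip: x_def)
      then show ?thesis using u(1,2) by blast
    qed
    ultimately show "\<exists>c\<in>obj_codes P. \<exists>e\<in>hom_codes Q PS n c. returns (alg ?F) [m, n, f] [c, e] \<and>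
        is_cokernel Q (obj P m) (obj P n) (mor PS f) (obj P c) (mor PS e) \<and>
        (\<forall>l. \<forall>t\<in>hom_codes Q PS n l. mor PS f \<odot> mor PS t = Zero Q (obj P m) (obj P l) \<longrightarrow>
          (\<exists>u\<in>hom_codes Q PS c l. returns (alg ?G) [m, n, f, l, t] [u] \<and> mor PS e \<odot> mor PS u = mor PS t))"
      using k(1) i(1) by blast
  qed
  show "\<exists>a. partial_recursive a \<and>
      (\<forall>k m c l. \<forall>i\<in>hom_codes Q PS k m. \<forall>f\<in>hom_codes Q PS m c. \<forall>t\<in>hom_codes Q PS l m.
        is_mono Q (obj P k) (obj P m) (mor PS i) \<longrightarrow>
        is_cokernel Q (obj P k) (obj P m) (mor PS i) (obj P c) (mor PS f) \<longrightarrow>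
        mor PS t \<odot> mor PS f = Zero Q (obj P l) (obj P c) \<longrightarrow>
        (\<exists>u\<in>hom_codes Q PS l k. returns a [k, m, c, l, i, f, t] [u] \<and> mor PS u \<odot> mor PS i = mor PS t))"
  proof (intro exI conjI ballI allI impI)
    \<comment> \<open>Positions 4 and 6 hold \<open>i\<close> and \<open>t\<close>, with ends at
      positions 0, 1 and 3, 1.\<close>
    let ?F = "\<lambda>a. [tri (rmono_lift (roofC (a 0) (a 1) (a 4)) (roofC (a 3) (a 1) (a 6)))]"
    show "partial_recursive (alg ?F)" by (intro pr_alg_intros)
    fix k m c l i f t
    assume i: "i \<in> hom_codes Q PS k m" and f: "f \<in> hom_codes Q PS m c" and t: "t \<in> hom_codes Q PS l m"
      and mono: "is_mono Q (obj P k) (obj P m) (mor PS i)"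
      and cok: "is_cokernel Q (obj P k) (obj P m) (mor PS i) (obj P c) (mor PS f)"
      and z: "mor PS t \<odot> mor PS f = Zero Q (obj P l) (obj P c)"
    define x where "x = roofC (Some k) (Some m) (Some i)"
    note x = roofC[OF i, folded x_def] and y = roofC[OF t]
    note [simp] = rvD[OF x(1)]
    note K = cokC(1,2)[of "num x", simplified]
    have "is_cokernel Q (obj P k) (obj P m) (mor PS i) (oval (ctgt (cokC (num x)))) (rc (Ident A (obj P m)) (mval (cokC (num x))))"
      using Q_is_cokernel[OF rv_roof[OF x(1)], of "oval (ctgt (cokC (num x)))" "mval (cokC (num x))"] K(2) x(2)
      by (simp add: cls_def)
    \<comment> \<open>The vanishing condition refers to the given cokernel and is moved to the
      computed one, for which the lift is constructed.\<close>
    then have "mor PS t \<odot> rc (Ident A (obj P m)) (mval (cokC (num x))) = Zero Q (obj P l) (oval (ctgt (cokC (num x))))"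
      by (intro cokernel_annihilates[OF cok hom_codesD(3)[OF t] z]) (simp_all add: is_cokernel_def)
    then have z': "cls (roofC (Some l) (Some m) (Some t)) \<odot> rc (Ident A (oval (Some m))) (mval (cokC (num x))) =
        Zero Q (oval (Some l)) (oval (ctgt (cokC (num x))))" by (simp add: y(2))
    note r = rmono_lift[OF x(1) y(1) _ z', unfolded x(2) y(2) oval_Some, OF mono]
    obtain u where u: "u \<in> hom_codes Q PS l k" "mor PS u \<odot> mor PS i = mor PS t"
      "tri (rmono_lift x (roofC (Some l) (Some m) (Some t))) = Some u"
      using tri[OF r(1)] r(2) by auto
    have "returns (alg ?F) [k, m, c, l, i, f, t] [u]"
      by (rule returns_alg) (simp add: u(3) flip: x_def)
    then show "\<exists>u\<in>hom_codes Q PS l k. returns (alg ?F) [k, m, c, l, i, f, t] [u] \<and> mor PS u \<odot> mor PS i = mor PS t"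
      using u(1,2) by blast
  qed
  show "\<exists>a. partial_recursive a \<and>
      (\<forall>k n c l. \<forall>e\<in>hom_codes Q PS n c. \<forall>f\<in>hom_codes Q PS k n. \<forall>t\<in>hom_codes Q PS n l.
        is_epi Q (obj P n) (obj P c) (mor PS e) \<longrightarrow>
        is_kernel Q (obj P n) (obj P c) (mor PS e) (obj P k) (mor PS f) \<longrightarrow>
        mor PS f \<odot> mor PS t = Zero Q (obj P k) (obj P l) \<longrightarrow>
        (\<exists>u\<in>hom_codes Q PS c l. returns a [k, n, c, l, e, f, t] [u] \<and> mor PS e \<odot> mor PS u = mor PS t))"
  proof (intro exI conjI ballI allI impI)
    \<comment> \<open>Positions 4 and 6 hold \<open>e\<close> and \<open>t\<close>, which share the
      source at position 1.\<close>
    let ?F = "\<lambda>a. [tri (repi_colift (roofC (a 1) (a 2) (a 4)) (roofC (a 1) (a 3) (a 6)))]"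
    show "partial_recursive (alg ?F)" by (intro pr_alg_intros)
    fix k n c l e f t
    assume e: "e \<in> hom_codes Q PS n c" and f: "f \<in> hom_codes Q PS k n" and t: "t \<in> hom_codes Q PS n l"
      and epi: "is_epi Q (obj P n) (obj P c) (mor PS e)"
      and ker: "is_kernel Q (obj P n) (obj P c) (mor PS e) (obj P k) (mor PS f)"
      and z: "mor PS f \<odot> mor PS t = Zero Q (obj P k) (obj P l)"
    define x where "x = roofC (Some n) (Some c) (Some e)"
    note x = roofC[OF e, folded x_def] and y = roofC[OF t]
    note [simp] = rvD[OF x(1)]
    note K = kerC(1,2)[of "num x", simplified]
    let ?K = "oval (csrc (kerC (num x)))" and ?k = "mval (kerC (num x)) \<cdot> mval (den x)"
    have "is_kernel Q (obj P n) (obj P c) (mor PS e) ?K (rc (Ident A ?K) ?k)"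
      using Q_is_kernel[OF rv_roof[OF x(1)], of ?K "mval (kerC (num x))"] K(2) x(2) by (simp add: cls_def)
    then have "rc (Ident A ?K) ?k \<odot> mor PS t = Zero Q ?K (obj P l)"
      by (intro kernel_annihilates[OF ker hom_codesD(3)[OF t] z]) (simp_all add: is_kernel_def)
    then have z': "rc (Ident A ?K) ?k \<odot> cls (roofC (Some n) (Some l) (Some t)) = Zero Q ?K (oval (Some l))"
      by (simp add: y(2))
    note r = repi_colift[OF x(1) y(1) _ z', unfolded x(2) y(2) oval_Some, OF epi]
    obtain u where u: "u \<in> hom_codes Q PS c l" "mor PS e \<odot> mor PS u = mor PS t"
      "tri (repi_colift x (roofC (Some n) (Some l) (Some t))) = Some u"
      using tri[OF r(1)] r(2) by auto
    have "returns (alg ?F) [k, n, c, l, e, f, t] [u]"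
      by (rule returns_alg) (simp add: u(3) flip: x_def)
    then show "\<exists>u\<in>hom_codes Q PS c l. returns (alg ?F) [k, n, c, l, e, f, t] [u] \<and> mor PS e \<odot> mor PS u = mor PS t"
      using u(1,2) by blast
  qed
qed

end

theorem theorem1p1:
  fixes A :: "('o, 'm) category_data" and P :: "('o, 'm) presentation" and C :: "'o set"
  assumes "constructively_abelian A P"
    and "thick A C"
    and "\<exists>a. decides_objects P C a"
  shows "constructively_abelian (serre_quotient A C) (serre_presentation A C P)"
proof -
  interpret constructively_abelian A P by fact
  \<comment> \<open>Choice turns each existence statement into a fixed algorithm; the nested uses
    select pairs, such as a kernel algorithm and its lift, that belong together.\<close>
  note id = someI_ex[OF alg_ident] and comp = someI_ex[OF alg_comp] and mem = someI_ex[OF alg_hom_membership]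
    and eq = someI_ex[OF alg_hom_equality] and add = someI_ex[OF alg_add] and sub = someI_ex[OF alg_minus]
    and zero = someI_ex[OF alg_zero] and zob = someI_ex[OF alg_zero_object]
    and prod = someI_ex[OF someI_ex[OF alg_product]] and ker = someI_ex[OF someI_ex[OF alg_kernel]]
    and cok = someI_ex[OF someI_ex[OF alg_cokernel]]
    and thickd = someI_ex[OF assms(3), unfolded decides_objects_def]
  show ?thesis
    by (rule serre_codes.constructively_abelian_serre_quotient, rule serre_codes.intro,
      rule thick_subcategory.intro[OF abelian_category_axioms thick_subcategory_axioms.intro[OF assms(2)]],
      rule serre_codes_axioms.intro[OF presentation id[THEN conjunct1] comp[THEN conjunct1] mem[THEN conjunct1]
        eq[THEN conjunct1] add[THEN conjunct1] sub[THEN conjunct1] zero[THEN conjunct1] zob[THEN conjunct1]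
        prod[THEN conjunct1] prod[THEN conjunct2, THEN conjunct1] ker[THEN conjunct1]
        ker[THEN conjunct2, THEN conjunct1] cok[THEN conjunct1] cok[THEN conjunct2, THEN conjunct1]
        thickd[THEN conjunct1] id[THEN conjunct2, rule_format] comp[THEN conjunct2, rule_format]
        mem[THEN conjunct2, rule_format] eq[THEN conjunct2, rule_format] add[THEN conjunct2, rule_format]
        sub[THEN conjunct2, rule_format] zero[THEN conjunct2, rule_format] zob[THEN conjunct2]
        prod[THEN conjunct2, THEN conjunct2, rule_format] ker[THEN conjunct2, THEN conjunct2, rule_format]
        cok[THEN conjunct2, THEN conjunct2, rule_format] thickd[THEN conjunct2, rule_format]])
qed

end
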